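(* Let $Y=(Y_x)_{x\in\mathbb{Z}^2}$ be i.i.d. exponential random variables with mean $1$, and let $\{B^\rho\}_{1<\rho<\infty}$ be the Busemann process of the exponential corner growth model with weights $Y$. Let $1<\rho_1<\dots<\rho_n$. For $t\in\mathbb{Z}$ and $\rho\in(1,\infty)$ let $\overline Y_t=(Y_{(k,t)})_{k\in\mathbb{Z}}$ and $\overline B^{\rho,e_1}_t=(B^\rho_{(k-1,t),(k,t)})_{k\in\mathbb{Z}}$. Then at each level $t\in\mathbb{Z}$, the $(n+1)$-tuple of sequences $(\overline Y_t,\overline B^{\rho_1,e_1}_t,\dots,\overline B^{\rho_n,e_1}_t)$ has distribution $\mu^{(1,\rho_1,\dots,\rho_n)}$.
   Context: Notation: $e_1=(1,0)$, $e_2=(0,1)$, coordinatewise order on $\mathbb{Z}^2$, $a\wedge b=\min(a,b)$. Last-passage values: for $u\le v$ in $\mathbb{Z}^2$, $G_{u,v}=\max\sum_iY_{x_i}$, the maximum over nearest-neighbor paths from $u$ to $v$ with steps in $\{e_1,e_2\}$ (endpoints included). Busemann process (existence known): a process $\{B^\rho_{x,y}:x,y\in\mathbb{Z}^2,\ \rho\in(1,\infty)\}$, cadlag in $\rho$, a Borel function of $Y$, such that: for fixed $\rho$, with $u(\rho)=-\bigl(\frac1{1+(\rho-1)^2},\frac{(\rho-1)^2}{1+(\rho-1)^2}\bigr)$, almost surely $B^\rho_{x,y}=\lim_{n\to\infty}[G_{u_n,y}-G_{u_n,x}]$ for every sequence $u_n\in\mathbb{Z}^2$ with $|u_n|_1\to\infty$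 and $u_n/n\to u(\rho)$; and on a single event of probability one, for all $x,y,z$ and all $\lambda<\rho$ in $(1,\infty)$: $B^\lambda_{x,x+e_1}\le B^\rho_{x,x+e_1}$, $B^\lambda_{x,x+e_2}\ge B^\rho_{x,x+e_2}$, $B^\rho_{x,y}+B^\rho_{y,z}=B^\rho_{x,z}$, $Y_x=B^\rho_{x-e_1,x}\wedge B^\rho_{x-e_2,x}$. For fixed $\rho$, $B^\rho$ is stationary under lattice shifts, $B^\rho_{x-e_1,x}$ is exponential with rate $\rho^{-1}$, $B^\rho_{x-e_2,x}$ is exponential with rate $1-\rho^{-1}$, and increments $B^\rho_{y_k,y_{k+1}}$ along any down-right path ($y_{k+1}-y_k\in\{e_1,-e_2\}$) are independent. Queueing map. For $I,\omega\in\mathbb{R}_{\ge0}^{\mathbb{Z}}$ with $\lim_{m\to-\infty}\sum_{i=m}^0(\omega_i-I_{i+1})=-\infty$, choose any $G:\mathbb{Z}\to\mathbb{R}$ with $I_k=G_k-G_{k-1}$, put $\widetilde G_\ell=\sup_{k\le\ell}\{G_k+\sum_{i=k}^\ell\omega_i\}$, and define $D(I,\omega)=(\widetilde G_\ell-\widetilde G_{\ell-1})_{\ell\in\mathbb{Z}}$ (independent of the choice of $G$). Let $D^{(1)}(\zeta)=\zeta$ and $D^{(m)}(\zeta^1,\dots,\zeta^m)=D\bigl(D^{(m-1)}(\zeta^1,\dots,\zeta^{m-1}),\zeta^m\bigr)$ for $m\ge2$. Measure $\mu^\sigma$. For $\sigma=(\sigma_1,\dots,\sigma_m)$ with $0<\sigma_1<\dots<\sigma_m$,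 let $I=(I^1,\dots,I^m)\in(\mathbb{R}_{\ge0}^{\mathbb{Z}})^m$ have all coordinates $I^i_k$ independent, $I^i_k$ exponential with mean $\sigma_i$. Then $\mu^\sigma$ is the distribution of $(\eta^1,\dots,\eta^m)$ where $\eta^i=D^{(i)}(I^i,I^{i-1},\dots,I^1)$, $i=1,\dots,m$ (almost surely well-defined). *)

theory Defs
  imports "HOL-Probability.Probability"
begin

type_synonym site = "int \<times> int"

definition e1 :: site where "e1 = (1, 0)"
definition e2 :: site where "e2 = (0, 1)"

definition up_right_paths :: "site \<Rightarrow> site \<Rightarrow> site list set" where
  "up_right_paths u v =
     {p. p \<noteq> [] \<and> hd p = u \<and> last p = v \<and> successively (\<lambda>x y. y - x \<in> {e1, e2}) p}"

text \<open>Only meaningful when \<open>u \<le> v\<close> coordinatewise; otherwise there is no path and the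
  maximum is over the empty set.\<close>

definition last_passage :: "(site \<Rightarrow> real) \<Rightarrow> site \<Rightarrow> site \<Rightarrow> real" where
  "last_passage w u v = Max ((\<lambda>p. \<Sum>x\<leftarrow>p. w x) ` up_right_paths u v)"

definition busemann_direction :: "real \<Rightarrow> real \<times> real" where
  "busemann_direction \<rho> =
     - (1 / (1 + (\<rho> - 1)\<^sup>2), (\<rho> - 1)\<^sup>2 / (1 + (\<rho> - 1)\<^sup>2))"

text \<open>\<open>B \<rho> x y \<omega>\<close> is constrained only for \<open>\<rho> \<in> (1, \<infinity>)\<close>.  The law of the weights \<open>Y\<close> is
  not part of this locale.  Down-right paths are taken bi-infinite; every finite or one-sided
  path extends to such a path.\<close>

locale busemann_process = prob_space M
  for M :: "'w measure" +
  fixes Y :: "site \<Rightarrow> 'w \<Rightarrow> real"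
    and B :: "real \<Rightarrow> site \<Rightarrow> site \<Rightarrow> 'w \<Rightarrow> real"
  assumes borel_function_of_weights:
    "\<And>\<rho> x y. 1 < \<rho> \<Longrightarrow>
       \<exists>f \<in> borel_measurable (\<Pi>\<^sub>M z\<in>(UNIV :: site set). (borel :: real measure)).
         \<forall>\<omega>\<in>space M. B \<rho> x y \<omega> = f (\<lambda>z. Y z \<omega>)"
    and cadlag:
    "AE \<omega> in M. \<forall>x y \<rho>. 1 < \<rho> \<longrightarrow>
       ((\<lambda>r. B r x y \<omega>) \<longlongrightarrow> B \<rho> x y \<omega>) (at_right \<rho>) \<and>
       (\<exists>l. ((\<lambda>r. B r x y \<omega>) \<longlongrightarrow> l) (at_left \<rho>))"
    and busemann_limit:
    "\<And>\<rho>. 1 < \<rho> \<Longrightarrow> AE \<omega> in M. \<forall>x y. \<forall>u :: nat \<Rightarrow> site.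
       filterlim (\<lambda>n. \<bar>fst (u n)\<bar> + \<bar>snd (u n)\<bar>) at_top sequentially \<longrightarrow>
       (\<lambda>n. (real_of_int (fst (u n)) / real n, real_of_int (snd (u n)) / real n))
         \<longlonglongrightarrow> busemann_direction \<rho> \<longrightarrow>
       (\<lambda>n. last_passage (\<lambda>z. Y z \<omega>) (u n) y - last_passage (\<lambda>z. Y z \<omega>) (u n) x)
         \<longlonglongrightarrow> B \<rho> x y \<omega>"
    and monotone_additive_recovery:
    "AE \<omega> in M. \<forall>x y z \<kappa> \<rho>. 1 < \<kappa> \<longrightarrow> \<kappa> < \<rho> \<longrightarrow>
       B \<kappa> x (x + e1) \<omega> \<le> B \<rho> x (x + e1) \<omega> \<and>
       B \<kappa> x (x + e2) \<omega> \<ge> B \<rho> x (x + e2) \<omega> \<and>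
       B \<rho> x y \<omega> + B \<rho> y z \<omega> = B \<rho> x z \<omega> \<and>
       Y x \<omega> = min (B \<rho> (x - e1) x \<omega>) (B \<rho> (x - e2) x \<omega>)"
    and stationary:
    "\<And>\<rho> a. 1 < \<rho> \<Longrightarrow>
       distr M (\<Pi>\<^sub>M q\<in>(UNIV :: (site \<times> site) set). borel)
           (\<lambda>\<omega> (x, y). B \<rho> (x + a) (y + a) \<omega>) =
       distr M (\<Pi>\<^sub>M q\<in>(UNIV :: (site \<times> site) set). borel)
           (\<lambda>\<omega> (x, y). B \<rho> x y \<omega>)"
    and horizontal_exponential:
    "\<And>\<rho> x. 1 < \<rho> \<Longrightarrow>
       distributed M lborel (B \<rho> (x - e1) x) (exponential_density (inverse \<rho>))"
    and vertical_exponential: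
    "\<And>\<rho> x. 1 < \<rho> \<Longrightarrow>
       distributed M lborel (B \<rho> (x - e2) x) (exponential_density (1 - inverse \<rho>))"
    and down_right_independent:
    "\<And>\<rho> (p :: int \<Rightarrow> site). 1 < \<rho> \<Longrightarrow> (\<And>k. p (k + 1) - p k \<in> {e1, - e2}) \<Longrightarrow>
       indep_vars (\<lambda>_. borel) (\<lambda>k. B \<rho> (p k) (p (k + 1))) UNIV"

definition queue_domain :: "((int \<Rightarrow> real) \<times> (int \<Rightarrow> real)) set" where
  "queue_domain = {(I, w). (\<forall>k. 0 \<le> I k) \<and> (\<forall>k. 0 \<le> w k) \<and>
     filterlim (\<lambda>m. \<Sum>i=m..0. w i - I (i + 1)) at_bot at_bot}"

definition queue_sup :: "(int \<Rightarrow> real) \<Rightarrow> (int \<Rightarrow> real) \<Rightarrow> int \<Rightarrow> real" where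
  "queue_sup G w l = (SUP k\<in>{..l}. G k + (\<Sum>i=k..l. w i))"

text \<open>Totalised by the zero sequence off the domain.  The choice of \<open>G\<close> is immaterial, see
  \<open>queue_map_eq\<close> below.\<close>

definition queue_map :: "(int \<Rightarrow> real) \<Rightarrow> (int \<Rightarrow> real) \<Rightarrow> int \<Rightarrow> real" where
  "queue_map I w =
     (if (I, w) \<in> queue_domain then
        let G = (SOME G. \<forall>k. I k = G k - G (k - 1))
        in (\<lambda>l. queue_sup G w l - queue_sup G w (l - 1))
      else (\<lambda>_. 0))"

text \<open>The iterated map takes its arguments \<open>\<zeta>\<^sup>1, \<dots>, \<zeta>\<^sup>m\<close> as a nonempty list.\<close>

definition queue_map_iter :: "(int \<Rightarrow> real) list \<Rightarrow> int \<Rightarrow> real" where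
  "queue_map_iter zs = foldl queue_map (hd zs) (tl zs)"

lemma queue_map_iter_single: "queue_map_iter [z] = z"
  by (simp add: queue_map_iter_def)

lemma queue_map_iter_snoc:
  "zs \<noteq> [] \<Longrightarrow> queue_map_iter (zs @ [z]) = queue_map (queue_map_iter zs) z"
  by (simp add: queue_map_iter_def)

lemma queue_sup_bdd_above:
  assumes dom: "(I, w) \<in> queue_domain" and G: "\<And>k. I k = G k - G (k - 1)"
  shows "bdd_above ((\<lambda>k. G k + (\<Sum>i=k..l. w i)) ` {..l})"
proof -
  have shift: "(\<Sum>i=m..0. I (i + 1)) = G 1 - G m" if "m \<le> 1" for m :: int
    using that
  proof (induction m rule: int_le_induct)
    case base
    then show ?case by simp
  next
    case (step m)
    have "{m - 1..0} = insert (m - 1) {m..0}" using step by auto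
    then show ?case using step G[of m] by simp
  qed
  have "eventually (\<lambda>m. (\<Sum>i=m..0. w i - I (i + 1)) \<le> 0) at_bot"
    using dom by (auto simp: queue_domain_def filterlim_at_bot)
  then obtain N where N: "\<And>m. m \<le> N \<Longrightarrow> (\<Sum>i=m..0. w i - I (i + 1)) \<le> 0"
    by (auto simp: eventually_at_bot_linorder)
  define N' where "N' = min N 0"
  have w0: "\<And>i. 0 \<le> w i" using dom by (auto simp: queue_domain_def)
  let ?f = "\<lambda>k. G k + (\<Sum>i=k..l. w i)"
  have far: "?f k \<le> G 1 + (\<Sum>i=0..l. w i)" if "k \<le> N'" for k
  proof -
    have k: "k \<le> 0" "k \<le> N" using that by (auto simp: N'_def)
    have "(\<Sum>i=k..l. w i) \<le> (\<Sum>i\<in>{k..0} \<union> {0..l}. w i)"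
      by (rule sum_mono2) (auto simp: w0)
    also have "\<dots> \<le> (\<Sum>i=k..0. w i) + (\<Sum>i=0..l. w i)"
      using sum.union_inter[of "{k..0}" "{0..l}" w] sum_nonneg[of "{k..0} \<inter> {0..l}" w] w0
      by simp
    finally show ?thesis
      using N[OF k(2)] shift[of k] k by (simp add: sum_subtractf)
  qed
  have "bdd_above (?f ` {N'..l})" by simp
  moreover have "bdd_above (?f ` {..N'})"
    using far by (auto simp: bdd_above_def)
  ultimately have "bdd_above (?f ` {N'..l} \<union> ?f ` {..N'})" by simp
  moreover have "?f ` {..l} \<subseteq> ?f ` {N'..l} \<union> ?f ` {..N'}"
  proof -
    have "{..l} \<subseteq> {N'..l} \<union> {..N'}" by auto
    from image_mono[OF this, of ?f] show ?thesis by (simp only: image_Un)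
  qed
  ultimately show ?thesis by (rule bdd_above_mono)
qed

lemma queue_map_eq:
  assumes dom: "(I, w) \<in> queue_domain" and G: "\<And>k. I k = G k - G (k - 1)"
  shows "queue_map I w l = queue_sup G w l - queue_sup G w (l - 1)"
proof -
  define H where "H = (SOME G. \<forall>k. I k = G k - G (k - 1))"
  have "\<forall>k. I k = H k - H (k - 1)"
    unfolding H_def by (rule someI[where x = G]) (intro allI G)
  then have H: "\<And>k. I k = H k - H (k - 1)" ..
  have step: "H k - G k = H (k - 1) - G (k - 1)" for k
    using H[of k] G[of k] by linarith
  define c where "c = H 0 - G 0"
  have c: "H k = c + G k" for k
  proof (induction k rule: int_induct[of _ 0])
    case base
    then show ?case by (simp add: c_def)
  next
    case (step1 i)
    then show ?case using step[of "i + 1"] by simp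
  next
    case (step2 i)
    then show ?case using step[of i] by simp
  qed
  have "queue_sup H w j = c + queue_sup G w j" for j
  proof -
    let ?f = "\<lambda>k. G k + (\<Sum>i=k..j. w i)"
    have bdd: "bdd_above (?f ` {..j})"
      by (rule queue_sup_bdd_above[OF dom G])
    have ub: "?f k \<le> (SUP k\<in>{..j}. ?f k)" if "k \<in> {..j}" for k
      by (rule cSUP_upper[OF that bdd])
    have "(SUP k\<in>{..j}. c + ?f k) = c + (SUP k\<in>{..j}. ?f k)"
    proof (rule cSup_eq_non_empty)
      show "(\<lambda>k. c + ?f k) ` {..j} \<noteq> {}" by simp
      show "x \<le> c + (SUP k\<in>{..j}. ?f k)" if "x \<in> (\<lambda>k. c + ?f k) ` {..j}" for x
        using that ub by force
      show "c + (SUP k\<in>{..j}. ?f k) \<le> y"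
        if y: "\<And>x. x \<in> (\<lambda>k. c + ?f k) ` {..j} \<Longrightarrow> x \<le> y" for y
      proof -
        have "(SUP k\<in>{..j}. ?f k) \<le> y - c"
        proof (rule cSUP_least)
          show "?f k \<le> y - c" if "k \<in> {..j}" for k
            using y[OF imageI[OF that]] by linarith
        qed simp
        then show ?thesis by linarith
      qed
    qed
    then show ?thesis by (simp add: queue_sup_def c add.assoc)
  qed
  then show ?thesis using dom by (simp add: queue_map_def H_def[symmetric])
qed

definition exponential_law :: "real \<Rightarrow> real measure" where
  "exponential_law m = density lborel (exponential_density (inverse m))"
  \<comment> \<open>\<open>m\<close> is the mean\<close>

abbreviation sequence_space :: "(int \<Rightarrow> real) measure" where
  "sequence_space \<equiv> (\<Pi>\<^sub>M k\<in>UNIV. borel)"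

text \<open>Tuples are indexed from \<open>0\<close>: with \<open>m = length \<sigma>\<close>, the components \<open>\<eta>\<^sup>1, \<dots>, \<eta>\<^sup>m\<close> sit at
  positions \<open>0, \<dots>, m - 1\<close>, and position \<open>i\<close> holds the iterated map applied to
  \<open>[I i, I (i - 1), \<dots>, I 0]\<close>.\<close>

definition multiclass_measure :: "real list \<Rightarrow> (nat \<Rightarrow> int \<Rightarrow> real) measure" where
  "multiclass_measure \<sigma> =
     distr (\<Pi>\<^sub>M i\<in>{..<length \<sigma>}. \<Pi>\<^sub>M k\<in>(UNIV :: int set). exponential_law (\<sigma> ! i))
           (\<Pi>\<^sub>M i\<in>{..<length \<sigma>}. sequence_space)
           (\<lambda>I. \<lambda>i\<in>{..<length \<sigma>}. queue_map_iter (map I (rev [0..<Suc i])))"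

end

theory Submission
  imports Defs
begin

text \<open>Put independent exponential rows \<open>I\<^sup>1, \<dots>, I\<^sup>n\<close> with means \<open>\<rho>\<^sub>1, \<dots>, \<rho>\<^sub>n\<close> below
  \<open>N\<close> rows of the weights \<open>Y\<close> and let \<open>\<eta>\<^sup>i = D\<^sup>(\<^sup>i\<^sup>)(I\<^sup>i, \<dots>, I\<^sup>1)\<close> evolve through these \<open>N\<close> rows.  The
  queueing map satisfies \<open>D(D(x, z), w) = D(D(x, R(z, w)), D(z, w))\<close>, and by Burke's theorem
  \<open>(D, R)(z, w)\<close> is again a pair of independent exponential rows.  Pushing the lowest \<open>Y\<close>-row down
  through all the \<open>I\<close>-rows therefore removes it without changing the joint law of the top row and
  the evolved sequences, so that this law is \<open>\<mu>\<close> for every \<open>N \<ge> 1\<close>.  On the other hand, the evolved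
  \<open>\<eta>\<^sup>i\<close> converges in probability to the Busemann row of parameter \<open>\<rho>\<^sub>i\<close> as \<open>N\<close> grows: the
  maximising paths of the problems with parameters \<open>\<kappa>' < \<rho>\<^sub>i < \<kappa>\<close> leave the initial level at
  separated places, so a path crossing argument squeezes the increments of the evolved sequence
  between those of \<open>B\<close> at \<open>\<kappa>'\<close> and \<open>\<kappa>\<close>, whose means differ by \<open>\<kappa> - \<kappa>'\<close>.\<close>

subsection \<open>Queues on the integer line\<close>

text \<open>The hypotheses give the law of the Busemann functions only one parameter at a time;
  different parameters are linked by monotonicity and by the common weights. Each probabilistic
  estimate is therefore brought down to a single parameter. For the exit points: if the path of
  parameter \<rho> leaves on the wrong side of column j, the passage increment of \<rho> from j is
  at most that of \<kappa>. With j on the characteristic of \<kappa> this is unlikely, because the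
  means differ the other way by a multiple of N, and each increment is a row sum plus a column sum
  of independent exponential variables, so that Chernoff bounds apply. The evolved sequence is not a
  Busemann row, but by Burke's theorem it enters the Y-rows as an independent exponential row,
  exactly like the Busemann row of the same mean, which is a function of the weights weakly below
  its level. Boundary and weights thus have the same joint law in both problems, and exit
  probabilities carry over.\<close>

definition potential :: "(int \<Rightarrow> real) \<Rightarrow> int \<Rightarrow> real" where
  "potential x k = (if 0 \<le> k then \<Sum>i=1..k. x i else - (\<Sum>i=k+1..0. x i))"

lemma potential_0 [simp]: "potential x 0 = 0"
  by (simp add: potential_def)

lemma potential_step: "x k = potential x k - potential x (k - 1)"
proof (cases "1 \<le> k")
  case True
  then have "{1..k} = insert k {1..k-1}" by auto
  then show ?thesis using True by (simp add: potential_def)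
next
  case False
  then have "{k..0} = insert k {k+1..0}" by auto
  then show ?thesis using False by (cases "k = 0") (simp_all add: potential_def)
qed

lemma sum_telescope:
  fixes G :: "int \<Rightarrow> real"
  assumes G: "\<And>k. x k = G k - G (k - 1)" and "j \<le> k + 1"
  shows "(\<Sum>i=j..k. x i) = G k - G (j - 1)"
proof -
  have "(\<Sum>i=j..j + int n - 1. x i) = G (j + int n - 1) - G (j - 1)" for n
  proof (induction n)
    case (Suc n)
    have "{j..j + int (Suc n) - 1} = insert (j + int n) {j..j + int n - 1}" by auto
    then show ?case using Suc G[of "j + int n"] by simp
  qed simp
  from this[of "nat (k + 1 - j)"] show ?thesis using assms(2) by simp
qed

lemma potential_unique:
  fixes G :: "int \<Rightarrow> real"
  assumes G: "\<And>k. x k = G k - G (k - 1)"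
  shows "potential x k = G k - G 0"
  using sum_telescope[of x G 1 k, OF G] sum_telescope[of x G "k + 1" 0, OF G]
  by (auto simp: potential_def)

lemma sum_potential: "j \<le> k + 1 \<Longrightarrow> (\<Sum>i=j..k. x i) = potential x k - potential x (j - 1)"
  by (rule sum_telescope[where G = "potential x"]) (rule potential_step)

text \<open>Only the behaviour at \<open>-\<infinity>\<close> matters for stability, so \<open>drift\<close> says nothing about positive times.\<close>

definition drift :: "(int \<Rightarrow> real) \<Rightarrow> real \<Rightarrow> bool" where
  "drift G a \<longleftrightarrow> (\<forall>\<epsilon>>0. \<exists>C. \<forall>k\<le>0. \<bar>G k - a * of_int k\<bar> \<le> C - \<epsilon> * of_int k)"

lemma driftD:
  assumes "drift G a" "0 < \<epsilon>"
  obtains C where "\<And>k. k \<le> 0 \<Longrightarrow> \<bar>G k - a * of_int k\<bar> \<le> C - \<epsilon> * of_int k"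
  using assms unfolding drift_def by meson

text \<open>The combination \<open>F + G - H + d\<close> is the shape in which conservation laws
  occur; with \<open>F = G = H\<close> it also shows that adding a constant keeps the slope.\<close>

lemma drift_add_diff:
  assumes "drift F a" "drift G b" "drift H c"
  shows "drift (\<lambda>k. F k + G k - H k + d) (a + b - c)"
  unfolding drift_def
proof (intro allI impI)
  fix \<epsilon> :: real assume "0 < \<epsilon>"
  then have e: "0 < \<epsilon> / 3" by simp
  obtain A where A: "\<And>k. k \<le> 0 \<Longrightarrow> \<bar>F k - a * of_int k\<bar> \<le> A - \<epsilon> / 3 * of_int k"
    using driftD[OF assms(1) e] by blast
  obtain B where B: "\<And>k. k \<le> 0 \<Longrightarrow> \<bar>G k - b * of_int k\<bar> \<le> B - \<epsilon> / 3 * of_int k"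
    using driftD[OF assms(2) e] by blast
  obtain C where C: "\<And>k. k \<le> 0 \<Longrightarrow> \<bar>H k - c * of_int k\<bar> \<le> C - \<epsilon> / 3 * of_int k"
    using driftD[OF assms(3) e] by blast
  show "\<exists>K. \<forall>k\<le>0. \<bar>F k + G k - H k + d - (a + b - c) * real_of_int k\<bar> \<le> K - \<epsilon> * real_of_int k"
  proof (intro exI allI impI)
    fix k :: int assume "k \<le> 0"
    have "(a + b - c) * real_of_int k = a * of_int k + b * of_int k - c * of_int k"
      "\<epsilon> * real_of_int k = 3 * (\<epsilon> / 3 * of_int k)" by (simp_all add: algebra_simps)
    with A[OF \<open>k \<le> 0\<close>] B[OF \<open>k \<le> 0\<close>] C[OF \<open>k \<le> 0\<close>]
    show "\<bar>F k + G k - H k + d - (a + b - c) * real_of_int k\<bar> \<le> (A + B + C + \<bar>d\<bar>) - \<epsilon> * real_of_int k"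
      by linarith
  qed
qed

lemma drift_unique:
  assumes "drift G a" "drift G b" shows "a = b"
proof (rule ccontr)
  assume "a \<noteq> b"
  then have e: "0 < \<bar>a - b\<bar> / 4" by simp
  obtain A where A: "\<And>k. k \<le> 0 \<Longrightarrow> \<bar>G k - a * of_int k\<bar> \<le> A - \<bar>a - b\<bar> / 4 * of_int k"
    using driftD[OF assms(1) e] by blast
  obtain B where B: "\<And>k. k \<le> 0 \<Longrightarrow> \<bar>G k - b * of_int k\<bar> \<le> B - \<bar>a - b\<bar> / 4 * of_int k"
    using driftD[OF assms(2) e] by blast
  obtain n :: nat where n: "2 * (A + B) / \<bar>a - b\<bar> < of_nat n"
    using reals_Archimedean2 by blast
  have "\<bar>a - b\<bar> * real n = \<bar>a * real n - b * real n\<bar>"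
    by (simp add: abs_mult flip: left_diff_distrib)
  also have "\<dots> \<le> A + B + \<bar>a - b\<bar> / 2 * real n"
  proof -
    have "\<bar>G (- int n) + a * real n\<bar> \<le> A + \<bar>a - b\<bar> / 4 * real n"
      "\<bar>G (- int n) + b * real n\<bar> \<le> B + \<bar>a - b\<bar> / 4 * real n"
      using A[of "- int n"] B[of "- int n"] by simp_all
    moreover have "\<bar>a - b\<bar> / 2 * real n = \<bar>a - b\<bar> / 4 * real n + \<bar>a - b\<bar> / 4 * real n" by simp
    ultimately show ?thesis by (smt (verit))
  qed
  finally have "\<bar>a - b\<bar> * real n \<le> 2 * (A + B)" by simp
  moreover have "2 * (A + B) < \<bar>a - b\<bar> * real n"
    using n \<open>a \<noteq> b\<close> by (simp add: field_simps)
  ultimately show False by simp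
qed

text \<open>The deterministic trace of an i.i.d. row of mean \<open>a\<close>: the law of large
  numbers gives this property almost surely, and the identities between queues are then proved
  pathwise from it.\<close>

definition good :: "(int \<Rightarrow> real) \<Rightarrow> real \<Rightarrow> bool" where
  "good x a \<longleftrightarrow> (\<forall>k. 0 \<le> x k) \<and> drift (potential x) a"

lemma good_nonneg: "good x a \<Longrightarrow> 0 \<le> x k"
  by (simp add: good_def)

lemma good_drift:
  assumes "good x a" "\<And>k. x k = G k - G (k - 1)"
  shows "drift G a"
proof -
  have "drift (\<lambda>k. potential x k + potential x k - potential x k + G 0) (a + a - a)"
    using assms(1) by (intro drift_add_diff) (auto simp: good_def)
  then show ?thesis using potential_unique[of x G, OF assms(2)] by simp
qed

lemma goodI:
  assumes "\<And>k. 0 \<le> x k" "\<And>k. x k = G k - G (k - 1)" "drift G a"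
  shows "good x a"
proof -
  have "drift (\<lambda>k. G k + G k - G k + - G 0) (a + a - a)"
    using assms(3) by (intro drift_add_diff)
  moreover have "potential x = (\<lambda>k. G k - G 0)"
    using potential_unique[of x G, OF assms(2)] by blast
  ultimately show ?thesis using assms(1) by (simp add: good_def)
qed

section \<open>A single stable queue\<close>

definition sojourn :: "(int \<Rightarrow> real) \<Rightarrow> (int \<Rightarrow> real) \<Rightarrow> int \<Rightarrow> real" where
  "sojourn I w l = queue_sup (potential I) w l - potential I l"

text \<open>Fixed by conservation: arrivals plus services equal departures plus rest. In a stable
  queue it is the smaller of the interarrival time and the previous sojourn time, which is how it
  enters Burke's theorem.\<close>

definition queue_rest :: "(int \<Rightarrow> real) \<Rightarrow> (int \<Rightarrow> real) \<Rightarrow> int \<Rightarrow> real" where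
  "queue_rest I w l = I l + w l - queue_map I w l"

locale stable_queue =
  fixes I w :: "int \<Rightarrow> real" and a b :: real
  assumes I: "good I a" and w: "good w b" and ba: "b < a"
begin

text \<open>This difference is the part of the candidate \<open>G k + (\<Sum>i=k..l. w i)\<close>
  that depends on \<open>k\<close>. Its slope \<open>a - b\<close> is positive, so it falls to
  -infinity on the left and only finitely many starting points compete.\<close>

lemma upper_line:
  assumes G: "\<And>k. I k = G k - G (k - 1)" and e: "0 < \<epsilon>"
  obtains C where "\<And>k. k \<le> 0 \<Longrightarrow>
    G k - potential w (k - 1) \<le> (a - b) * of_int k - \<epsilon> * of_int k + C"
proof -
  have e2: "0 < \<epsilon> / 2" using e by simp
  obtain A where A: "\<And>k. k \<le> 0 \<Longrightarrow> \<bar>G k - a * of_int k\<bar> \<le> A - \<epsilon> / 2 * of_int k"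
    using driftD[OF good_drift[OF I G] e2] by blast
  obtain B where B: "\<And>k. k \<le> 0 \<Longrightarrow> \<bar>potential w k - b * of_int k\<bar> \<le> B - \<epsilon> / 2 * of_int k"
    using driftD[OF _ e2, of "potential w" b] w unfolding good_def by blast
  show ?thesis
  proof (rule that[of "A + B + b + \<epsilon> / 2"])
    fix k :: int assume "k \<le> 0"
    have "b * real_of_int (k - 1) = b * of_int k - b" "(a - b) * real_of_int k = a * of_int k - b * of_int k"
      "\<epsilon> * real_of_int k = 2 * (\<epsilon> / 2 * of_int k)" "\<epsilon> / 2 * real_of_int (k - 1) = \<epsilon> / 2 * of_int k - \<epsilon> / 2"
      by (simp_all add: field_simps)
    moreover have "G k - a * of_int k \<le> A - \<epsilon> / 2 * of_int k"
      by (rule abs_le_D1[OF A]) fact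
    moreover have "- (potential w (k - 1) - b * of_int (k - 1)) \<le> B - \<epsilon> / 2 * of_int (k - 1)"
      by (rule abs_le_D2[OF B]) (use \<open>k \<le> 0\<close> in simp)
    ultimately show "G k - potential w (k - 1) \<le> (a - b) * of_int k - \<epsilon> * of_int k + (A + B + b + \<epsilon> / 2)"
      by argo
  qed
qed

lemma domain: "(I, w) \<in> queue_domain"
proof -
  \<comment> \<open>Losing half of the slope \<open>a - b\<close> to the error term still leaves a
    positive slope.\<close>
  have e: "0 < (a - b) / 2" using ba by simp
  obtain C where C: "\<And>k. k \<le> 0 \<Longrightarrow> potential I k - potential w (k - 1) \<le> (a - b) * of_int k - (a - b) / 2 * of_int k + C"
    using upper_line[where G = "potential I", OF potential_step e] by blast
  have eq: "(\<Sum>i=m..0. w i - I (i + 1)) = potential I m - potential w (m - 1) - potential I 1" if "m \<le> 0" for m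
  proof -
    have "(\<Sum>i=m..0. w i) = potential w 0 - potential w (m - 1)"
      using that by (intro sum_potential) simp
    moreover have "(\<Sum>i=m..0. I (i + 1)) = potential I (0 + 1) - potential I (m - 1 + 1)"
      by (rule sum_telescope[of _ "\<lambda>k. potential I (k + 1)"])
        (use that potential_step[of I "_ + 1"] in \<open>auto\<close>)
    ultimately show ?thesis by (simp add: sum_subtractf)
  qed
  have "filterlim (\<lambda>m. (\<Sum>i=m..0. w i - I (i + 1))) at_bot at_bot"
    unfolding filterlim_at_bot
  proof
    fix Z :: real
    show "\<forall>\<^sub>F m in at_bot. (\<Sum>i=m..0. w i - I (i + 1)) \<le> Z"
      unfolding eventually_at_bot_linorder
    proof (intro exI allI impI)
      let ?n = "min 0 (\<lfloor>2 * (Z - C + potential I 1) / (a - b)\<rfloor>)"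
      fix m :: int assume m: "m \<le> ?n"
      then have "real_of_int m \<le> 2 * (Z - C + potential I 1) / (a - b)" by linarith
      then have "(a - b) / 2 * real_of_int m \<le> Z - C + potential I 1"
        using ba by (simp add: field_simps)
      moreover have "(a - b) * real_of_int m = 2 * ((a - b) / 2 * of_int m)" by simp
      moreover have "m \<le> 0" using m by simp
      ultimately show "(\<Sum>i=m..0. w i - I (i + 1)) \<le> Z"
        using C[of m] eq[of m] by linarith
    qed
  qed
  then show ?thesis using I w by (auto simp: queue_domain_def good_def)
qed

context
  fixes G :: "int \<Rightarrow> real"
  assumes G: "\<And>k. I k = G k - G (k - 1)"
begin

lemma queue_sup_upper:
  "k \<le> l \<Longrightarrow> G k + (\<Sum>i=k..l. w i) \<le> queue_sup G w l"
  unfolding queue_sup_def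
  by (rule cSUP_upper) (use queue_sup_bdd_above[OF domain G] in auto)

text \<open>Below \<open>m\<close> every candidate is beaten by the candidate \<open>k = l\<close>,
  so the supremum is a maximum over the finite window from \<open>m\<close> to
  \<open>l\<close>.\<close>

lemma queue_sup_attained:
  "\<exists>k\<le>l. queue_sup G w l = G k + (\<Sum>i=k..l. w i)"
proof -
  let ?f = "\<lambda>k. G k + (\<Sum>i=k..l. w i)"
  have fW: "?f k = G k - potential w (k - 1) + potential w l" if "k \<le> l" for k
    using sum_potential[of k l w] that by simp
  have e: "0 < (a - b) / 2" using ba by simp
  obtain C where C: "\<And>k. k \<le> 0 \<Longrightarrow> G k - potential w (k - 1) \<le> (a - b) * of_int k - (a - b) / 2 * of_int k + C"
    using upper_line[OF G e] by blast
  define m where "m = min (min 0 l) (\<lfloor>2 * (?f l - C - potential w l) / (a - b)\<rfloor>)"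
  have far: "?f k \<le> ?f l" if "k \<le> m" for k
  proof -
    have "real_of_int k \<le> 2 * (?f l - C - potential w l) / (a - b)" using that unfolding m_def by linarith
    then have "(a - b) / 2 * real_of_int k \<le> ?f l - C - potential w l"
      using ba by (simp add: field_simps)
    moreover have "(a - b) * real_of_int k = 2 * ((a - b) / 2 * of_int k)" by simp
    moreover have "k \<le> 0" "k \<le> l" using that by (simp_all add: m_def)
    ultimately show ?thesis using C[of k] fW[of k] by linarith
  qed
  have ne: "?f ` {m..l} \<noteq> {}" "finite (?f ` {m..l})" by (auto simp: m_def)
  from Max_in[OF ne(2,1)] obtain k where k: "k \<in> {m..l}" "?f k = Max (?f ` {m..l})"
    by (auto simp: image_iff)
  have max: "?f j \<le> ?f k" if "j \<le> l" for j
  proof (cases "m \<le> j")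
    case True
    then show ?thesis using that k(2) ne(2) by auto
  next
    case False
    then have "?f j \<le> ?f l" using far by auto
    also have "l \<in> {m..l}" by (auto simp: m_def)
    then have "?f l \<le> ?f k" unfolding k(2) by (intro Max_ge[OF ne(2)] imageI)
    finally show ?thesis .
  qed
  have "queue_sup G w l = ?f k"
    unfolding queue_sup_def using k(1) max by (intro cSup_eq_maximum) auto
  then show ?thesis using k(1) by auto
qed

text \<open>Lindley's recursion for departure times: the service of customer \<open>l\<close> begins
  at its arrival \<open>G l\<close> or at the previous departure, whichever is later.\<close>

lemma queue_sup_rec:
  "queue_sup G w l = w l + max (queue_sup G w (l - 1)) (G l)"
proof (rule antisym)
  obtain k where k: "k \<le> l" "queue_sup G w l = G k + (\<Sum>i=k..l. w i)"
    using queue_sup_attained by blast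
  have split: "(\<Sum>i=j..l. w i) = (\<Sum>i=j..l-1. w i) + w l" if "j \<le> l" for j
    using sum_potential[of j l w] sum_potential[of j "l-1" w]
      potential_step[of w l] that by simp
  show "queue_sup G w l \<le> w l + max (queue_sup G w (l - 1)) (G l)"
    using k split[OF k(1)] queue_sup_upper[of k "l - 1"] by (cases "k = l") auto
  have "G l + w l \<le> queue_sup G w l" using queue_sup_upper[of l l] by simp
  moreover obtain j where j: "j \<le> l - 1" "queue_sup G w (l - 1) = G j + (\<Sum>i=j..l-1. w i)"
    using queue_sup_attained by blast
  then have "queue_sup G w (l - 1) + w l \<le> queue_sup G w l"
    using queue_sup_upper[of j l] split[of j] by simp
  ultimately show "w l + max (queue_sup G w (l - 1)) (G l) \<le> queue_sup G w l" by simp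
qed

lemma drift_queue_sup: "drift (queue_sup G w) a"
  unfolding drift_def
proof (intro allI impI)
  fix \<epsilon> :: real assume "0 < \<epsilon>"
  \<comment> \<open>\<open>d \<le> a - b\<close> keeps the coefficient \<open>a - b - d\<close>
    nonnegative, so that the maximising \<open>k\<close> may be replaced by \<open>l\<close>;
    \<open>2 * d \<le> \<epsilon>\<close> leaves room for both error terms.\<close>
  define d where "d = min (\<epsilon> / 2) (a - b)"
  have d: "0 < d" "d \<le> a - b" "2 * d \<le> \<epsilon>"
    using \<open>0 < \<epsilon>\<close> ba by (auto simp: d_def min_def)
  obtain A where A: "\<And>k. k \<le> 0 \<Longrightarrow> \<bar>G k - a * of_int k\<bar> \<le> A - \<epsilon> * of_int k"
    using driftD[OF good_drift[OF I G] \<open>0 < \<epsilon>\<close>] by blast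
  obtain B where B: "\<And>k. k \<le> 0 \<Longrightarrow> \<bar>potential w k - b * of_int k\<bar> \<le> B - d * of_int k"
    using driftD[OF _ d(1), of "potential w" b] w unfolding good_def by blast
  obtain C where C: "\<And>k. k \<le> 0 \<Longrightarrow> G k - potential w (k - 1) \<le> (a - b) * of_int k - d * of_int k + C"
    using upper_line[OF G d(1)] by blast
  show "\<exists>K. \<forall>l\<le>0. \<bar>queue_sup G w l - a * of_int l\<bar> \<le> K - \<epsilon> * of_int l"
  proof (intro exI allI impI)
    fix l :: int assume l: "l \<le> 0"
    have "G l \<le> queue_sup G w l" using queue_sup_upper[of l l] good_nonneg[OF w, of l] by simp
    then have lo: "a * of_int l - (A - \<epsilon> * of_int l) \<le> queue_sup G w l" using A[OF l] by linarith
    obtain k where k: "k \<le> l" "queue_sup G w l = G k + (\<Sum>i=k..l. w i)"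
      using queue_sup_attained by blast
    have "queue_sup G w l = G k - potential w (k - 1) + potential w l"
      using k sum_potential[of k l w] by simp
    also have "\<dots> \<le> (a - b - d) * of_int k + C + (b * of_int l + B - d * of_int l)"
      using C[of k] B[of l] k l by (simp add: algebra_simps)
    also have "(a - b - d) * real_of_int k \<le> (a - b - d) * of_int l"
      using d k by (intro mult_left_mono) auto
    finally have "queue_sup G w l \<le> a * of_int l - (2 * d) * of_int l + (C + B)"
      by (simp add: algebra_simps)
    moreover have "\<epsilon> * real_of_int l \<le> (2 * d) * of_int l"
      using d l by (intro mult_right_mono_neg) auto
    moreover have "0 \<le> - \<epsilon> * real_of_int l" using l \<open>0 < \<epsilon>\<close> by (simp add: mult_nonneg_nonpos)
    ultimately show "\<bar>queue_sup G w l - a * of_int l\<bar> \<le> (\<bar>A\<bar> + \<bar>B + C\<bar>) - \<epsilon> * of_int l"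
      using lo by (simp add: algebra_simps abs_le_iff)
  qed
qed

end

lemmas Isup_rec = queue_sup_rec[where G = "potential I", OF potential_step]

lemma queue_map_potential:
  "queue_map I w k = queue_sup (potential I) w k - queue_sup (potential I) w (k - 1)"
  by (rule queue_map_eq[where G = "potential I", OF domain]) (rule potential_step)

text \<open>The server is idle from the previous departure until the arrival of customer
  \<open>l\<close>, if that comes later; this idle time is
  \<open>I l - sojourn I w (l - 1)\<close>.\<close>

lemma queue_map_sojourn: "queue_map I w l = w l + max (I l - sojourn I w (l - 1)) 0"
  using Isup_rec[of l] potential_step[of I l]
  unfolding queue_map_potential sojourn_def by auto

lemma sojourn_rec: "sojourn I w l = w l + max (sojourn I w (l - 1) - I l) 0"
  using Isup_rec[of l] potential_step[of I l] unfolding sojourn_def by auto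

lemma sojourn_nonneg: "0 \<le> sojourn I w l"
  using good_nonneg[OF w, of l] sojourn_rec[of l] by linarith

lemma queue_rest_eq: "queue_rest I w l = min (I l) (sojourn I w (l - 1))"
  unfolding queue_rest_def queue_map_sojourn by auto

lemma good_queue_map: "good (queue_map I w) a"
proof (rule goodI)
  show "0 \<le> queue_map I w k" for k
    unfolding queue_map_sojourn using good_nonneg[OF w, of k] by simp
  show "queue_map I w k = queue_sup (potential I) w k - queue_sup (potential I) w (k - 1)" for k
    by (rule queue_map_potential)
  show "drift (queue_sup (potential I) w) a"
    by (rule drift_queue_sup) (rule potential_step)
qed

text \<open>By conservation the slope is \<open>a + b - a\<close>: the departures keep the slope
  \<open>a\<close> of the arrivals, so the rest inherits that of the services.\<close>

lemma good_queue_rest: "good (queue_rest I w) b"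
proof (rule goodI)
  show "0 \<le> queue_rest I w k" for k
    using good_nonneg[OF I, of k] sojourn_nonneg by (simp add: queue_rest_eq)
  show "queue_rest I w k =
      (potential I k + potential w k - potential (queue_map I w) k + 0) -
      (potential I (k - 1) + potential w (k - 1) - potential (queue_map I w) (k - 1) + 0)" for k
    using potential_step[of I k] potential_step[of w k] potential_step[of "queue_map I w" k]
    by (simp add: queue_rest_def)
  have "drift (\<lambda>k. potential I k + potential w k - potential (queue_map I w) k + 0) (a + b - a)"
    by (rule drift_add_diff) (use I w good_queue_map in \<open>auto simp: good_def\<close>)
  then show "drift (\<lambda>k. potential I k + potential w k - potential (queue_map I w) k + 0) b" by simp
qed

end

section \<open>Two queues in series and their interchange\<close>

primrec two_row :: "(int \<Rightarrow> real) \<Rightarrow> (int \<Rightarrow> real) \<Rightarrow> int \<Rightarrow> nat \<Rightarrow> real" where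
  "two_row z w k 0 = z k + w k"
| "two_row z w k (Suc n) =
     w (k + int (Suc n)) + max (two_row z w k n) (\<Sum>i=k..k + int (Suc n). z i)"

lemma sum_int_Suc:
  fixes z :: "int \<Rightarrow> real"
  shows "(\<Sum>i=k..k + int (Suc n). z i) = (\<Sum>i=k..k + int n. z i) + z (k + int (Suc n))"
proof -
  have "{k..k + int (Suc n)} = insert (k + int (Suc n)) {k..k + int n}" by auto
  then show ?thesis by simp
qed

lemma sum_int_last:
  fixes z :: "int \<Rightarrow> real"
  shows "k \<le> l \<Longrightarrow> (\<Sum>i=k..l. z i) = (\<Sum>i=k..l - 1. z i) + z l"
proof -
  assume "k \<le> l"
  then have "{k..l} = insert l {k..l - 1}" by auto
  then show ?thesis by simp
qed

text \<open>With the next lemma this identifies \<open>two_row z w k n\<close> as the last-passage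
  value over two rows, from column \<open>k\<close> of \<open>z\<close> to column
  \<open>k + n\<close> of \<open>w\<close>, where \<open>j\<close> is the column of the upward
  step.\<close>

lemma two_row_upper:
  "k \<le> j \<Longrightarrow> j \<le> k + int n \<Longrightarrow> (\<Sum>i=k..j. z i) + (\<Sum>i=j..k + int n. w i) \<le> two_row z w k n"
proof (induction n)
  case (Suc n)
  show ?case
  proof (cases "j = k + int (Suc n)")
    case True
    then show ?thesis by simp
  next
    case False
    then have "j \<le> k + int n" using Suc.prems by simp
    from Suc.IH[OF Suc.prems(1) this] sum_int_last[of j "k + int (Suc n)" w] Suc.prems(2)
    show ?thesis by (simp add: algebra_simps)
  qed
qed simp

lemma two_row_attained:
  "\<exists>j. k \<le> j \<and> j \<le> k + int n \<and> two_row z w k n = (\<Sum>i=k..j. z i) + (\<Sum>i=j..k + int n. w i)"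
proof (induction n)
  case 0
  show ?case by (intro exI[of _ k]) simp
next
  case (Suc n)
  then obtain j where j: "k \<le> j" "j \<le> k + int n"
    "two_row z w k n = (\<Sum>i=k..j. z i) + (\<Sum>i=j..k + int n. w i)" by blast
  show ?case
  proof (cases "two_row z w k n \<le> (\<Sum>i=k..k + int (Suc n). z i)")
    case True
    then show ?thesis by (intro exI[of _ "k + int (Suc n)"]) (simp add: max_def)
  next
    case False
    then show ?thesis using j sum_int_last[of j "k + int (Suc n)" w]
      by (intro exI[of _ j]) (simp add: max_def algebra_simps)
  qed
qed

text \<open>The interchange of two servers.  It holds for every solution \<open>J\<close> of the sojourn recursion,
  because on each window starting at \<open>k\<close> the sojourn time \<open>J\<close> is a function of \<open>J (k - 1)\<close>, the row sums
  and the two-row passage time, see \<open>inv\<close> below.\<close>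

lemma two_row_swap:
  assumes R: "\<And>l. R l = min (z l) (J (l - 1))"
    and J: "\<And>l. J l = w l + max (J (l - 1) - z l) 0"
    and D: "\<And>l. D l = w l + max (z l - J (l - 1)) (0::real)"
  shows "two_row R D k n = two_row z w k n"
proof -
  let ?S = "\<lambda>x n. \<Sum>i=k..k + int n. x i"
  have inv: "J (k + int n) = max (J (k - 1) + ?S w n - ?S z n) (two_row z w k n - ?S z n) \<and>
      ?S R n = J (k - 1) + ?S w n - J (k + int n) \<and> two_row R D k n = two_row z w k n" for n
  proof (induction n)
    case 0
    show ?case using R[of k] J[of k] D[of k] by auto
  next
    case (Suc n)
    define l where "l = k + int (Suc n)"
    have l1: "l - 1 = k + int n" by (simp add: l_def)
    note S = sum_int_Suc[of _ k n, folded l_def]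
    have tr: "two_row z w k (Suc n) = w l + max (two_row z w k n) (?S z n + z l)"
         "two_row R D k (Suc n) = D l + max (two_row R D k n) (?S R n + R l)"
      by (simp_all only: two_row.simps S flip: l_def)
    show ?case unfolding tr S l_def[symmetric]
      using Suc R[of l] J[of l] D[of l] unfolding l1 by (auto simp: max_def min_def split: if_splits)
  qed
  then show ?thesis by blast
qed

text \<open>Two queues in series take the maximum over \<open>k\<close> of
  \<open>potential x k\<close> plus a two-row passage time from \<open>k\<close>. The services enter
  only through that passage time, so they may be exchanged for another pair of rows with the same
  passage times.\<close>

lemma intertwining_sup_le:
  assumes q1: "stable_queue x z a b" and q2: "stable_queue (queue_map x z) w a c"
    and q3: "stable_queue x z' a b'" and q4: "stable_queue (queue_map x z') w' a c'"
    and two: "\<And>k n. two_row z w k n = two_row z' w' k n"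
  shows "queue_sup (queue_sup (potential x) z) w l \<le> queue_sup (queue_sup (potential x) z') w' l"
proof -
  have inc: "queue_map x z k = queue_sup (potential x) z k - queue_sup (potential x) z (k - 1)" for k
    by (rule stable_queue.queue_map_potential[OF q1])
  have inc': "queue_map x z' k = queue_sup (potential x) z' k - queue_sup (potential x) z' (k - 1)" for k
    by (rule stable_queue.queue_map_potential[OF q3])
  obtain j where j: "j \<le> l"
    "queue_sup (queue_sup (potential x) z) w l = queue_sup (potential x) z j + (\<Sum>i=j..l. w i)"
    using stable_queue.queue_sup_attained[OF q2 inc] by blast
  obtain k where k: "k \<le> j" "queue_sup (potential x) z j = potential x k + (\<Sum>i=k..j. z i)"
    using stable_queue.queue_sup_attained[where G = "potential x", OF q1 potential_step] by blast
  define n where "n = nat (l - k)"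
  have l: "l = k + int n" using j k by (simp add: n_def)
  obtain m where m: "k \<le> m" "m \<le> l"
    "two_row z' w' k n = (\<Sum>i=k..m. z' i) + (\<Sum>i=m..l. w' i)"
    using two_row_attained[of k n z' w'] unfolding l by blast
  have "queue_sup (queue_sup (potential x) z) w l \<le> potential x k + two_row z w k n"
    using j k two_row_upper[of k j n z w] l by simp
  also have "\<dots> = potential x k + (\<Sum>i=k..m. z' i) + (\<Sum>i=m..l. w' i)"
    using m two by simp
  also have "\<dots> \<le> queue_sup (potential x) z' m + (\<Sum>i=m..l. w' i)"
    using stable_queue.queue_sup_upper[where G = "potential x", OF q3 potential_step, of k m] m by simp
  also have "\<dots> \<le> queue_sup (queue_sup (potential x) z') w' l"
    by (rule stable_queue.queue_sup_upper[OF q4 inc' m(2)])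
  finally show ?thesis .
qed

text \<open>\<open>two_row_swap\<close> makes the two-row passage times agree before and after the
  exchange, so the composed departure times agree; two applications of the one-sided comparison give
  equality. The order \<open>c < b < a\<close> keeps every queue involved stable.\<close>

lemma queue_intertwining:
  assumes x: "good x a" and z: "good z b" and w: "good w c" and "c < b" "b < a"
  shows "queue_map (queue_map x z) w = queue_map (queue_map x (queue_rest z w)) (queue_map z w)"
proof -
  interpret q: stable_queue z w b c using assms by unfold_locales
  have q1: "stable_queue x z a b" using assms by unfold_locales
  have q2: "stable_queue (queue_map x z) w a c"
    using assms stable_queue.good_queue_map[OF q1] by unfold_locales auto
  have q3: "stable_queue x (queue_rest z w) a c"
    using assms q.good_queue_rest by unfold_locales auto
  have q4: "stable_queue (queue_map x (queue_rest z w)) (queue_map z w) a b"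
    using assms stable_queue.good_queue_map[OF q3] q.good_queue_map by unfold_locales auto
  have two: "two_row z w k n = two_row (queue_rest z w) (queue_map z w) k n" for k n
    by (rule two_row_swap[symmetric, where J = "sojourn z w"])
      (rule q.queue_rest_eq q.sojourn_rec q.queue_map_sojourn)+
  have "queue_sup (queue_sup (potential x) z) w l =
      queue_sup (queue_sup (potential x) (queue_rest z w)) (queue_map z w) l" for l
    by (rule antisym; rule intertwining_sup_le)
      (use q1 q2 q3 q4 two in \<open>auto\<close>)
  moreover have "queue_map (queue_map x z) w l =
      queue_sup (queue_sup (potential x) z) w l - queue_sup (queue_sup (potential x) z) w (l - 1)" for l
    by (rule queue_map_eq[where G = "queue_sup (potential x) z", OF stable_queue.domain[OF q2]])
      (rule stable_queue.queue_map_potential[OF q1])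
  moreover have "queue_map (queue_map x (queue_rest z w)) (queue_map z w) l =
      queue_sup (queue_sup (potential x) (queue_rest z w)) (queue_map z w) l -
      queue_sup (queue_sup (potential x) (queue_rest z w)) (queue_map z w) (l - 1)" for l
    by (rule queue_map_eq[where G = "queue_sup (potential x) (queue_rest z w)", OF stable_queue.domain[OF q4]])
      (rule stable_queue.queue_map_potential[OF q3])
  ultimately show ?thesis by (intro ext) simp
qed

text \<open>The finitely many values between \<open>l\<close> and \<open>0\<close>, where nothing is
  known about \<open>H\<close>, go into the constant.\<close>

lemma drift_cong_le:
  assumes G: "drift G a" and H: "\<And>k. k \<le> l \<Longrightarrow> H k = G k + c"
  shows "drift H a"
  unfolding drift_def
proof (intro allI impI)
  fix \<epsilon> :: real assume e: "0 < \<epsilon>"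
  obtain C where C: "\<And>k. k \<le> 0 \<Longrightarrow> \<bar>G k - a * of_int k\<bar> \<le> C - \<epsilon> * of_int k"
    using driftD[OF G e] by blast
  let ?S = "\<Sum>i=l..0. \<bar>H i - a * of_int i\<bar>"
  show "\<exists>C. \<forall>k\<le>0. \<bar>H k - a * of_int k\<bar> \<le> C - \<epsilon> * of_int k"
  proof (intro exI allI impI)
    fix k :: int assume k: "k \<le> 0"
    have nn: "0 \<le> - \<epsilon> * real_of_int k" using e k by (simp add: mult_nonneg_nonpos)
    have S: "0 \<le> ?S" by (intro sum_nonneg) simp
    show "\<bar>H k - a * of_int k\<bar> \<le> (\<bar>C\<bar> + \<bar>c\<bar> + ?S) - \<epsilon> * of_int k"
    proof (cases "k \<le> l")
      case True
      have "\<bar>H k - a * of_int k\<bar> \<le> \<bar>G k - a * of_int k\<bar> + \<bar>c\<bar>" using H[OF True] by simp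
      with C[OF k] S show ?thesis by linarith
    next
      case False
      then have "\<bar>H k - a * of_int k\<bar> \<le> ?S"
        using k by (intro member_le_sum) auto
      then show ?thesis using nn by linarith
    qed
  qed
qed

section \<open>Stacks of rows and exchanges of neighbouring rows\<close>

lemma good_foldl:
  assumes "good x a" "\<And>w. w \<in> set ws \<Longrightarrow> \<exists>b<a. good w b"
  shows "good (foldl queue_map x ws) a"
  using assms
proof (induction ws arbitrary: x)
  case (Cons w ws)
  then obtain b where "b < a" "good w b" by auto
  then have "good (queue_map x w) a"
    using Cons.prems(1) by (intro stable_queue.good_queue_map) unfold_locales
  then show ?case using Cons by simp
qed simp

text \<open>Rows are numbered from the top: row \<open>j\<close> feeds the queues with services \<open>j - 1, \<dots>, 0\<close>.\<close>

definition queue_stack :: "(nat \<Rightarrow> int \<Rightarrow> real) \<Rightarrow> nat \<Rightarrow> int \<Rightarrow> real" where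
  "queue_stack z j = foldl queue_map (z j) (map z (rev [0..<j]))"

lemma queue_stack_eq: "queue_map_iter (map z (rev [0..<Suc j])) = queue_stack z j"
  by (simp add: queue_map_iter_def queue_stack_def)

lemma queue_stack_cong: "(\<And>i. i \<le> j \<Longrightarrow> z i = z' i) \<Longrightarrow> queue_stack z j = queue_stack z' j"
  unfolding queue_stack_def by (auto intro!: foldl_cong)

text \<open>The Burke map on two neighbouring rows: the lower row is fed into the upper one, and
  afterwards the means have changed places, since departures have the mean of the arrivals and the
  rest has that of the services.\<close>

definition swap_rows :: "nat \<Rightarrow> (nat \<Rightarrow> int \<Rightarrow> real) \<Rightarrow> nat \<Rightarrow> int \<Rightarrow> real" where
  "swap_rows i z = z(i := queue_map (z (Suc i)) (z i), Suc i := queue_rest (z (Suc i)) (z i))"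

lemma swap_rows_other: "j \<noteq> i \<Longrightarrow> j \<noteq> Suc i \<Longrightarrow> swap_rows i z j = z j"
  by (simp add: swap_rows_def)

lemma good_swap_rows:
  assumes "\<And>j. j < n \<Longrightarrow> good (z j) (\<tau> j)" "Suc i < n" "\<tau> i < \<tau> (Suc i)" "j < n"
  shows "good (swap_rows i z j) ((\<tau>(i := \<tau> (Suc i), Suc i := \<tau> i)) j)"
proof -
  interpret stable_queue "z (Suc i)" "z i" "\<tau> (Suc i)" "\<tau> i"
    using assms by unfold_locales auto
  show ?thesis using good_queue_map good_queue_rest assms by (auto simp: swap_rows_def)
qed

text \<open>The departures of row \<open>Suc i\<close> through row \<open>i\<close> are already the
  first step of its stack, so after the exchange the remaining steps start from row
  \<open>i\<close>.\<close>

lemma queue_stack_swap_at: "queue_stack (swap_rows i z) i = queue_stack z (Suc i)"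
proof -
  have "map (swap_rows i z) (rev [0..<i]) = map z (rev [0..<i])"
    by (auto simp: swap_rows_other)
  then show ?thesis by (simp add: queue_stack_def swap_rows_def)
qed

text \<open>Row \<open>j\<close> first passes the rows in between, which are unchanged; its output
  \<open>?A\<close> then meets the two exchanged servers in succession, and
  \<open>queue_intertwining\<close> applies to them.\<close>

lemma queue_stack_swap_below:
  assumes good: "\<And>k. k \<le> j \<Longrightarrow> good (z k) (\<tau> k)" and i: "Suc i < j" "\<tau> i < \<tau> (Suc i)"
    and top: "\<And>k. k < j \<Longrightarrow> \<tau> k < \<tau> j"
  shows "queue_stack (swap_rows i z) j = queue_stack z j"
proof -
  let ?A = "foldl queue_map (z j) (map z (rev [Suc (Suc i)..<j]))"
  have "good ?A (\<tau> j)"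
  proof (rule good_foldl)
    fix w assume "w \<in> set (map z (rev [Suc (Suc i)..<j]))"
    then obtain k where "w = z k" "k < j" by auto
    then show "\<exists>b<\<tau> j. good w b" using good[of k] top[of k] by auto
  qed (use good in simp)
  then have swap: "queue_map (queue_map ?A (z (Suc i))) (z i) =
      queue_map (queue_map ?A (queue_rest (z (Suc i)) (z i))) (queue_map (z (Suc i)) (z i))"
    using good[of i] good[of "Suc i"] top[of "Suc i"] i by (intro queue_intertwining) auto
  have split: "rev [0..<j] = rev [Suc (Suc i)..<j] @ Suc i # i # rev [0..<i]"
  proof -
    have "[0..<j] = [0..<i] @ [i..<j]" using i upt_add_eq_append[of 0 i "j - i"] by simp
    moreover have "[i..<j] = i # Suc i # [Suc (Suc i)..<j]"
      using i by (simp add: upt_conv_Cons)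
    ultimately show ?thesis by simp
  qed
  have m: "map (swap_rows i z) (rev [Suc (Suc i)..<j]) = map z (rev [Suc (Suc i)..<j])"
    "map (swap_rows i z) (rev [0..<i]) = map z (rev [0..<i])" "swap_rows i z j = z j"
    "swap_rows i z i = queue_map (z (Suc i)) (z i)"
    "swap_rows i z (Suc i) = queue_rest (z (Suc i)) (z i)"
    using i by (auto simp: swap_rows_def)
  show ?thesis
    unfolding queue_stack_def split map_append list.map foldl_append foldl.simps m swap ..
qed

text \<open>Adjacent exchanges carry row \<open>p\<close> down past the next \<open>n\<close> rows;
  on its way it is replaced by successive rests, and the rows it passes move up by one as
  departures. \<open>push_index\<close> records the means.\<close>

definition push_row :: "nat \<Rightarrow> nat \<Rightarrow> (nat \<Rightarrow> int \<Rightarrow> real) \<Rightarrow> nat \<Rightarrow> int \<Rightarrow> real" where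
  "push_row p n z = fold swap_rows [p..<p + n] z"

definition push_index :: "nat \<Rightarrow> nat \<Rightarrow> (nat \<Rightarrow> real) \<Rightarrow> nat \<Rightarrow> real" where
  "push_index p n \<tau> j =
     (if p \<le> j \<and> j < p + n then \<tau> (Suc j) else if j = p + n then \<tau> p else \<tau> j)"

lemma push_row_0 [simp]: "push_row p 0 z = z"
  by (simp add: push_row_def)

lemma push_row_Suc: "push_row p (Suc n) z = swap_rows (p + n) (push_row p n z)"
  by (simp add: push_row_def)

lemma push_index_0 [simp]: "push_index p 0 \<tau> = \<tau>"
  by (auto simp: push_index_def)

lemma push_index_Suc:
  "push_index p (Suc n) \<tau> = (push_index p n \<tau>)
     (p + n := push_index p n \<tau> (Suc (p + n)), Suc (p + n) := push_index p n \<tau> (p + n))"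
  by (auto simp: push_index_def fun_eq_iff)

lemma push_row_above: "j < p \<Longrightarrow> push_row p n z j = z j"
  by (induction n) (auto simp: push_row_Suc swap_rows_other)

lemma good_push_row:
  assumes "\<And>j. j < m \<Longrightarrow> good (z j) (\<tau> j)" "\<And>i. i < n \<Longrightarrow> \<tau> p < \<tau> (Suc (p + i))"
    "p + n < m" "j < m"
  shows "good (push_row p n z j) (push_index p n \<tau> j)"
  using assms(2-)
proof (induction n arbitrary: j)
  case (Suc n)
  show ?case unfolding push_row_Suc push_index_Suc
    by (rule good_swap_rows[where n = m])
      (use Suc in \<open>auto simp: push_index_def\<close>)
qed (use assms(1) in simp)

text \<open>Exchange number \<open>i\<close> moves the stack of row \<open>Suc (p + i)\<close> to
  position \<open>p + i\<close>. Earlier exchanges act on two rows strictly above it and are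
  absorbed by intertwining; later ones touch only rows below the new position.\<close>

lemma queue_stack_push_row:
  assumes good: "\<And>j. j \<le> p + n \<Longrightarrow> good (z j) (\<tau> j)"
    and top: "\<And>i j. p < j \<Longrightarrow> j \<le> p + n \<Longrightarrow> i < j \<Longrightarrow> \<tau> i < \<tau> j"
    and i: "i < n"
  shows "queue_stack (push_row p n z) (p + i) = queue_stack z (Suc (p + i))"
proof -
  have below: "queue_stack (push_row p m z) j = queue_stack z j" if "p + m < j" "j \<le> p + n" for m j
    using that
  proof (induction m)
    case (Suc m)
    have "queue_stack (swap_rows (p + m) (push_row p m z)) j = queue_stack (push_row p m z) j"
    proof (rule queue_stack_swap_below[where \<tau> = "push_index p m \<tau>"])
      show "good (push_row p m z k) (push_index p m \<tau> k)" if "k \<le> j" for k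
        by (rule good_push_row[where m = "Suc j"]) (use good top Suc.prems that in auto)
    qed (use Suc.prems top in \<open>auto simp: push_index_def\<close>)
    then show ?case using Suc by (simp add: push_row_Suc)
  qed simp
  have "queue_stack (push_row p m z) (p + i) = queue_stack z (Suc (p + i))" if "i < m" "m \<le> n" for m
    using that
  proof (induction m)
    case (Suc m)
    show ?case
    proof (cases "i = m")
      case True
      then show ?thesis using queue_stack_swap_at[of "p + m" "push_row p m z"]
          below[of m "Suc (p + m)"] Suc.prems by (simp add: push_row_Suc)
    next
      case False
      have "queue_stack (push_row p (Suc m) z) (p + i) = queue_stack (push_row p m z) (p + i)"
        by (rule queue_stack_cong) (use False Suc.prems in \<open>auto simp: push_row_Suc swap_rows_other\<close>)
      then show ?thesis using Suc False by simp
    qed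
  qed simp
  then show ?thesis using i by simp
qed

text \<open>Exchanging in reverse order carries row \<open>q\<close> up to position
  \<open>p\<close>, where it arrives as the departures from the servers in between. The law of these
  departures can then be read off from Burke's theorem.\<close>

lemma lift_row:
  assumes "p \<le> q"
  shows "fold swap_rows (rev [p..<q]) z p = foldl queue_map (z q) (map z (rev [p..<q])) \<and>
    (\<forall>j<p. fold swap_rows (rev [p..<q]) z j = z j)"
  using assms
proof (induction q arbitrary: z rule: dec_induct)
  case (step q)
  have *: "rev [p..<Suc q] = q # rev [p..<q]" using step by simp
  have m: "map (swap_rows q z) (rev [p..<q]) = map z (rev [p..<q])"
    by (auto simp: swap_rows_other)
  show ?case using step.IH[of "swap_rows q z"] step.hyps
    unfolding * m by (simp add: swap_rows_def)
qed simp

section \<open>Last-passage values and crossing paths\<close>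

text \<open>The last-passage value from column \<open>j\<close> of row \<open>0\<close> to column \<open>j + n\<close> of row \<open>s\<close>; here, unlike in
  \<open>queue_stack\<close>, rows are numbered upwards.\<close>

fun lp :: "(nat \<Rightarrow> int \<Rightarrow> real) \<Rightarrow> int \<Rightarrow> nat \<Rightarrow> nat \<Rightarrow> real" where
  "lp w j 0 0 = w 0 j"
| "lp w j 0 (Suc n) = w 0 (j + int (Suc n)) + lp w j 0 n"
| "lp w j (Suc s) 0 = w (Suc s) j + lp w j s 0"
| "lp w j (Suc s) (Suc n) = w (Suc s) (j + int (Suc n)) + max (lp w j (Suc s) n) (lp w j s (Suc n))"

lemma lp_right: "w s (j + int (Suc n)) + lp w j s n \<le> lp w j s (Suc n)"
  by (cases s) auto

lemma lp_up: "w (Suc s) (j + int n) + lp w j s n \<le> lp w j (Suc s) n"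
  by (cases n) auto

text \<open>Crossing of paths in incremental form: moving the start to the right raises horizontal
  increments and lowers vertical ones. The two inequalities are proved together, because the
  recursion expresses the horizontal increments of a row by those of the row below and the vertical
  ones.\<close>

lemma lp_cross_aux:
  "lp w j s (Suc (Suc n)) - lp w j s (Suc n) \<le> lp w (j + 1) s (Suc n) - lp w (j + 1) s n \<and>
   lp w (j + 1) (Suc s) n - lp w (j + 1) s n \<le> lp w j (Suc s) (Suc n) - lp w j s (Suc n)"
proof (induction s arbitrary: n)
  case 0
  have h: "lp w j 0 (Suc (Suc n)) - lp w j 0 (Suc n) = lp w (j + 1) 0 (Suc n) - lp w (j + 1) 0 n" for n
    by (simp add: algebra_simps)
  have "lp w (j + 1) (Suc 0) n - lp w (j + 1) 0 n \<le> lp w j (Suc 0) (Suc n) - lp w j 0 (Suc n)"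
  proof (induction n)
    case (Suc n)
    then show ?case using h[of n] lp.simps(4)[of w "j + 1" 0 n] lp.simps(4)[of w j 0 "Suc n"]
      by (simp add: algebra_simps del: lp.simps)
  qed (auto simp: algebra_simps)
  with h[of n] show ?case by simp
next
  case (Suc s)
  have h: "lp w j (Suc s) (Suc (Suc n)) - lp w j (Suc s) (Suc n) \<le>
      lp w (j + 1) (Suc s) (Suc n) - lp w (j + 1) (Suc s) n" for n
    using Suc.IH[of n] lp.simps(4)[of w "j + 1" s n] lp.simps(4)[of w j s "Suc n"]
    by (simp add: algebra_simps del: lp.simps) linarith
  have "lp w (j + 1) (Suc (Suc s)) n - lp w (j + 1) (Suc s) n \<le>
      lp w j (Suc (Suc s)) (Suc n) - lp w j (Suc s) (Suc n)"
  proof (induction n)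
    case 0
    show ?case using lp.simps(4)[of w j "Suc s" 0] lp.simps(3)[of w "j + 1" "Suc s"]
      by (simp add: algebra_simps del: lp.simps)
  next
    case (Suc n)
    then show ?case using h[of n] lp.simps(4)[of w "j + 1" "Suc s" n] lp.simps(4)[of w j "Suc s" "Suc n"]
      by (simp add: algebra_simps del: lp.simps)
  qed
  with h[of n] show ?case by blast
qed

definition lp_to :: "(nat \<Rightarrow> int \<Rightarrow> real) \<Rightarrow> nat \<Rightarrow> int \<Rightarrow> int \<Rightarrow> real" where
  "lp_to w s j l = lp w j s (nat (l - j))"

lemma lp_to_crossing:
  assumes "i \<le> j" "j < l"
  shows "lp_to w s i l - lp_to w s i (l - 1) \<le> lp_to w s j l - lp_to w s j (l - 1)"
  using assms
proof (induction j rule: int_ge_induct)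
  case (step j)
  define n where "n = nat (l - j - 2)"
  have "nat (l - j) = Suc (Suc n)" "nat (l - 1 - j) = Suc n"
    "nat (l - (j + 1)) = Suc n" "nat (l - 1 - (j + 1)) = n"
    using step.prems by (auto simp: n_def)
  then have "lp_to w s j l - lp_to w s j (l - 1) \<le> lp_to w s (j + 1) l - lp_to w s (j + 1) (l - 1)"
    using lp_cross_aux[of w j s n] unfolding lp_to_def by simp
  then show ?case using step by simp
qed simp

section \<open>Fields with a boundary condition and their exit points\<close>

text \<open>\<open>F 0\<close> is the boundary condition one level below the row \<open>w 0\<close>.  The second clause excludes
  maximising paths that run along a row to \<open>-\<infinity>\<close>.\<close>

definition lpp_field :: "(nat \<Rightarrow> int \<Rightarrow> real) \<Rightarrow> nat \<Rightarrow> (nat \<Rightarrow> int \<Rightarrow> real) \<Rightarrow> bool" where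
  "lpp_field w N F \<longleftrightarrow>
     (\<forall>s<N. \<forall>l. F (Suc s) l = w s l + max (F (Suc s) (l - 1)) (F s l)) \<and>
     (\<forall>s<N. \<forall>l. \<exists>m\<le>l. F (Suc s) m = w s m + F s m)"

lemma lpp_field_rec:
  "lpp_field w N F \<Longrightarrow> s < N \<Longrightarrow> F (Suc s) l = w s l + max (F (Suc s) (l - 1)) (F s l)"
  unfolding lpp_field_def by blast

lemma lpp_field_ge_aux:
  assumes F: "lpp_field w N F"
  shows "s < N \<Longrightarrow> F 0 j + lp w j s n \<le> F (Suc s) (j + int n)"
proof (induction s arbitrary: n)
  case 0
  show ?case
  proof (induction n)
    case 0
    show ?case using lpp_field_rec[OF F \<open>0 < N\<close>, of j] by simp
  next
    case (Suc n)
    then show ?case using lpp_field_rec[OF F \<open>0 < N\<close>, of "j + int (Suc n)"] by simp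
  qed
next
  case (Suc s)
  then have IH: "F 0 j + lp w j s n \<le> F (Suc s) (j + int n)" for n by simp
  show ?case
  proof (induction n)
    case 0
    show ?case using lpp_field_rec[OF F Suc.prems, of j] IH[of 0] by simp
  next
    case (Suc n)
    then show ?case using lpp_field_rec[OF F \<open>Suc s < N\<close>, of "j + int (Suc n)"] IH[of "Suc n"] by simp
  qed
qed

lemma lpp_field_ge:
  assumes "lpp_field w N F" "s < N" "j \<le> l"
  shows "F 0 j + lp_to w s j l \<le> F (Suc s) l"
  using lpp_field_ge_aux[OF assms(1,2), of j "nat (l - j)"] assms(3) by (simp add: lp_to_def)

text \<open>A maximising path is traced back along the row until it steps down; column
  \<open>m\<close>, entered from below, ensures that this happens after finitely many steps. The
  hypothesis \<open>up\<close> treats the step down, so that the bottom row and the induction over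
  rows share one argument.\<close>

lemma lpp_field_exit_row:
  assumes F: "lpp_field w N F" and s: "s < N"
    and up: "\<And>l. F (Suc s) l = w s l + F s l \<Longrightarrow> \<exists>j\<le>l. F (Suc s) l \<le> F 0 j + lp_to w s j l"
  shows "\<exists>j\<le>l. F (Suc s) l = F 0 j + lp_to w s j l"
proof -
  obtain m where m: "m \<le> l" "F (Suc s) m = w s m + F s m" using F s unfolding lpp_field_def by blast
  from m(1) have "\<exists>j\<le>l. F (Suc s) l \<le> F 0 j + lp_to w s j l"
  proof (induction l rule: int_ge_induct)
    case base
    show ?case by (rule up[OF m(2)])
  next
    case (step l)
    show ?case
    proof (cases "F (Suc s) (l + 1) = w s (l + 1) + F s (l + 1)")
      case False
      then have eq: "F (Suc s) (l + 1) = w s (l + 1) + F (Suc s) l"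
        using lpp_field_rec[OF F s, of "l + 1"] by (auto simp: max_def split: if_splits)
      from step obtain j where j: "j \<le> l" "F (Suc s) l \<le> F 0 j + lp_to w s j l" by auto
      have i: "nat (l + 1 - j) = Suc (nat (l - j))" "j + int (Suc (nat (l - j))) = l + 1" using j by simp_all
      show ?thesis using j eq lp_right[of w s j "nat (l - j)", unfolded i]
        by (intro exI[of _ j]) (simp add: lp_to_def i del: lp.simps)
    qed (rule up)
  qed
  then show ?thesis using lpp_field_ge[OF F s] by (meson antisym)
qed

lemma lpp_field_exit:
  assumes F: "lpp_field w N F"
  shows "s < N \<Longrightarrow> \<exists>j\<le>l. F (Suc s) l = F 0 j + lp_to w s j l"
proof (induction s arbitrary: l)
  case 0
  show ?case
  proof (rule lpp_field_exit_row[OF F 0])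
    show "\<exists>j\<le>l. F (Suc 0) l \<le> F 0 j + lp_to w 0 j l" if "F (Suc 0) l = w 0 l + F 0 l" for l
      using that by (intro exI[of _ l]) (simp add: lp_to_def)
  qed
next
  case (Suc s)
  show ?case
  proof (rule lpp_field_exit_row[OF F Suc.prems])
    fix l assume v: "F (Suc (Suc s)) l = w (Suc s) l + F (Suc s) l"
    obtain j where j: "j \<le> l" "F (Suc s) l = F 0 j + lp_to w s j l" using Suc.IH Suc.prems by auto
    then show "\<exists>j\<le>l. F (Suc (Suc s)) l \<le> F 0 j + lp_to w (Suc s) j l"
      using v lp_up[of w s j "nat (l - j)"] by (intro exI[of _ j]) (auto simp: lp_to_def)
  qed
qed

definition exit_left :: "(nat \<Rightarrow> int \<Rightarrow> real) \<Rightarrow> nat \<Rightarrow> (int \<Rightarrow> real) \<Rightarrow> int \<Rightarrow> int \<Rightarrow> bool" where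
  "exit_left w s G j0 l \<longleftrightarrow>
     (\<exists>j\<le>j0. \<forall>i\<in>{j0<..l}. G i + lp_to w s i l \<le> G j + lp_to w s j l)"

definition exit_right :: "(nat \<Rightarrow> int \<Rightarrow> real) \<Rightarrow> nat \<Rightarrow> (int \<Rightarrow> real) \<Rightarrow> int \<Rightarrow> int \<Rightarrow> bool" where
  "exit_right w s G j0 l \<longleftrightarrow>
     (\<exists>j\<in>{j0..l}. \<forall>i<j0. G i + lp_to w s i l \<le> G j + lp_to w s j l)"

text \<open>Let \<open>i\<close> and \<open>j\<close> be the exit columns. The increment of
  \<open>F\<close> is at most that of the passage value from \<open>i\<close>, the increment of
  \<open>H\<close> at least that from \<open>j\<close>, and \<open>i \<le> j0 \<le> j\<close> puts
  these in order. As \<open>F\<close> is traced back from \<open>l\<close> and \<open>H\<close> from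
  \<open>l - 1\<close>, the two exit conditions have different endpoints.\<close>

lemma exit_increment_le:
  assumes F: "lpp_field w N F" and H: "lpp_field w N H" and s: "s < N" and j0: "j0 < l"
    and left: "exit_left w s (F 0) j0 l" and right: "exit_right w s (H 0) j0 (l - 1)"
  shows "F (Suc s) l - F (Suc s) (l - 1) \<le> H (Suc s) l - H (Suc s) (l - 1)"
proof -
  obtain i where i: "i \<le> j0" "F (Suc s) l \<le> F 0 i + lp_to w s i l"
  proof -
    obtain j where j: "j \<le> l" "F (Suc s) l = F 0 j + lp_to w s j l"
      using lpp_field_exit[OF F s] by blast
    obtain k where "k \<le> j0" "\<forall>i\<in>{j0<..l}. F 0 i + lp_to w s i l \<le> F 0 k + lp_to w s k l"
      using left unfolding exit_left_def by blast
    then show ?thesis using j that[of j] that[of k] by (cases "j \<le> j0") auto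
  qed
  obtain j where j: "j0 \<le> j" "j < l" "H (Suc s) (l - 1) \<le> H 0 j + lp_to w s j (l - 1)"
  proof -
    obtain j where j: "j \<le> l - 1" "H (Suc s) (l - 1) = H 0 j + lp_to w s j (l - 1)"
      using lpp_field_exit[OF H s] by blast
    obtain k where "k \<in> {j0..l - 1}" "\<forall>i<j0. H 0 i + lp_to w s i (l - 1) \<le> H 0 k + lp_to w s k (l - 1)"
      using right unfolding exit_right_def by blast
    then show ?thesis using j that[of j] that[of k] by (cases "j < j0") auto
  qed
  show ?thesis
    using lp_to_crossing[of i j l w s] i j j0 lpp_field_ge[OF F s, of i "l - 1"]
      lpp_field_ge[OF H s, of j l] by linarith
qed

lemma increments_le_imp_le:
  fixes F H :: "int \<Rightarrow> real"
  assumes "\<And>k. F k - F (k - 1) \<le> H k - H (k - 1)" "i \<le> j"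
  shows "F j - F i \<le> H j - H i"
  using assms(2)
proof (induction j rule: int_ge_induct)
  case (step j)
  then show ?case using assms(1)[of "j + 1"] by simp
qed simp

text \<open>If the maximising path of \<open>F\<close> leaves the boundary to the right of \<open>j0\<close>, then \<open>F\<close> is dominated by
  any other field along that path.  This bounds the probability of a wrong exit by that of an
  inequality between two sums of independent variables, without any shape theorem.\<close>

lemma not_exit_left_le:
  assumes F: "lpp_field w N F" and H: "lpp_field w N H" and s: "s < N"
    and inc: "\<And>k. F 0 k - F 0 (k - 1) \<le> H 0 k - H 0 (k - 1)"
    and left: "\<not> exit_left w s (F 0) j0 l"
  shows "F (Suc s) l - F 0 j0 \<le> H (Suc s) l - H 0 j0"
proof -
  obtain j where j: "j \<le> l" "F (Suc s) l = F 0 j + lp_to w s j l"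
    using lpp_field_exit[OF F s] by blast
  have "j0 < j"
  proof (rule ccontr)
    assume "\<not> j0 < j"
    then have "exit_left w s (F 0) j0 l"
      unfolding exit_left_def using lpp_field_ge[OF F s, of _ l] j
      by (intro exI[of _ j]) auto
    with left show False ..
  qed
  then have "F 0 j - F 0 j0 \<le> H 0 j - H 0 j0"
    using increments_le_imp_le[of "F 0" "H 0", OF inc] by simp
  then show ?thesis using lpp_field_ge[OF H s j(1)] j by linarith
qed

lemma not_exit_right_le:
  assumes F: "lpp_field w N F" and H: "lpp_field w N H" and s: "s < N"
    and inc: "\<And>k. H 0 k - H 0 (k - 1) \<le> F 0 k - F 0 (k - 1)"
    and right: "\<not> exit_right w s (F 0) j0 l"
  shows "F (Suc s) l - F 0 j0 \<le> H (Suc s) l - H 0 j0"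
proof -
  obtain j where j: "j \<le> l" "F (Suc s) l = F 0 j + lp_to w s j l"
    using lpp_field_exit[OF F s] by blast
  have "j < j0"
  proof (rule ccontr)
    assume "\<not> j < j0"
    then have "exit_right w s (F 0) j0 l"
      unfolding exit_right_def using lpp_field_ge[OF F s, of _ l] j
      by (intro bexI[of _ j]) auto
    with right show False ..
  qed
  then have "H 0 j0 - H 0 j \<le> F 0 j0 - F 0 j"
    using increments_le_imp_le[of "H 0" "F 0", OF inc] by simp
  then show ?thesis using lpp_field_ge[OF H s j(1)] j by linarith
qed

text \<open>If no column up to \<open>l\<close> were entered from below, the row would grow exactly
  like its weights and have slope \<open>b s\<close> instead of \<open>a\<close>.\<close>

lemma lpp_fieldI_drift:
  assumes rec: "\<And>s l. s < N \<Longrightarrow> F (Suc s) l = w s l + max (F (Suc s) (l - 1)) (F s l)"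
    and F: "\<And>s. s < N \<Longrightarrow> drift (F (Suc s)) a"
    and w: "\<And>s. s < N \<Longrightarrow> good (w s) (b s) \<and> b s \<noteq> a"
  shows "lpp_field w N F"
  unfolding lpp_field_def
proof (intro conjI allI impI)
  fix s l assume s: "s < N"
  show "\<exists>m\<le>l. F (Suc s) m = w s m + F s m"
  proof (rule ccontr)
    assume neg: "\<not> ?thesis"
    have step: "F (Suc s) m = w s m + F (Suc s) (m - 1)" if "m \<le> l" for m
      using neg that rec[OF s, of m] by (auto simp: max_def split: if_splits)
    have "potential (w s) k = F (Suc s) k + (potential (w s) l - F (Suc s) l)" if "k \<le> l" for k
      using that
    proof (induction k rule: int_le_induct)
      case (step k)
      then show ?case using \<open>\<And>m. m \<le> l \<Longrightarrow> _\<close>[of k] potential_step[of "w s" k] by simp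
    qed simp
    then have "drift (potential (w s)) a" by (rule drift_cong_le[OF F[OF s]])
    then show False using w[OF s] drift_unique unfolding good_def by blast
  qed
qed (rule rec)

primrec queue_field :: "(int \<Rightarrow> real) \<Rightarrow> (nat \<Rightarrow> int \<Rightarrow> real) \<Rightarrow> nat \<Rightarrow> int \<Rightarrow> real" where
  "queue_field A w 0 = potential A"
| "queue_field A w (Suc s) = queue_sup (queue_field A w s) (w s)"

text \<open>By induction \<open>queue_field A w s\<close> is an antiderivative of the iterated
  output, and \<open>queue_map\<close> may be computed from any antiderivative.\<close>

lemma queue_field_increments:
  assumes A: "good A a" and w: "\<And>i. i < s \<Longrightarrow> \<exists>b<a. good (w i) b"
  shows "foldl queue_map A (map w [0..<s]) k = queue_field A w s k - queue_field A w s (k - 1)"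
  using w
proof (induction s arbitrary: k)
  case 0
  show ?case using potential_step[of A k] by simp
next
  case (Suc s)
  have w': "\<exists>b<a. good (w i) b" if "i < s" for i using Suc.prems[of i] that by simp
  have "good (foldl queue_map A (map w [0..<s])) a"
    by (rule good_foldl[OF A]) (use w' in auto)
  moreover obtain b where "b < a" "good (w s) b" using Suc.prems by blast
  ultimately interpret stable_queue "foldl queue_map A (map w [0..<s])" "w s" a b
    by unfold_locales
  have "foldl queue_map A (map w [0..<s]) k = queue_field A w s k - queue_field A w s (k - 1)" for k
    by (rule Suc.IH[OF w'])
  then show ?case using queue_map_eq[OF domain, of "queue_field A w s"] by simp
qed

lemma lpp_field_queue_field:
  assumes A: "good A a" and w: "\<And>i. i < N \<Longrightarrow> \<exists>b<a. good (w i) b"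
  shows "lpp_field w N (queue_field A w)"
  unfolding lpp_field_def
proof (intro conjI allI impI)
  fix s l assume s: "s < N"
  have w': "\<exists>b<a. good (w i) b" if "i < s" for i using w[of i] that s by simp
  have "good (foldl queue_map A (map w [0..<s])) a"
    by (rule good_foldl[OF A]) (use w' in auto)
  moreover obtain b where b: "b < a" "good (w s) b" using w s by blast
  ultimately interpret stable_queue "foldl queue_map A (map w [0..<s])" "w s" a b
    by unfold_locales
  have G: "foldl queue_map A (map w [0..<s]) k = queue_field A w s k - queue_field A w s (k - 1)" for k
    by (rule queue_field_increments[OF A w'])
  show "queue_field A w (Suc s) l = w s l + max (queue_field A w (Suc s) (l - 1)) (queue_field A w s l)"
    using queue_sup_rec[OF G, of l] by simp
  obtain k where k: "k \<le> l" "queue_sup (queue_field A w s) (w s) l = queue_field A w s k + (\<Sum>i=k..l. w s i)"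
    using queue_sup_attained[OF G] by blast
  \<comment> \<open>The maximising start \<open>k\<close> of the supremum at \<open>l\<close> is a
    column entered from below: a larger value of \<open>?H k\<close>, continued along the row, would
    exceed \<open>?H l\<close>.\<close>
  let ?H = "queue_sup (queue_field A w s) (w s)"
  have "?H k + (\<Sum>i=k+1..l. w s i) \<le> ?H l"
    using k(1)
  proof (induction l rule: int_ge_induct)
    case (step l)
    then show ?case using queue_sup_rec[OF G, of "l + 1"] sum_int_last[of "k + 1" "l + 1" "w s"] by simp
  qed simp
  moreover have "(\<Sum>i=k..l. w s i) = w s k + (\<Sum>i=k+1..l. w s i)"
  proof -
    have "{k..l} = insert k {k+1..l}" using k by auto
    then show ?thesis by simp
  qed
  moreover have "w s k + queue_field A w s k \<le> ?H k" using queue_sup_rec[OF G, of k] by simp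
  ultimately show "\<exists>m\<le>l. queue_field A w (Suc s) m = w s m + queue_field A w s m"
    using k by (intro exI[of _ k]) auto
qed

subsection \<open>Independent families and exponential laws\<close>

text \<open>Independence and marginal laws in a single equation between laws, for arbitrary index
  sets. The form is convenient because it is preserved by reindexing and by law-preserving changes
  of two coordinates.\<close>

definition indep_law :: "'w measure \<Rightarrow> ('i \<Rightarrow> 'w \<Rightarrow> real) \<Rightarrow> ('i \<Rightarrow> real measure) \<Rightarrow> 'i set \<Rightarrow> bool" where
  "indep_law M X L K \<longleftrightarrow> prob_space M \<and>
     (\<forall>q\<in>K. X q \<in> borel_measurable M \<and> prob_space (L q) \<and> sets (L q) = sets borel) \<and>
     distr M (\<Pi>\<^sub>M q\<in>K. borel) (\<lambda>\<omega>. \<lambda>q\<in>K. X q \<omega>) = (\<Pi>\<^sub>M q\<in>K. L q)"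

lemma indep_law_prob: "indep_law M X L K \<Longrightarrow> prob_space M"
  by (simp add: indep_law_def)

lemma indep_law_measurable: "indep_law M X L K \<Longrightarrow> q \<in> K \<Longrightarrow> X q \<in> borel_measurable M"
  by (simp add: indep_law_def)

lemma indep_law_marginals:
  "indep_law M X L K \<Longrightarrow> q \<in> K \<Longrightarrow> prob_space (L q)"
  "indep_law M X L K \<Longrightarrow> q \<in> K \<Longrightarrow> sets (L q) = sets borel"
  by (simp_all add: indep_law_def)

lemma indep_law_distr:
  "indep_law M X L K \<Longrightarrow> distr M (\<Pi>\<^sub>M q\<in>K. borel) (\<lambda>\<omega>. \<lambda>q\<in>K. X q \<omega>) = (\<Pi>\<^sub>M q\<in>K. L q)"
  by (simp add: indep_law_def)

lemma measurable_restrict_family: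
  "(\<And>q. q \<in> K \<Longrightarrow> X q \<in> borel_measurable M) \<Longrightarrow>
    (\<lambda>\<omega>. \<lambda>q\<in>K. X q \<omega>) \<in> measurable M (\<Pi>\<^sub>M q\<in>K. (borel :: real measure))"
  by (rule measurable_restrict)

lemma indep_law_cong:
  assumes "\<And>q \<omega>. q \<in> K \<Longrightarrow> X q \<omega> = X' q \<omega>" "\<And>q. q \<in> K \<Longrightarrow> L q = L' q"
  shows "indep_law M X L K \<longleftrightarrow> indep_law M X' L' K"
proof -
  have "X q = X' q" if "q \<in> K" for q using assms(1)[OF that] by blast
  moreover have "(\<lambda>\<omega>. \<lambda>q\<in>K. X q \<omega>) = (\<lambda>\<omega>. \<lambda>q\<in>K. X' q \<omega>)" using assms(1) by (auto simp: fun_eq_iff)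
  moreover have "PiM K L = PiM K L'" using assms(2) by (intro PiM_cong) auto
  ultimately show ?thesis using assms(2) unfolding indep_law_def by simp
qed

lemma indep_law_prob_eq:
  assumes X: "indep_law M X L K" and F: "finite F" "F \<subseteq> K" and A: "\<And>q. q \<in> F \<Longrightarrow> A q \<in> sets borel"
  shows "measure M {\<omega>\<in>space M. \<forall>q\<in>F. X q \<omega> \<in> A q} = (\<Prod>q\<in>F. measure (L q) (A q))"
proof -
  interpret M: prob_space M using X by (rule indep_law_prob)
  \<comment> \<open>Outside \<open>K\<close> nothing is known about \<open>L\<close>; a point mass
    there makes every factor a probability measure, as the product locale requires.\<close>
  define L' where "L' q = (if q \<in> K then L q else return borel 0)" for q
  interpret L: product_prob_space L' K
    unfolding product_prob_space_def product_sigma_finite_def product_prob_space_axioms_def L'_def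
    using indep_law_marginals[OF X] by (auto intro!: prob_space_imp_sigma_finite prob_space_return)
  have L: "PiM K L = PiM K L'" by (intro PiM_cong) (auto simp: L'_def)
  have m [measurable]: "(\<lambda>\<omega>. \<lambda>q\<in>K. X q \<omega>) \<in> measurable M (\<Pi>\<^sub>M q\<in>K. borel)"
    using indep_law_measurable[OF X] by (rule measurable_restrict_family)
  have sps: "space (PiM K L') = space (PiM K (\<lambda>_. borel::real measure))"
    using indep_law_distr[OF X] L by (metis space_distr)
  have sp: "{x \<in> space (PiM K L'). \<forall>q\<in>F. x q \<in> A q} \<in> sets (PiM K (\<lambda>_. borel))"
  proof -
    have "{x \<in> space (PiM K (\<lambda>_. borel::real measure)). \<forall>q\<in>F. x q \<in> A q} \<in> sets (PiM K (\<lambda>_. borel))"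
      using F A by (intro sets.sets_Collect_finite_All) (auto intro!: measurable_sets_Collect[OF measurable_component_singleton])
    then show ?thesis unfolding sps .
  qed
  have "measure M {\<omega>\<in>space M. \<forall>q\<in>F. X q \<omega> \<in> A q} =
      measure (distr M (\<Pi>\<^sub>M q\<in>K. borel) (\<lambda>\<omega>. \<lambda>q\<in>K. X q \<omega>)) {x \<in> space (PiM K L'). \<forall>q\<in>F. x q \<in> A q}"
  proof (subst measure_distr[OF m sp], rule arg_cong[where f = "measure M"])
    have "(\<lambda>q\<in>K. X q \<omega>) \<in> space (PiM K L')" if "\<omega> \<in> space M" for \<omega>
      using measurable_space[OF m that] sps by simp
    then show "{\<omega>\<in>space M. \<forall>q\<in>F. X q \<omega> \<in> A q} =
        (\<lambda>\<omega>. \<lambda>q\<in>K. X q \<omega>) -` {x \<in> space (PiM K L'). \<forall>q\<in>F. x q \<in> A q} \<inter> space M"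
      using F by (auto simp: subset_eq)
  qed
  also have "\<dots> = measure (PiM K L') {x \<in> space (PiM K L'). \<forall>q\<in>F. x q \<in> A q}"
    unfolding indep_law_distr[OF X] L ..
  also have "\<dots> = (\<Prod>q\<in>F. measure (L' q) (A q))"
  proof -
    have "emeasure (PiM K L') {x \<in> space (PiM K L'). \<forall>q\<in>F. x q \<in> A q} = (\<Prod>q\<in>F. emeasure (L' q) (A q))"
      using F A indep_law_marginals[OF X] by (intro L.emeasure_PiM_Collect) (auto simp: L'_def)
    then show ?thesis
      by (simp add: measure_def[of "PiM K L'"] L.M.emeasure_eq_measure prod_ennreal prod_nonneg)
  qed
  also have "\<dots> = (\<Prod>q\<in>F. measure (L q) (A q))"
    using F by (intro prod.cong) (auto simp: L'_def)
  finally show ?thesis .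
qed

text \<open>Finite-dimensional boxes determine a product measure. Together with the preceding lemma
  this lets later proofs work with probabilities of boxes only.\<close>

lemma indep_lawI:
  assumes "prob_space M" and X: "\<And>q. q \<in> K \<Longrightarrow> X q \<in> borel_measurable M"
    and L: "\<And>q. q \<in> K \<Longrightarrow> prob_space (L q)" "\<And>q. q \<in> K \<Longrightarrow> sets (L q) = sets borel"
    and eq: "\<And>F A. finite F \<Longrightarrow> F \<subseteq> K \<Longrightarrow> (\<And>q. q \<in> F \<Longrightarrow> A q \<in> sets borel) \<Longrightarrow>
      measure M {\<omega>\<in>space M. \<forall>q\<in>F. X q \<omega> \<in> A q} = (\<Prod>q\<in>F. measure (L q) (A q))"
  shows "indep_law M X L K"
proof -
  interpret M: prob_space M by fact
  define L' where "L' q = (if q \<in> K then L q else return borel 0)" for q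
  interpret L: product_prob_space L' K
    unfolding product_prob_space_def product_sigma_finite_def product_prob_space_axioms_def L'_def
    using L by (auto intro!: prob_space_imp_sigma_finite prob_space_return)
  have PL: "PiM K L = PiM K L'" by (intro PiM_cong) (auto simp: L'_def)
  have m [measurable]: "(\<lambda>\<omega>. \<lambda>q\<in>K. X q \<omega>) \<in> measurable M (\<Pi>\<^sub>M q\<in>K. borel)"
    using X by (rule measurable_restrict_family)
  have sL: "sets (PiM K L') = sets (PiM K (\<lambda>_. borel))"
    using L by (intro sets_PiM_cong) (auto simp: L'_def)
  have spL: "space (L' q) = UNIV" if "q \<in> K" for q
    using sets_eq_imp_space_eq[of "L' q" borel] L that by (simp add: L'_def)
  have "distr M (PiM K (\<lambda>_. borel)) (\<lambda>\<omega>. \<lambda>q\<in>K. X q \<omega>) = PiM K L'"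
  proof (rule L.PiM_eq)
    fix F A assume F: "finite F" "F \<subseteq> K" and A: "\<And>q. q \<in> F \<Longrightarrow> A q \<in> sets (L' q)"
    have A': "A q \<in> sets borel" if "q \<in> F" for q using A[OF that] F that L by (auto simp: L'_def split: if_splits)
    have "emeasure (distr M (PiM K (\<lambda>_. borel)) (\<lambda>\<omega>. \<lambda>q\<in>K. X q \<omega>)) (prod_emb K L' F (Pi\<^sub>E F A)) =
        emeasure M ((\<lambda>\<omega>. \<lambda>q\<in>K. X q \<omega>) -` prod_emb K L' F (Pi\<^sub>E F A) \<inter> space M)"
      by (rule emeasure_distr[OF m]) (use F A in \<open>auto simp flip: sL intro!: sets_PiM_I\<close>)
    also have "(\<lambda>\<omega>. \<lambda>q\<in>K. X q \<omega>) -` prod_emb K L' F (Pi\<^sub>E F A) \<inter> space M =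
        {\<omega>\<in>space M. \<forall>q\<in>F. X q \<omega> \<in> A q}"
      using F spL by (auto simp: prod_emb_def PiE_iff extensional_def restrict_def subset_eq)
    also have "emeasure M \<dots> = (\<Prod>q\<in>F. emeasure (L' q) (A q))"
    proof -
      have "(\<Prod>q\<in>F. emeasure (L' q) (A q)) = (\<Prod>q\<in>F. ennreal (measure (L q) (A q)))"
        using F by (intro prod.cong) (auto simp: L.M.emeasure_eq_measure, auto simp: L'_def)
      then show ?thesis using eq[OF F A'] by (simp add: M.emeasure_eq_measure prod_ennreal)
    qed
    finally show "emeasure (distr M (PiM K (\<lambda>_. borel)) (\<lambda>\<omega>. \<lambda>q\<in>K. X q \<omega>)) (prod_emb K L' F (Pi\<^sub>E F A)) =
        (\<Prod>q\<in>F. emeasure (L' q) (A q))" .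
  qed (simp add: sL)
  then show ?thesis unfolding indep_law_def PL using assms by simp
qed

lemma indep_law_marginal:
  assumes X: "indep_law M X L K" and q: "q \<in> K"
  shows "distr M borel (X q) = L q"
proof (rule measure_eqI)
  interpret M: prob_space M using X by (rule indep_law_prob)
  interpret L: prob_space "L q" using indep_law_marginals[OF X q] by blast
  show "sets (distr M borel (X q)) = sets (L q)" using indep_law_marginals[OF X q] by simp
  fix A assume "A \<in> sets (distr M borel (X q))"
  then have A: "A \<in> sets borel" by simp
  have "measure M {\<omega>\<in>space M. X q \<omega> \<in> A} = measure (L q) A"
    using indep_law_prob_eq[OF X, of "{q}" "\<lambda>_. A"] q A by simp
  moreover have "X q -` A \<inter> space M = {\<omega>\<in>space M. X q \<omega> \<in> A}" by auto
  ultimately show "emeasure (distr M borel (X q)) A = emeasure (L q) A"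
    using A indep_law_measurable[OF X q]
    by (simp add: emeasure_distr M.emeasure_eq_measure L.emeasure_eq_measure)
qed

lemma indep_law_subset:
  assumes "indep_law M X L K" "K' \<subseteq> K"
  shows "indep_law M X L K'"
proof (rule indep_lawI)
  fix F A assume "finite F" "F \<subseteq> K'" "\<And>q. q \<in> F \<Longrightarrow> A q \<in> sets (borel :: real measure)"
  then show "measure M {\<omega>\<in>space M. \<forall>q\<in>F. X q \<omega> \<in> A q} = (\<Prod>q\<in>F. measure (L q) (A q))"
    using assms by (intro indep_law_prob_eq[OF assms(1)]) auto
qed (use assms in \<open>auto simp: indep_law_def\<close>)

lemma indep_law_indep_vars:
  assumes X: "indep_law M X L K"
  shows "prob_space.indep_vars M (\<lambda>_. borel) X K"
proof (cases "K = {}")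
  case True
  interpret M: prob_space M using X by (rule indep_law_prob)
  show ?thesis unfolding True M.indep_vars_def M.indep_sets_def by simp
next
  case False
  interpret M: prob_space M using X by (rule indep_law_prob)
  show ?thesis
    by (subst M.indep_vars_iff_distr_eq_PiM'[OF False])
      (use X indep_law_marginal[OF X] in \<open>auto simp: indep_law_def intro!: PiM_cong\<close>)
qed

lemma indep_lawI_indep_vars:
  assumes "prob_space M" "prob_space.indep_vars M (\<lambda>_. borel) X K"
    and L: "\<And>q. q \<in> K \<Longrightarrow> distr M borel (X q) = L q"
  shows "indep_law M X L K"
proof -
  interpret M: prob_space M by fact
  have X: "X q \<in> borel_measurable M" if "q \<in> K" for q
    using assms(2) that by (simp add: M.indep_vars_def)
  show ?thesis
  proof (rule indep_lawI)
    fix F A assume F: "finite F" "F \<subseteq> K" and A: "\<And>q. q \<in> F \<Longrightarrow> A q \<in> sets (borel :: real measure)"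
    have eq: "measure M (X q -` A q \<inter> space M) = measure (L q) (A q)" if "q \<in> F" for q
      using X[of q] A[OF that] F that by (subst L[symmetric]) (auto simp: measure_distr)
    show "measure M {\<omega>\<in>space M. \<forall>q\<in>F. X q \<omega> \<in> A q} = (\<Prod>q\<in>F. measure (L q) (A q))"
    proof (cases "F = {}")
      case False
      have "{\<omega>\<in>space M. \<forall>q\<in>F. X q \<omega> \<in> A q} = (\<Inter>q\<in>F. X q -` A q \<inter> space M)" using False by auto
      then show ?thesis using M.indep_varsD[OF assms(2) False F(1,2) A] eq by simp
    qed (simp add: M.prob_space)
  qed (use X L assms(1) M.prob_space_distr in \<open>auto simp flip: L\<close>)
qed

lemma indep_law_independent:
  assumes X: "indep_law M X L K" and "S \<subseteq> K" "T \<subseteq> K" "S \<inter> T = {}"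
    and f: "f \<in> measurable (\<Pi>\<^sub>M q\<in>S. borel) N" and g: "g \<in> measurable (\<Pi>\<^sub>M q\<in>T. borel) N'"
  shows "prob_space.indep_var M N (\<lambda>\<omega>. f (\<lambda>q\<in>S. X q \<omega>)) N' (\<lambda>\<omega>. g (\<lambda>q\<in>T. X q \<omega>))"
proof -
  interpret M: prob_space M using X by (rule indep_law_prob)
  have "M.indep_var N (f \<circ> (\<lambda>\<omega>. \<lambda>q\<in>S. X q \<omega>)) N' (g \<circ> (\<lambda>\<omega>. \<lambda>q\<in>T. X q \<omega>))"
    by (rule M.indep_var_compose[OF M.indep_var_restrict f g])
      (use assms indep_law_indep_vars[OF X] in auto)
  then show ?thesis by (simp add: comp_def)
qed

lemma indep_law_events:
  assumes X: "indep_law M X L K" and "S \<subseteq> K" "T \<subseteq> K" "S \<inter> T = {}"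
    and A: "A \<in> sets (\<Pi>\<^sub>M q\<in>S. borel)" and B: "B \<in> sets (\<Pi>\<^sub>M q\<in>T. borel)"
  shows "measure M {\<omega>\<in>space M. (\<lambda>q\<in>S. X q \<omega>) \<in> A \<and> (\<lambda>q\<in>T. X q \<omega>) \<in> B} =
    measure M {\<omega>\<in>space M. (\<lambda>q\<in>S. X q \<omega>) \<in> A} * measure M {\<omega>\<in>space M. (\<lambda>q\<in>T. X q \<omega>) \<in> B}"
proof -
  interpret M: prob_space M using X by (rule indep_law_prob)
  have "M.indep_var (\<Pi>\<^sub>M q\<in>S. borel) (\<lambda>\<omega>. \<lambda>q\<in>S. X q \<omega>) (\<Pi>\<^sub>M q\<in>T. borel) (\<lambda>\<omega>. \<lambda>q\<in>T. X q \<omega>)"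
    by (rule M.indep_var_restrict[OF indep_law_indep_vars[OF X]]) (use assms in auto)
  from M.indep_varD[OF this A B] show ?thesis
    by (simp add: vimage_def Int_def conj_commute)
qed

lemma indep_law_pair:
  assumes X: "indep_law M X L K" and ab: "a \<in> K" "b \<in> K" "a \<noteq> b"
  shows "distr M (borel \<Otimes>\<^sub>M borel) (\<lambda>\<omega>. (X a \<omega>, X b \<omega>)) = L a \<Otimes>\<^sub>M L b"
proof -
  interpret M: prob_space M using X by (rule indep_law_prob)
  have "M.indep_var borel (\<lambda>\<omega>. (\<lambda>x. x a) (\<lambda>q\<in>{a}. X q \<omega>)) borel (\<lambda>\<omega>. (\<lambda>x. x b) (\<lambda>q\<in>{b}. X q \<omega>))"
    by (rule indep_law_independent[OF X]) (use ab in \<open>auto intro!: measurable_component_singleton\<close>)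
  then have "M.indep_var borel (X a) borel (X b)" by simp
  then show ?thesis
    using M.indep_var_distribution_eq[of borel "X a" borel "X b"] indep_law_marginal[OF X] ab by simp
qed

text \<open>The elementary move behind Burke's theorem: a function carrying one pair of independent
  marginals to another acts on two coordinates, while the others, being independent of the pair,
  keep their joint law.\<close>

lemma indep_law_replace_pair:
  assumes X: "indep_law M X L K" and ab: "a \<in> K" "b \<in> K" "a \<noteq> b"
    and f: "f \<in> measurable (borel \<Otimes>\<^sub>M borel) (borel \<Otimes>\<^sub>M borel)"
    and law: "distr (L a \<Otimes>\<^sub>M L b) (borel \<Otimes>\<^sub>M borel) f = La \<Otimes>\<^sub>M Lb"
    and La: "prob_space La" "sets La = sets borel" and Lb: "prob_space Lb" "sets Lb = sets borel"
  shows "indep_law M (X(a := \<lambda>\<omega>. fst (f (X a \<omega>, X b \<omega>)), b := \<lambda>\<omega>. snd (f (X a \<omega>, X b \<omega>))))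
    (L(a := La, b := Lb)) K"
    (is "indep_law M ?X ?L K")
proof (rule indep_lawI)
  interpret M: prob_space M using X by (rule indep_law_prob)
  interpret La: prob_space La by fact
  interpret Lb: prob_space Lb by fact
  note [measurable] = f indep_law_measurable[OF X ab(1)] indep_law_measurable[OF X ab(2)]
  show "prob_space M" by (rule M.prob_space_axioms)
  show "?X q \<in> borel_measurable M" if "q \<in> K" for q
    using indep_law_measurable[OF X that] by auto
  show "prob_space (?L q)" "sets (?L q) = sets borel" if "q \<in> K" for q
    using indep_law_marginals[OF X that] La Lb by auto
  fix F A assume F: "finite F" "F \<subseteq> K" and A: "\<And>q. q \<in> F \<Longrightarrow> A q \<in> sets (borel :: real measure)"
  \<comment> \<open>Filling up with \<open>UNIV\<close> puts conditions on both \<open>a\<close> and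
    \<open>b\<close>, whether or not they occur in \<open>F\<close>.\<close>
  define A' where "A' q = (if q \<in> F then A q else UNIV)" for q
  have A'[measurable]: "A' q \<in> sets borel" for q using A by (simp add: A'_def)
  define F' where "F' = F - {a, b}"
  let ?T = "K - {a, b}"
  let ?C = "{x \<in> space (\<Pi>\<^sub>M q\<in>?T. borel). \<forall>q\<in>F'. x q \<in> A' q}"
  have C: "?C \<in> sets (\<Pi>\<^sub>M q\<in>?T. borel)"
    using F by (intro sets.sets_Collect_finite_All) (auto simp: F'_def intro!: measurable_sets_Collect[OF measurable_component_singleton])
  let ?E = "(\<lambda>x. f (x a, x b)) -` (A' a \<times> A' b) \<inter> space (\<Pi>\<^sub>M q\<in>{a, b}. borel)"
  have E: "?E \<in> sets (\<Pi>\<^sub>M q\<in>{a, b}. borel)"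
    by (rule measurable_sets[where A = "borel \<Otimes>\<^sub>M borel"]) auto
  have "{\<omega>\<in>space M. \<forall>q\<in>F. ?X q \<omega> \<in> A q} =
      {\<omega>\<in>space M. (\<lambda>q\<in>{a, b}. X q \<omega>) \<in> ?E \<and> (\<lambda>q\<in>?T. X q \<omega>) \<in> ?C}"
  proof (intro Collect_cong conj_cong refl)
    fix \<omega>
    have "(\<forall>q\<in>F. ?X q \<omega> \<in> A q) \<longleftrightarrow> (\<forall>q\<in>F \<union> {a, b}. ?X q \<omega> \<in> A' q)" by (auto simp: A'_def)
    also have "\<dots> \<longleftrightarrow> f (X a \<omega>, X b \<omega>) \<in> A' a \<times> A' b \<and> (\<forall>q\<in>F'. X q \<omega> \<in> A' q)"
      using ab by (auto simp: F'_def mem_Times_iff)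
    also have "\<dots> \<longleftrightarrow> (\<lambda>q\<in>{a, b}. X q \<omega>) \<in> ?E \<and> (\<lambda>q\<in>?T. X q \<omega>) \<in> ?C"
      using F by (auto simp: F'_def space_PiM subset_eq)
    finally show "(\<forall>q\<in>F. ?X q \<omega> \<in> A q) \<longleftrightarrow> (\<lambda>q\<in>{a, b}. X q \<omega>) \<in> ?E \<and> (\<lambda>q\<in>?T. X q \<omega>) \<in> ?C" .
  qed
  then have "measure M {\<omega>\<in>space M. \<forall>q\<in>F. ?X q \<omega> \<in> A q} =
      measure M {\<omega>\<in>space M. (\<lambda>q\<in>{a, b}. X q \<omega>) \<in> ?E} * measure M {\<omega>\<in>space M. (\<lambda>q\<in>?T. X q \<omega>) \<in> ?C}"
    using indep_law_events[OF X _ _ _ E C] ab by simp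
  also have "{\<omega>\<in>space M. (\<lambda>q\<in>{a, b}. X q \<omega>) \<in> ?E} = (\<lambda>\<omega>. f (X a \<omega>, X b \<omega>)) -` (A' a \<times> A' b) \<inter> space M"
    by (auto simp: space_PiM)
  also have "measure M ((\<lambda>\<omega>. f (X a \<omega>, X b \<omega>)) -` (A' a \<times> A' b) \<inter> space M) =
      measure (distr (distr M (borel \<Otimes>\<^sub>M borel) (\<lambda>\<omega>. (X a \<omega>, X b \<omega>))) (borel \<Otimes>\<^sub>M borel) f) (A' a \<times> A' b)"
    by (simp add: measure_distr distr_distr comp_def)
  also have "\<dots> = measure (La \<Otimes>\<^sub>M Lb) (A' a \<times> A' b)"
    unfolding indep_law_pair[OF X ab] law ..
  also have "\<dots> = measure La (A' a) * measure Lb (A' b)"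
    using La Lb A'[of a] A'[of b] by (simp add: measure_def[of "La \<Otimes>\<^sub>M Lb"] Lb.emeasure_pair_measure_Times
        La.emeasure_eq_measure Lb.emeasure_eq_measure flip: ennreal_mult)
  also have "{\<omega>\<in>space M. (\<lambda>q\<in>?T. X q \<omega>) \<in> ?C} = {\<omega>\<in>space M. \<forall>q\<in>F'. X q \<omega> \<in> A' q}"
    using F by (auto simp: F'_def space_PiM)
  also have "measure M \<dots> = (\<Prod>q\<in>F'. measure (L q) (A' q))"
    by (rule indep_law_prob_eq[OF X]) (use F in \<open>auto simp: F'_def\<close>)
  also have "measure La (A' a) * measure Lb (A' b) * \<dots> = (\<Prod>q\<in>F' \<union> {a, b}. measure (?L q) (A' q))"
  proof -
    have "(\<Prod>q\<in>F'. measure (?L q) (A' q)) = (\<Prod>q\<in>F'. measure (L q) (A' q))"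
      by (intro prod.cong) (auto simp: F'_def)
    moreover have "finite F'" "F' \<inter> {a, b} = {}" using F by (auto simp: F'_def)
    ultimately show ?thesis using ab by (subst prod.union_disjoint) auto
  qed
  also have "\<dots> = (\<Prod>q\<in>F. measure (?L q) (A q))"
  proof -
    have "measure (?L q) (A' q) = 1" if "q \<in> {a, b} - F" for q
      using that sets_eq_imp_space_eq[OF La(2)] sets_eq_imp_space_eq[OF Lb(2)] La.prob_space Lb.prob_space
      by (auto simp: A'_def)
    then have "\<forall>q\<in>(F' \<union> {a, b}) - F. measure (?L q) (A' q) = 1" by (auto simp: F'_def simp del: fun_upd_apply)
    then have "(\<Prod>q\<in>F' \<union> {a, b}. measure (?L q) (A' q)) = (\<Prod>q\<in>F. measure (?L q) (A' q))"
      using F by (intro prod.mono_neutral_right) (simp_all add: F'_def, blast)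
    also have "\<dots> = (\<Prod>q\<in>F. measure (?L q) (A q))" by (intro prod.cong) (auto simp: A'_def)
    finally show ?thesis .
  qed
  finally show "measure M {\<omega>\<in>space M. \<forall>q\<in>F. ?X q \<omega> \<in> A q} = (\<Prod>q\<in>F. measure (?L q) (A q))" .
qed

section \<open>Exponential laws and lack of memory\<close>

abbreviation exp_rate :: "real \<Rightarrow> real measure" where
  "exp_rate l \<equiv> density lborel (exponential_density l)"

lemma exp_rate_shift:
  fixes g :: "real \<Rightarrow> ennreal"
  assumes [measurable]: "g \<in> borel_measurable borel" and l: "0 < l" and t: "0 \<le> t"
  shows "(\<integral>\<^sup>+x. g x * indicator {t<..} x \<partial>exp_rate l) = ennreal (exp (- l * t)) * (\<integral>\<^sup>+x. g (t + x) \<partial>exp_rate l)"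
proof -
  have "(\<integral>\<^sup>+x. g x * indicator {t<..} x \<partial>exp_rate l) =
      (\<integral>\<^sup>+x. ennreal (exponential_density l x) * (g x * indicator {t<..} x) \<partial>lborel)"
    by (simp add: nn_integral_density)
  also have "\<dots> = (\<integral>\<^sup>+x. ennreal (exponential_density l (t + x)) * (g (t + x) * indicator {t<..} (t + x)) \<partial>lborel)"
    by (subst nn_integral_real_affine[where c = 1 and t = t]) auto
  also have "\<dots> = (\<integral>\<^sup>+x. ennreal (exp (- l * t)) * (ennreal (exponential_density l x) * g (t + x)) \<partial>lborel)"
  proof (rule nn_integral_cong_AE)
    \<comment> \<open>At \<open>x = 0\<close> the density is positive but the open half-line
      excludes the point, so the integrands are compared off a null set.\<close>
    have "AE x in lborel. x \<noteq> (0::real)" by (rule AE_lborel_singleton)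
    then show "AE x in lborel. ennreal (exponential_density l (t + x)) * (g (t + x) * indicator {t<..} (t + x)) =
        ennreal (exp (- l * t)) * (ennreal (exponential_density l x) * g (t + x))"
    proof eventually_elim
      fix x :: real assume "x \<noteq> 0"
      show "ennreal (exponential_density l (t + x)) * (g (t + x) * indicator {t<..} (t + x)) =
        ennreal (exp (- l * t)) * (ennreal (exponential_density l x) * g (t + x))"
      proof (cases "0 < x")
        case True
        have "exponential_density l (t + x) = exp (- l * t) * exponential_density l x"
          using True t by (simp add: exponential_density_def algebra_simps flip: exp_add)
        then show ?thesis using True l exponential_density_nonneg[of l x] by (simp add: ennreal_mult mult.assoc)
      next
        case False
        with \<open>x \<noteq> 0\<close> have "x < 0" by simp
        then show ?thesis by (simp add: exponential_density_def)
      qed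
    qed
  qed
  also have "\<dots> = ennreal (exp (- l * t)) * (\<integral>\<^sup>+x. g (t + x) \<partial>exp_rate l)"
    by (simp add: nn_integral_cmult nn_integral_density)
  finally show ?thesis .
qed

text \<open>Kept as an image measure: what matters about the difference is its independence of the
  minimum, not the form of its density.\<close>

definition diff_law :: "real \<Rightarrow> real \<Rightarrow> real measure" where
  "diff_law a c = distr (exp_rate a \<Otimes>\<^sub>M exp_rate c) borel (\<lambda>(x, y). x - y)"

lemma measurable_exp_rate_pair [measurable_cong]: "sets (exp_rate a \<Otimes>\<^sub>M exp_rate c) = sets (borel \<Otimes>\<^sub>M borel)"
  by (intro sets_pair_measure_cong) auto

lemma prob_space_diff_law: "0 < a \<Longrightarrow> 0 < c \<Longrightarrow> prob_space (diff_law a c)"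
proof -
  assume "0 < a" "0 < c"
  then interpret a: prob_space "exp_rate a" by (intro prob_space_exponential_density)
  interpret c: prob_space "exp_rate c" using \<open>0 < c\<close> by (intro prob_space_exponential_density)
  interpret pair_prob_space "exp_rate a" "exp_rate c" ..
  show ?thesis unfolding diff_law_def by (intro prob_space_distr) measurable
qed

text \<open>On this event both variables exceed \<open>t\<close>; removing \<open>t\<close> from
  each leaves the difference unchanged and costs the factors \<open>exp (- a * t)\<close> and
  \<open>exp (- c * t)\<close> by lack of memory.\<close>

lemma exp_min_diff_tail:
  assumes "0 < a" "0 < c" "0 \<le> t" and [measurable]: "B \<in> sets borel"
  shows "emeasure (exp_rate a \<Otimes>\<^sub>M exp_rate c) {(x, y). t < min x y \<and> x - y \<in> B} =
    ennreal (exp (- (a + c) * t)) * emeasure (diff_law a c) B"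
proof -
  interpret a: prob_space "exp_rate a" using assms by (intro prob_space_exponential_density)
  interpret c: prob_space "exp_rate c" using assms by (intro prob_space_exponential_density)
  interpret pair_prob_space "exp_rate a" "exp_rate c" ..
  define h where "h x = (\<integral>\<^sup>+y. indicator B (x - y) \<partial>exp_rate c)" for x
  have [measurable]: "h \<in> borel_measurable borel" unfolding h_def by measurable
  have "{(x, y). t < min x y \<and> x - y \<in> B} =
      {z \<in> space (borel \<Otimes>\<^sub>M borel). t < min (fst z) (snd z) \<and> fst z - snd z \<in> B}"
    by (auto simp: space_pair_measure)
  then have [measurable]: "{(x, y). t < min x y \<and> x - y \<in> B} \<in> sets (borel \<Otimes>\<^sub>M borel)" by simp
  have "emeasure (exp_rate a \<Otimes>\<^sub>M exp_rate c) {(x, y). t < min x y \<and> x - y \<in> B} =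
      (\<integral>\<^sup>+z. indicator {(x, y). t < min x y \<and> x - y \<in> B} z \<partial>(exp_rate a \<Otimes>\<^sub>M exp_rate c))"
    by (rule nn_integral_indicator[symmetric]) measurable
  also have "\<dots> = (\<integral>\<^sup>+x. \<integral>\<^sup>+y. indicator {(x, y). t < min x y \<and> x - y \<in> B} (x, y) \<partial>exp_rate c \<partial>exp_rate a)"
    by (rule c.nn_integral_fst[symmetric]) measurable
  also have "\<dots> = (\<integral>\<^sup>+x. (\<integral>\<^sup>+y. indicator B (x - y) * indicator {t<..} y \<partial>exp_rate c) * indicator {t<..} x \<partial>exp_rate a)"
    by (intro nn_integral_cong) (auto simp: indicator_def intro!: nn_integral_cong)
  also have "\<dots> = (\<integral>\<^sup>+x. (ennreal (exp (- c * t)) * h (x - t)) * indicator {t<..} x \<partial>exp_rate a)"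
    using assms by (subst exp_rate_shift) (auto simp: h_def algebra_simps)
  also have "\<dots> = ennreal (exp (- a * t)) * (\<integral>\<^sup>+x. ennreal (exp (- c * t)) * h x \<partial>exp_rate a)"
    using assms by (subst exp_rate_shift) auto
  also have "\<dots> = ennreal (exp (- (a + c) * t)) * (\<integral>\<^sup>+x. h x \<partial>exp_rate a)"
  proof -
    have "(\<integral>\<^sup>+x. ennreal (exp (- c * t)) * h x \<partial>exp_rate a) = ennreal (exp (- c * t)) * (\<integral>\<^sup>+x. h x \<partial>exp_rate a)"
      by (rule nn_integral_cmult) measurable
    moreover have "exp (- (a + c) * t) = exp (- a * t) * exp (- c * t)"
      by (simp add: algebra_simps flip: exp_add)
    ultimately show ?thesis by (simp add: ennreal_mult mult.assoc)
  qed
  also have "(\<integral>\<^sup>+x. h x \<partial>exp_rate a) = emeasure (diff_law a c) B"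
  proof -
    have "emeasure (diff_law a c) B = (\<integral>\<^sup>+z. indicator B ((\<lambda>(x, y). x - y) z) \<partial>(exp_rate a \<Otimes>\<^sub>M exp_rate c))"
      unfolding diff_law_def
      by (subst nn_integral_distr[of "\<lambda>(x, y). x - y" _ borel "indicator B", symmetric]) auto
    also have "\<dots> = (\<integral>\<^sup>+x. h x \<partial>exp_rate a)"
      unfolding h_def by (subst c.nn_integral_fst[symmetric]) auto
    finally show ?thesis ..
  qed
  finally show ?thesis .
qed

lemma emeasure_distr_restricted:
  assumes E: "E \<in> sets M" and X: "X \<in> borel_measurable M" and B: "B \<in> sets borel"
  shows "emeasure (distr (density M (indicator E)) borel X) B = emeasure M (E \<inter> (X -` B \<inter> space M))"
proof -
  have "emeasure (distr (density M (indicator E)) borel X) B = emeasure (density M (indicator E)) (X -` B \<inter> space M)"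
    using X B by (subst emeasure_distr) auto
  also have "\<dots> = emeasure M (E \<inter> (X -` B \<inter> space M))"
    using E X B by (intro emeasure_restricted) (auto intro: measurable_sets)
  finally show ?thesis .
qed

text \<open>By the memoryless property.  Applied in both directions this is the one-step Burke property: with
  \<open>(w, d)\<close> in the role of \<open>(min x y, x - y)\<close> the inverse map returns departure and sojourn time.\<close>

lemma exp_min_diff_law:
  assumes "0 < a" "0 < c"
  shows "distr (exp_rate a \<Otimes>\<^sub>M exp_rate c) (borel \<Otimes>\<^sub>M borel) (\<lambda>(x, y). (min x y, x - y)) =
    exp_rate (a + c) \<Otimes>\<^sub>M diff_law a c"
proof -
  interpret a: prob_space "exp_rate a" using assms by (intro prob_space_exponential_density)
  interpret c: prob_space "exp_rate c" using assms by (intro prob_space_exponential_density)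
  interpret ac: prob_space "exp_rate (a + c)" using assms by (intro prob_space_exponential_density) simp
  interpret d: prob_space "diff_law a c" using assms by (rule prob_space_diff_law)
  interpret P: pair_prob_space "exp_rate a" "exp_rate c" ..
  let ?P = "exp_rate a \<Otimes>\<^sub>M exp_rate c"
  let ?f = "\<lambda>(x, y). (min x y, x - y) :: real \<times> real"
  have f: "?f \<in> measurable ?P (borel \<Otimes>\<^sub>M borel)" by measurable
  have sd: "sets (diff_law a c) = sets borel" by (simp add: diff_law_def)
  have "emeasure (exp_rate (a + c)) A * emeasure (diff_law a c) B = emeasure (distr ?P (borel \<Otimes>\<^sub>M borel) ?f) (A \<times> B)"
    if A: "A \<in> sets borel" and B[measurable]: "B \<in> sets borel" for A B
  proof -
    define D where "D = {z :: real \<times> real. fst z - snd z \<in> B}"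
    have D: "D \<in> sets ?P"
    proof -
      have "{z \<in> space (borel \<Otimes>\<^sub>M borel). fst z - snd z \<in> B} \<in> sets (borel \<Otimes>\<^sub>M (borel :: real measure))"
        by measurable
      then show ?thesis by (simp add: D_def space_pair_measure)
    qed
    \<comment> \<open>For fixed \<open>B\<close> two finite measures are compared: the law of the
      minimum on the event that the difference lies in \<open>B\<close>, and a multiple of the
      exponential law. They agree on open half-lines, which generate the Borel sets.\<close>
    define N1 where "N1 = distr (density ?P (indicator D)) borel (\<lambda>(x, y). min x y)"
    define N2 where "N2 = scale_measure (emeasure (diff_law a c) B) (exp_rate (a + c))"
    have e1: "emeasure N1 S = emeasure ?P {z. min (fst z) (snd z) \<in> S \<and> z \<in> D}" if S: "S \<in> sets borel" for S
      unfolding N1_def using S D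
      by (subst emeasure_distr_restricted)
        (auto simp: space_pair_measure intro!: arg_cong[where f = "emeasure ?P"])
    have tail: "emeasure N1 {t<..} = emeasure N2 {t<..}" if "0 \<le> t" for t
    proof -
      have "emeasure N1 {t<..} = emeasure ?P {(x, y). t < min x y \<and> x - y \<in> B}"
        by (subst e1) (auto simp: D_def intro!: arg_cong[where f = "emeasure ?P"])
      also have "\<dots> = ennreal (exp (- (a + c) * t)) * emeasure (diff_law a c) B"
        using assms that by (intro exp_min_diff_tail) auto
      also have "ennreal (exp (- (a + c) * t)) = emeasure (exp_rate (a + c)) {t<..}"
        using exp_rate_shift[of "\<lambda>_. 1" "a + c" t] assms that ac.emeasure_space_1
        by (simp add: nn_integral_indicator)
      finally show ?thesis by (simp add: N2_def mult.commute)
    qed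
    have all: "emeasure N1 UNIV = emeasure N2 UNIV"
    proof -
      have "emeasure N1 UNIV = emeasure ?P D"
        by (subst e1) (auto)
      also have "\<dots> = emeasure (diff_law a c) B"
        unfolding diff_law_def
        by (subst emeasure_distr) (auto simp: D_def space_pair_measure intro!: arg_cong[where f = "emeasure ?P"])
      finally show ?thesis using ac.emeasure_space_1 by (simp add: N2_def)
    qed
    have null: "emeasure (exp_rate (a + c)) {..<0} = 0"
      by (simp add: emeasure_density nn_integral_0_iff_AE exponential_density_def indicator_def)
    \<comment> \<open>For negative \<open>t\<close> both sides carry the total mass, since
      \<open>N2\<close> and hence \<open>N1\<close> live on the positive half-line.\<close>
    have tail': "emeasure N1 {t<..} = emeasure N2 {t<..}" for t
    proof (cases "0 \<le> t")
      case False
      have "emeasure (exp_rate (a + c)) {t<..} = 1"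
      proof -
        have "AE x in exp_rate (a + c). x \<in> {t<..}"
          using False by (subst AE_density) (auto simp: exponential_density_def intro!: AE_I2)
        then show ?thesis using ac.emeasure_eq_1_AE[of "{t<..}"] by simp
      qed
      then have "emeasure N2 {t<..} = emeasure N2 UNIV" using ac.emeasure_space_1 by (simp add: N2_def)
      moreover have "emeasure N1 {t<..} = emeasure N1 UNIV"
      proof (rule antisym)
        have "emeasure N1 {0<..} = emeasure N2 {0<..}" by (rule tail) simp
        also have "emeasure N2 {0<..} = emeasure N2 UNIV"
        proof -
          have "AE x in exp_rate (a + c). x \<in> {0<..}"
            using AE_lborel_singleton[of "0::real"] by (subst AE_density) (auto simp: exponential_density_def)
          then show ?thesis using ac.emeasure_eq_1_AE[of "{0<..}"] ac.emeasure_space_1 by (simp add: N2_def)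
        qed
        finally have "emeasure N1 UNIV = emeasure N1 {0<..}" using all by simp
        also have "\<dots> \<le> emeasure N1 {t<..}" using False by (intro emeasure_mono) (auto simp: N1_def)
        finally show "emeasure N1 UNIV \<le> emeasure N1 {t<..}" .
      qed (intro emeasure_mono, auto simp: N1_def)
      ultimately show ?thesis using all by simp
    qed (rule tail)
    have "N1 = N2"
    proof (rule measure_eqI_generator_eq[where E = "range (\<lambda>t. {t<..})" and \<Omega> = UNIV and A = "\<lambda>i. {- real i<..}"])
      show "Int_stable (range (\<lambda>t::real. {t<..}))"
      proof (rule Int_stableI)
        fix S T assume "S \<in> range (\<lambda>t::real. {t<..})" "T \<in> range (\<lambda>t::real. {t<..})"
        then obtain s t where "S = {s<..}" "T = {t<..}" by auto
        then have "S \<inter> T = {max s t<..}" by auto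
        then show "S \<inter> T \<in> range (\<lambda>t. {t<..})" by blast
      qed
      show "sets N1 = sigma_sets UNIV (range greaterThan)" "sets N2 = sigma_sets UNIV (range greaterThan)"
        unfolding N1_def N2_def by (simp_all add: borel_Ioi)
      show "(\<Union>i. {- real i<..}) = UNIV"
        by (auto, metis minus_less_iff reals_Archimedean2)
      show "emeasure N1 {- real i<..} \<noteq> \<infinity>" for i
        by (subst e1) auto
    qed (use tail' in auto)
    then have "emeasure N1 A = emeasure N2 A" by simp
    moreover have "emeasure N1 A = emeasure (distr ?P (borel \<Otimes>\<^sub>M borel) ?f) (A \<times> B)"
      using A by (subst emeasure_distr[OF f])
        (auto simp: e1 D_def space_pair_measure intro!: arg_cong[where f = "emeasure ?P"])
    ultimately show ?thesis by (simp add: N2_def mult.commute)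
  qed
  then show ?thesis
    by (intro pair_measure_eqI[symmetric])
      (auto simp: sd prob_space_imp_sigma_finite ac.prob_space_axioms d.prob_space_axioms intro!: sets_pair_measure_cong)
qed

lemma exp_sum_diff_law:
  assumes "0 < a" "0 < c"
  shows "distr (exp_rate (a + c) \<Otimes>\<^sub>M diff_law a c) (borel \<Otimes>\<^sub>M borel)
      (\<lambda>(w, d). (w + max d 0, w + max (- d) 0)) = exp_rate a \<Otimes>\<^sub>M exp_rate c"
proof -
  have "distr (exp_rate (a + c) \<Otimes>\<^sub>M diff_law a c) (borel \<Otimes>\<^sub>M borel)
      (\<lambda>(w, d). (w + max d 0, w + max (- d) 0)) =
    distr (exp_rate a \<Otimes>\<^sub>M exp_rate c) (borel \<Otimes>\<^sub>M borel)
      ((\<lambda>(w, d). (w + max d 0, w + max (- d) 0)) \<circ> (\<lambda>(x, y). (min x y, x - y)))"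
    unfolding exp_min_diff_law[OF assms, symmetric] by (rule distr_distr) measurable
  also have "(\<lambda>(w, d). (w + max d 0, w + max (- d) 0)) \<circ> (\<lambda>(x, y). (min x y, x - y)) = (\<lambda>z :: real \<times> real. z)"
    by (auto simp: fun_eq_iff)
  also have "distr (exp_rate a \<Otimes>\<^sub>M exp_rate c) (borel \<Otimes>\<^sub>M borel) (\<lambda>z. z) = exp_rate a \<Otimes>\<^sub>M exp_rate c"
    by (rule distr_id2) (intro sets_pair_measure_cong, auto)
  finally show ?thesis .
qed

lemma exponential_law_rate: "exponential_law m = exp_rate (1 / m)"
  by (simp add: exponential_law_def inverse_eq_divide)

lemma prob_space_exponential_law: "0 < m \<Longrightarrow> prob_space (exponential_law m)"
  unfolding exponential_law_rate by (intro prob_space_exponential_density) simp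

lemma sets_exponential_law [simp]: "sets (exponential_law m) = sets borel"
  by (simp add: exponential_law_def)

text \<open>Tilting the density of rate \<open>l\<close> by \<open>exp (t * x)\<close> gives a
  multiple of the density of rate \<open>l - t\<close>.\<close>

lemma exp_rate_mgf:
  assumes "0 < l" "t < l"
  shows "(\<integral>\<^sup>+x. ennreal (exp (t * x)) \<partial>exp_rate l) = ennreal (l / (l - t))"
proof -
  interpret prob_space "exp_rate (l - t)" using assms by (intro prob_space_exponential_density) simp
  have "(\<integral>\<^sup>+x. ennreal (exp (t * x)) \<partial>exp_rate l) =
      (\<integral>\<^sup>+x. ennreal (exponential_density l x) * ennreal (exp (t * x)) \<partial>lborel)"
    by (simp add: nn_integral_density)
  also have "\<dots> = (\<integral>\<^sup>+x. ennreal (l / (l - t)) * ennreal (exponential_density (l - t) x) \<partial>lborel)"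
  proof (intro nn_integral_cong)
    fix x :: real
    have "exponential_density l x * exp (t * x) = l / (l - t) * exponential_density (l - t) x"
    proof -
      have "exp (- x * l) * exp (t * x) = exp (- x * (l - t))"
        by (simp add: algebra_simps flip: exp_add)
      moreover have "l / (l - t) * ((l - t) * exp (- x * (l - t))) = l * exp (- x * (l - t))"
        using assms by (simp add: field_simps)
      ultimately show ?thesis by (simp add: exponential_density_def mult.assoc)
    qed
    then show "ennreal (exponential_density l x) * ennreal (exp (t * x)) =
        ennreal (l / (l - t)) * ennreal (exponential_density (l - t) x)"
      using assms exponential_density_nonneg[of l x] exponential_density_nonneg[of "l - t" x]
      by (simp flip: ennreal_mult)
  qed
  also have "\<dots> = ennreal (l / (l - t)) * emeasure (exp_rate (l - t)) (space (exp_rate (l - t)))"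
    by (simp add: nn_integral_cmult emeasure_density)
  finally show ?thesis using emeasure_space_1 by simp
qed

lemma exponential_law_mgf:
  assumes "0 < m" "m * t < 1"
  shows "(\<integral>\<^sup>+x. ennreal (exp (t * x)) \<partial>exponential_law m) = ennreal (1 / (1 - m * t))"
proof -
  have "t < 1 / m" using assms by (simp add: field_simps)
  moreover have "1 / m / (1 / m - t) = 1 / (1 - m * t)"
    using assms by (simp add: field_simps)
  ultimately show ?thesis using assms exp_rate_mgf[of "1 / m" t] by (simp add: exponential_law_rate)
qed

section \<open>Chernoff bounds and the law of large numbers\<close>

lemma sum_mgf:
  assumes X: "indep_law M X L K" and F: "finite F" "F \<subseteq> K"
    and L: "\<And>q. q \<in> F \<Longrightarrow> L q = exponential_law m" and "0 < m" "m * t < 1"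
  shows "(\<integral>\<^sup>+\<omega>. ennreal (exp (t * (\<Sum>q\<in>F. X q \<omega>))) \<partial>M) = ennreal ((1 / (1 - m * t)) ^ card F)"
proof -
  interpret M: prob_space M using X by (rule indep_law_prob)
  have "(\<integral>\<^sup>+\<omega>. ennreal (exp (t * (\<Sum>q\<in>F. X q \<omega>))) \<partial>M) = (\<integral>\<^sup>+\<omega>. (\<Prod>q\<in>F. ennreal (exp (t * X q \<omega>))) \<partial>M)"
    using F by (simp add: prod_ennreal exp_sum sum_distrib_left)
  also have "\<dots> = (\<Prod>q\<in>F. \<integral>\<^sup>+\<omega>. ennreal (exp (t * X q \<omega>)) \<partial>M)"
  proof (rule M.indep_vars_nn_integral[OF F(1)])
    have "M.indep_vars (\<lambda>_. borel) X F"
      using indep_law_indep_vars[OF X] F(2) by (rule M.indep_vars_subset)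
    from M.indep_vars_compose2[OF this, of "\<lambda>_ x. ennreal (exp (t * x))" "\<lambda>_. borel"]
    show "M.indep_vars (\<lambda>_. borel) (\<lambda>q \<omega>. ennreal (exp (t * X q \<omega>))) F" by simp
  qed simp
  also have "\<dots> = (\<Prod>q\<in>F. ennreal (1 / (1 - m * t)))"
  proof (intro prod.cong refl)
    fix q assume q: "q \<in> F"
    then have "q \<in> K" using F by auto
    note [measurable] = indep_law_measurable[OF X this]
    have "(\<integral>\<^sup>+\<omega>. ennreal (exp (t * X q \<omega>)) \<partial>M) = (\<integral>\<^sup>+x. ennreal (exp (t * x)) \<partial>distr M borel (X q))"
      by (subst nn_integral_distr) auto
    also have "distr M borel (X q) = exponential_law m"
      using indep_law_marginal[OF X \<open>q \<in> K\<close>] L[OF q] by simp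
    finally show "(\<integral>\<^sup>+\<omega>. ennreal (exp (t * X q \<omega>)) \<partial>M) = ennreal (1 / (1 - m * t))"
      using exponential_law_mgf assms by simp
  qed
  also have "\<dots> = ennreal ((1 / (1 - m * t)) ^ card F)"
    using assms by (simp add: ennreal_power)
  finally show ?thesis .
qed

text \<open>Half of the value at which \<open>(1 - m t) (1 + t (m + \<epsilon>)) > 1\<close> ceases to hold.\<close>

definition chernoff_tilt :: "real \<Rightarrow> real \<Rightarrow> real" where
  "chernoff_tilt m \<epsilon> = \<epsilon> / (2 * m * (m + \<epsilon>))"

text \<open>The larger of the two factors that one summand contributes to the exponential bounds:
  for upper deviations with tilt \<open>t\<close>, for lower ones with tilt
  \<open>- t\<close>.\<close>

definition chernoff_rate :: "real \<Rightarrow> real \<Rightarrow> real" where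
  "chernoff_rate m \<epsilon> = (let t = chernoff_tilt m \<epsilon> in
     max (exp (- t * (m + \<epsilon>)) / (1 - m * t)) (exp (t * (m - \<epsilon>)) / (1 + m * t)))"

lemma chernoff_tilt_bounds:
  assumes "0 < m" "0 < \<epsilon>"
  shows "0 < chernoff_tilt m \<epsilon>" "m * chernoff_tilt m \<epsilon> < 1"
    "m * chernoff_tilt m \<epsilon> * (m + \<epsilon>) = \<epsilon> / 2"
proof -
  have pos: "0 < m + \<epsilon>" using assms by simp
  have mt: "m * chernoff_tilt m \<epsilon> = \<epsilon> / (2 * (m + \<epsilon>))"
    using assms by (simp add: chernoff_tilt_def)
  show "0 < chernoff_tilt m \<epsilon>" unfolding chernoff_tilt_def using assms pos by (intro divide_pos_pos mult_pos_pos) auto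
  show "m * chernoff_tilt m \<epsilon> < 1" unfolding mt using assms pos by (simp add: divide_simps)
  show "m * chernoff_tilt m \<epsilon> * (m + \<epsilon>) = \<epsilon> / 2" unfolding mt using pos by (simp add: divide_simps)
qed

lemma chernoff_rate_bounds:
  assumes "0 < m" "0 < \<epsilon>"
  shows "0 \<le> chernoff_rate m \<epsilon>" "chernoff_rate m \<epsilon> < 1"
proof -
  define t where "t = chernoff_tilt m \<epsilon>"
  note t = chernoff_tilt_bounds[OF assms, folded t_def]
  have mt: "0 < m * t" using assms t by simp
  have r: "chernoff_rate m \<epsilon> = max (exp (- t * (m + \<epsilon>)) / (1 - m * t)) (exp (t * (m - \<epsilon>)) / (1 + m * t))"
    by (simp add: chernoff_rate_def t_def Let_def)
  show "0 \<le> chernoff_rate m \<epsilon>" unfolding r using t by (simp add: le_max_iff_disj)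
  have te: "0 < t * (\<epsilon> / 2)" using t assms by simp
  \<comment> \<open>The bound \<open>exp x \<ge> 1 + x\<close> reduces the claim to a polynomial
    inequality, and the choice of the tilt leaves a margin of
    \<open>t * \<epsilon> / 2\<close>.\<close>
  have "1 < (1 - m * t) * (1 + t * (m + \<epsilon>))"
  proof -
    have "(1 - m * t) * (1 + t * (m + \<epsilon>)) = 1 + t * \<epsilon> - t * (m * t * (m + \<epsilon>))" by (simp add: algebra_simps)
    then show ?thesis using te unfolding t(3) by (simp add: algebra_simps)
  qed
  also have "\<dots> \<le> (1 - m * t) * exp (t * (m + \<epsilon>))"
    using t exp_ge_add_one_self[of "t * (m + \<epsilon>)"] by (intro mult_left_mono) auto
  finally have "1 * exp (- t * (m + \<epsilon>)) < (1 - m * t) * exp (t * (m + \<epsilon>)) * exp (- t * (m + \<epsilon>))"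
    by (intro mult_strict_right_mono) auto
  then have 1: "exp (- t * (m + \<epsilon>)) < 1 - m * t" by (simp add: mult.assoc flip: exp_add)
  have "1 < (1 + m * t) * (1 + - t * (m - \<epsilon>))"
  proof -
    have "(1 + m * t) * (1 + - t * (m - \<epsilon>)) = 1 + t * \<epsilon> - t * (m * t * (m + \<epsilon>)) + 2 * (t * (m * t * \<epsilon>))"
      by (simp add: algebra_simps)
    moreover have "0 \<le> t * (m * t * \<epsilon>)" using t mt assms by simp
    ultimately show ?thesis using te unfolding t(3) by (simp add: algebra_simps)
  qed
  also have "\<dots> \<le> (1 + m * t) * exp (- t * (m - \<epsilon>))"
    using mt exp_ge_add_one_self[of "- t * (m - \<epsilon>)"] by (intro mult_left_mono) auto
  finally have "1 * exp (t * (m - \<epsilon>)) < (1 + m * t) * exp (- t * (m - \<epsilon>)) * exp (t * (m - \<epsilon>))"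
    by (intro mult_strict_right_mono) auto
  then have 2: "exp (t * (m - \<epsilon>)) < 1 + m * t" by (simp add: mult.assoc flip: exp_add)
  show "chernoff_rate m \<epsilon> < 1" unfolding r using 1 2 t mt by simp
qed

text \<open>The bound depends on \<open>F\<close> only through its cardinality, so it applies to
  rows and columns that move with \<open>N\<close>; its geometric decay is also what Borel-Cantelli
  asks for.\<close>

lemma chernoff_sum:
  fixes m \<epsilon> :: real
  assumes X: "indep_law M X L K" and F: "finite F" "F \<subseteq> K"
    and L: "\<And>q. q \<in> F \<Longrightarrow> L q = exponential_law m" and m: "0 < m" and e: "0 < \<epsilon>"
  shows "measure M {\<omega>\<in>space M. \<epsilon> * card F \<le> \<bar>(\<Sum>q\<in>F. X q \<omega>) - m * card F\<bar>}
    \<le> 2 * chernoff_rate m \<epsilon> ^ card F"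
proof -
  interpret M: prob_space M using X by (rule indep_law_prob)
  define t where "t = chernoff_tilt m \<epsilon>"
  note t = chernoff_tilt_bounds[OF m e, folded t_def]
  have [measurable]: "X q \<in> borel_measurable M" if "q \<in> F" for q
    using indep_law_measurable[OF X] F that by auto
  have S[measurable]: "(\<lambda>\<omega>. \<Sum>q\<in>F. X q \<omega>) \<in> borel_measurable M" by measurable
  let ?n = "card F" and ?S = "\<lambda>\<omega>. \<Sum>q\<in>F. X q \<omega>"
  have mt: "m * t < 1" "m * (- t) < 1" using t m e by (auto intro: less_le_trans[of _ 0] simp: mult_pos_pos)
  have "emeasure M {\<omega>\<in>space M. ?S \<omega> \<ge> (m + \<epsilon>) * ?n} \<le>
      ennreal (exp (- t * ((m + \<epsilon>) * ?n))) * (\<integral>\<^sup>+\<omega>. ennreal (exp (t * ?S \<omega>)) * indicator (space M) \<omega> \<partial>M)"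
    using t by (intro Chernoff_ineq_nn_integral_ge) auto
  also have "(\<integral>\<^sup>+\<omega>. ennreal (exp (t * ?S \<omega>)) * indicator (space M) \<omega> \<partial>M) = (\<integral>\<^sup>+\<omega>. ennreal (exp (t * ?S \<omega>)) \<partial>M)"
    by (intro nn_integral_cong) auto
  also have "\<dots> = ennreal ((1 / (1 - m * t)) ^ ?n)" by (rule sum_mgf[OF X F L m mt(1)])
  also have "ennreal (exp (- t * ((m + \<epsilon>) * ?n))) * ennreal ((1 / (1 - m * t)) ^ ?n) =
      ennreal ((exp (- t * (m + \<epsilon>)) / (1 - m * t)) ^ ?n)"
    using mt by (simp add: power_divide flip: ennreal_mult exp_of_nat_mult)
  also have "\<dots> \<le> ennreal (chernoff_rate m \<epsilon> ^ ?n)"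
    using mt by (intro ennreal_leI power_mono) (auto simp: chernoff_rate_def Let_def t_def)
  finally have 1: "measure M {\<omega>\<in>space M. ?S \<omega> \<ge> (m + \<epsilon>) * ?n} \<le> chernoff_rate m \<epsilon> ^ ?n"
    using chernoff_rate_bounds[OF m e] by (simp add: M.emeasure_eq_measure)
  have "emeasure M {\<omega>\<in>space M. ?S \<omega> \<le> (m - \<epsilon>) * ?n} \<le>
      ennreal (exp (t * ((m - \<epsilon>) * ?n))) * (\<integral>\<^sup>+\<omega>. ennreal (exp (- t * ?S \<omega>)) * indicator (space M) \<omega> \<partial>M)"
    using t by (intro Chernoff_ineq_nn_integral_le) auto
  also have "(\<integral>\<^sup>+\<omega>. ennreal (exp (- t * ?S \<omega>)) * indicator (space M) \<omega> \<partial>M) = (\<integral>\<^sup>+\<omega>. ennreal (exp (- t * ?S \<omega>)) \<partial>M)"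
    by (intro nn_integral_cong) auto
  also have "\<dots> = ennreal ((1 / (1 - m * (- t))) ^ ?n)" by (rule sum_mgf[OF X F L m mt(2)])
  also have "ennreal (exp (t * ((m - \<epsilon>) * ?n))) * ennreal ((1 / (1 - m * (- t))) ^ ?n) =
      ennreal ((exp (t * (m - \<epsilon>)) / (1 + m * t)) ^ ?n)"
    using mt by (simp add: power_divide flip: ennreal_mult exp_of_nat_mult)
  also have "\<dots> \<le> ennreal (chernoff_rate m \<epsilon> ^ ?n)"
    using mt by (intro ennreal_leI power_mono) (auto simp: chernoff_rate_def Let_def t_def)
  finally have 2: "measure M {\<omega>\<in>space M. ?S \<omega> \<le> (m - \<epsilon>) * ?n} \<le> chernoff_rate m \<epsilon> ^ ?n"
    using chernoff_rate_bounds[OF m e] by (simp add: M.emeasure_eq_measure)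
  have "{\<omega>\<in>space M. \<epsilon> * ?n \<le> \<bar>?S \<omega> - m * ?n\<bar>} =
      {\<omega>\<in>space M. ?S \<omega> \<ge> (m + \<epsilon>) * ?n} \<union> {\<omega>\<in>space M. ?S \<omega> \<le> (m - \<epsilon>) * ?n}"
    by (auto simp: abs_real_def algebra_simps split: if_splits)
  then have "measure M {\<omega>\<in>space M. \<epsilon> * ?n \<le> \<bar>?S \<omega> - m * ?n\<bar>} \<le>
      measure M {\<omega>\<in>space M. ?S \<omega> \<ge> (m + \<epsilon>) * ?n} + measure M {\<omega>\<in>space M. ?S \<omega> \<le> (m - \<epsilon>) * ?n}"
    by (simp add: measure_subadditive M.emeasure_eq_measure)
  with 1 2 show ?thesis by simp
qed

lemma AE_exponential_law_nonneg: "AE x in exponential_law m. 0 \<le> x"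
  unfolding exponential_law_def by (subst AE_density) (auto simp: exponential_density_def)

lemma AE_indep_law_nonneg:
  assumes X: "indep_law M X L K" and q: "q \<in> K" "L q = exponential_law m"
  shows "AE \<omega> in M. 0 \<le> X q \<omega>"
proof -
  have "AE x in distr M borel (X q). 0 \<le> x"
    unfolding indep_law_marginal[OF X q(1)] q(2) by (rule AE_exponential_law_nonneg)
  then show ?thesis using indep_law_measurable[OF X q(1)] by (subst (asm) AE_distr_iff) auto
qed

text \<open>A law of large numbers to the left: the Chernoff bounds are summable, so Borel-Cantelli
  gives the linear bound for each of countably many tolerances.\<close>

lemma AE_good:
  assumes X: "indep_law M X L K" and p: "inj p" "\<And>k :: int. p k \<in> K"
    and L: "\<And>k. L (p k) = exponential_law m" and m: "0 < m"
  shows "AE \<omega> in M. good (\<lambda>k. X (p k) \<omega>) m"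
proof -
  interpret M: prob_space M using X by (rule indep_law_prob)
  \<comment> \<open>The \<open>n\<close> entries from \<open>- n + 1\<close> to \<open>0\<close> sum
    to minus the potential at \<open>- n\<close>.\<close>
  define F where "F n = p ` {- int n + 1..0}" for n
  have F: "finite (F n)" "F n \<subseteq> K" "card (F n) = n" for n
    using p by (auto simp: F_def card_image inj_on_subset[OF p(1)])
  have sumF: "(\<Sum>q\<in>F n. X q \<omega>) = (\<Sum>k=- int n + 1..0. X (p k) \<omega>)" for n \<omega>
    unfolding F_def using p(1) by (subst sum.reindex) (auto intro: inj_on_subset)
  have [measurable]: "X (p k) \<in> borel_measurable M" for k using indep_law_measurable[OF X] p by auto
  have "AE \<omega> in M. \<forall>k. 0 \<le> X (p k) \<omega>"
    unfolding AE_all_countable using AE_indep_law_nonneg[OF X p(2) L] by blast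
  moreover have "AE \<omega> in M. \<forall>j::nat. \<forall>\<^sub>F n in sequentially.
      \<bar>(\<Sum>q\<in>F n. X q \<omega>) - m * n\<bar> < (1 / Suc j) * n"
    unfolding AE_all_countable
  proof
    fix j :: nat
    define \<epsilon> where "\<epsilon> = 1 / Suc j"
    have e: "0 < \<epsilon>" by (simp add: \<epsilon>_def)
    let ?A = "\<lambda>n. {\<omega>\<in>space M. \<epsilon> * n \<le> \<bar>(\<Sum>q\<in>F n. X q \<omega>) - m * n\<bar>}"
    have "AE \<omega> in M. \<forall>\<^sub>F n in sequentially. \<omega> \<in> space M - ?A n"
    proof (rule borel_cantelli_AE1)
      show "?A n \<in> sets M" for n unfolding sumF by measurable
      show "emeasure M (?A n) < \<infinity>" for n by (simp add: M.emeasure_eq_measure)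
      show "summable (\<lambda>n. measure M (?A n))"
      proof (rule summable_comparison_test')
        show "summable (\<lambda>n. 2 * chernoff_rate m \<epsilon> ^ n)"
          using chernoff_rate_bounds[OF m e] by (intro summable_mult summable_geometric) auto
        show "norm (measure M (?A n)) \<le> 2 * chernoff_rate m \<epsilon> ^ n" if "0 \<le> n" for n
          using chernoff_sum[OF X F(1,2) _ m e, of n] L F(3)[of n] by (auto simp: F_def)
      qed
    qed
    then show "AE \<omega> in M. \<forall>\<^sub>F n in sequentially. \<bar>(\<Sum>q\<in>F n. X q \<omega>) - m * n\<bar> < (1 / Suc j) * n"
    proof eventually_elim
      case (elim \<omega>)
      then show ?case by eventually_elim (auto simp: \<epsilon>_def)
    qed
  qed
  ultimately show ?thesis
  proof eventually_elim
    case (elim \<omega>)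
    let ?x = "\<lambda>k. X (p k) \<omega>"
    have pot: "potential ?x (- int n) = - (\<Sum>q\<in>F n. X q \<omega>)" for n
      unfolding sumF by (cases n) (auto simp: potential_def)
    show ?case unfolding good_def drift_def
    proof (intro conjI allI impI)
      show "0 \<le> ?x k" for k using elim by blast
      fix \<epsilon> :: real assume "0 < \<epsilon>"
      then obtain j :: nat where j: "1 / Suc j < \<epsilon>" using nat_approx_posE by blast
      then obtain n0 where n0: "\<And>n. n0 \<le> n \<Longrightarrow> \<bar>(\<Sum>q\<in>F n. X q \<omega>) - m * n\<bar> < (1 / Suc j) * n"
        using elim unfolding eventually_sequentially by blast
      \<comment> \<open>The finitely many \<open>n\<close> before the bound sets in are absorbed
        into the constant.\<close>
      let ?C = "\<Sum>n<n0. \<bar>(\<Sum>q\<in>F n. X q \<omega>) - m * n\<bar>"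
      show "\<exists>C. \<forall>k\<le>0. \<bar>potential ?x k - m * of_int k\<bar> \<le> C - \<epsilon> * of_int k"
      proof (intro exI allI impI)
        fix k :: int assume "k \<le> 0"
        then obtain n where k: "k = - int n" by (metis nonpos_int_cases)
        have eq: "\<bar>potential ?x k - m * of_int k\<bar> = \<bar>(\<Sum>q\<in>F n. X q \<omega>) - m * n\<bar>"
          unfolding k pot by (simp add: abs_minus_commute)
        have C: "0 \<le> ?C" by (intro sum_nonneg) simp
        have en: "0 \<le> \<epsilon> * n" using \<open>0 < \<epsilon>\<close> by simp
        show "\<bar>potential ?x k - m * of_int k\<bar> \<le> ?C - \<epsilon> * of_int k"
        proof (cases "n < n0")
          case True
          then have "\<bar>(\<Sum>q\<in>F n. X q \<omega>) - m * n\<bar> \<le> ?C" by (intro member_le_sum) auto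
          then show ?thesis using eq en k by simp
        next
          case False
          then have "\<bar>(\<Sum>q\<in>F n. X q \<omega>) - m * n\<bar> < (1 / Suc j) * n" using n0 by simp
          also have "\<dots> \<le> \<epsilon> * n" using j by (intro mult_right_mono) auto
          finally show ?thesis using C unfolding eq unfolding k by (simp, linarith)
        qed
      qed
    qed
  qed
qed

section \<open>Measurability of the queueing map\<close>

lemma measurable_potential:
  assumes [measurable]: "\<And>k. (\<lambda>\<omega>. I \<omega> k) \<in> borel_measurable N"
  shows "(\<lambda>\<omega>. potential (I \<omega>) k) \<in> borel_measurable N"
  unfolding potential_def by measurable

lemma measurable_queue_domain:
  assumes [measurable]: "\<And>k. (\<lambda>\<omega>. I \<omega> k) \<in> borel_measurable N" "\<And>k. (\<lambda>\<omega>. w \<omega> k) \<in> borel_measurable N"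
  shows "Measurable.pred N (\<lambda>\<omega>. (I \<omega>, w \<omega>) \<in> queue_domain)"
proof -
  have "(I \<omega>, w \<omega>) \<in> queue_domain \<longleftrightarrow> (\<forall>k. 0 \<le> I \<omega> k) \<and> (\<forall>k. 0 \<le> w \<omega> k) \<and>
      (\<forall>j::nat. \<exists>n. \<forall>m\<in>{..n}. (\<Sum>i=m..0. w \<omega> i - I \<omega> (i + 1)) \<le> - real j)" for \<omega>
  proof -
    have "filterlim f at_bot at_bot \<longleftrightarrow> (\<forall>j::nat. \<exists>n. \<forall>m\<in>{..n}. f m \<le> - real j)" for f :: "int \<Rightarrow> real"
    proof
      assume "filterlim f at_bot at_bot"
      then show "\<forall>j::nat. \<exists>n. \<forall>m\<in>{..n}. f m \<le> - real j"
        unfolding filterlim_at_bot eventually_at_bot_linorder by (metis atMost_iff)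
    next
      assume *: "\<forall>j::nat. \<exists>n. \<forall>m\<in>{..n}. f m \<le> - real j"
      show "filterlim f at_bot at_bot"
        unfolding filterlim_at_bot eventually_at_bot_linorder
      proof
        fix Z :: real
        obtain j :: nat where "- Z \<le> j" using real_arch_simple by blast
        then show "\<exists>n. \<forall>m\<le>n. f m \<le> Z" using * by (smt (verit) atMost_iff)
      qed
    qed
    then show ?thesis by (auto simp: queue_domain_def)
  qed
  then show ?thesis by simp
qed

lemma measurable_queue_map:
  assumes I [measurable]: "\<And>k. (\<lambda>\<omega>. I \<omega> k) \<in> borel_measurable N"
    and w [measurable]: "\<And>k. (\<lambda>\<omega>. w \<omega> k) \<in> borel_measurable N"
  shows "(\<lambda>\<omega>. queue_map (I \<omega>) (w \<omega>) l) \<in> borel_measurable N"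
proof -
  note [measurable] = measurable_potential[OF I] measurable_queue_domain[OF I w]
  \<comment> \<open>Off the domain the candidates may be unbounded; setting them to zero there keeps
    the supremum finite for every argument.\<close>
  define S where "S l \<omega> = (SUP k\<in>{..l}. if (I \<omega>, w \<omega>) \<in> queue_domain
      then potential (I \<omega>) k + (\<Sum>i=k..l. w \<omega> i) else 0)" for l \<omega>
  have [measurable]: "S l \<in> borel_measurable N" for l
    unfolding S_def
  proof (rule borel_measurable_cSUP)
    show "bdd_above ((\<lambda>k. if (I \<omega>, w \<omega>) \<in> queue_domain
        then potential (I \<omega>) k + (\<Sum>i=k..l. w \<omega> i) else 0) ` {..l})" for \<omega>
      using queue_sup_bdd_above[of "I \<omega>" "w \<omega>" "potential (I \<omega>)" l] potential_step[of "I \<omega>"]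
      by (cases "(I \<omega>, w \<omega>) \<in> queue_domain") auto
  qed (auto, measurable)
  have "queue_map (I \<omega>) (w \<omega>) l = (if (I \<omega>, w \<omega>) \<in> queue_domain then S l \<omega> - S (l - 1) \<omega> else 0)" for \<omega>
  proof (cases "(I \<omega>, w \<omega>) \<in> queue_domain")
    case True
    then show ?thesis
      using queue_map_eq[OF True, of "potential (I \<omega>)" l] potential_step[of "I \<omega>"]
      by (simp add: S_def queue_sup_def)
  qed (simp add: queue_map_def)
  then show ?thesis by simp
qed

lemma measurable_queue_rest:
  assumes I [measurable]: "\<And>k. (\<lambda>\<omega>. I \<omega> k) \<in> borel_measurable N"
    and w [measurable]: "\<And>k. (\<lambda>\<omega>. w \<omega> k) \<in> borel_measurable N"
  shows "(\<lambda>\<omega>. queue_rest (I \<omega>) (w \<omega>) l) \<in> borel_measurable N"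
  using measurable_queue_map[OF I w] unfolding queue_rest_def by simp

lemma measurable_foldl_queue_map:
  assumes "\<And>k. (\<lambda>\<omega>. x \<omega> k) \<in> borel_measurable N"
    and "\<And>i k. i \<in> set is \<Longrightarrow> (\<lambda>\<omega>. z i \<omega> k) \<in> borel_measurable N"
  shows "(\<lambda>\<omega>. foldl queue_map (x \<omega>) (map (\<lambda>i. z i \<omega>) is) k) \<in> borel_measurable N"
  using assms
proof (induction "is" arbitrary: x)
  case (Cons i "is")
  have "(\<lambda>\<omega>. foldl queue_map (queue_map (x \<omega>) (z i \<omega>)) (map (\<lambda>i. z i \<omega>) is) k) \<in> borel_measurable N"
    by (rule Cons.IH, rule measurable_queue_map) (use Cons.prems in auto)
  then show ?case by simp
qed simp

section \<open>Loss of memory of the initial sojourn time\<close>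

lemma drift_at_bot:
  assumes "drift F c" "0 < c"
  shows "\<forall>\<^sub>F n in sequentially. F (- int n) < Z"
proof -
  have "0 < c / 2" using assms by simp
  then obtain C where C: "\<And>k. k \<le> 0 \<Longrightarrow> \<bar>F k - c * of_int k\<bar> \<le> C - c / 2 * of_int k"
    using driftD[OF assms(1)] by blast
  obtain n0 :: nat where n0: "2 * (C - Z) / c < n0" using reals_Archimedean2 by blast
  show ?thesis unfolding eventually_sequentially
  proof (intro exI allI impI)
    fix n assume "n0 \<le> n"
    then have "2 * (C - Z) / c < n" using n0 by linarith
    then have "C - Z < c / 2 * n" using assms(2) by (simp add: field_simps)
    moreover have "F (- int n) - c * of_int (- int n) \<le> C - c / 2 * of_int (- int n)"
      by (rule abs_le_D1[OF C]) simp
    ultimately show "F (- int n) < Z" by (simp add: algebra_simps)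
  qed
qed

primrec wait_chain :: "(int \<Rightarrow> real) \<Rightarrow> (int \<Rightarrow> real) \<Rightarrow> int \<Rightarrow> real \<Rightarrow> nat \<Rightarrow> real" where
  "wait_chain I w m e 0 = e"
| "wait_chain I w m e (Suc n) =
     w (m + int (Suc n)) + max (wait_chain I w m e n - I (m + int (Suc n))) 0"

text \<open>Both chains see the same arrivals and services, so their order is kept. Once the larger
  one empties, so does the smaller, and they coincide from then on; until then the larger one is its
  start plus the net work.\<close>

lemma wait_chain_coupling:
  assumes "e \<le> e'"
  shows "wait_chain I w m e n \<le> wait_chain I w m e' n \<and>
    (wait_chain I w m e n = wait_chain I w m e' n \<or>
     wait_chain I w m e' n = e' + (potential w (m + int n) - potential w m) - (potential I (m + int n) - potential I m))"
proof (induction n)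
  case (Suc n)
  have eq: "m + int (Suc n) - 1 = m + int n" by simp
  show ?case
    using Suc potential_step[of w "m + int (Suc n)"] potential_step[of I "m + int (Suc n)"]
    unfolding eq wait_chain.simps by (auto simp: max_def)
qed (use assms in simp)

lemma (in stable_queue) wait_chain_sojourn:
  "wait_chain I w m (sojourn I w m) n = sojourn I w (m + int n)"
proof (induction n)
  case (Suc n)
  have eq: "m + int (Suc n) - 1 = m + int n" by simp
  show ?case using sojourn_rec[of "m + int (Suc n)"] unfolding eq by (simp add: Suc)
qed simp

text \<open>If the chains had not merged by time \<open>k\<close>, the larger one would equal its
  start plus the net work since time \<open>- n\<close>, which is negative for large
  \<open>n\<close>, while sojourn times are nonnegative.\<close>

lemma (in stable_queue) wait_chain_eventually:
  "\<forall>\<^sub>F n in sequentially. wait_chain I w (- int n) e (nat (k + int n)) = sojourn I w k"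
proof -
  let ?d = "potential w k - potential I k"
  have dI: "drift (potential I) a" and dw: "drift (potential w) b" using I w by (auto simp: good_def)
  have d0: "drift (\<lambda>_. 0) 0" unfolding drift_def by (auto intro!: exI[of _ 0] simp: mult_nonneg_nonpos)
  \<comment> \<open>The larger start is \<open>e\<close> or the stationary sojourn time. The latter
    varies with \<open>n\<close>, and its growth is controlled by the slope of
    \<open>queue_sup\<close>.\<close>
  have "drift (\<lambda>m. potential I m + 0 - potential w m + (e + ?d)) (a + 0 - b)"
    by (intro drift_add_diff dI dw d0)
  from drift_at_bot[OF this, of 0] ba
  have ev1: "\<forall>\<^sub>F n in sequentially. potential I (- int n) - potential w (- int n) + (e + ?d) < 0" by simp
  have "drift (\<lambda>m. queue_sup (potential I) w m + 0 - potential w m + ?d) (a + 0 - b)"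
    by (intro drift_add_diff dw d0 drift_queue_sup) (rule potential_step)
  from drift_at_bot[OF this, of 0] ba
  have ev2: "\<forall>\<^sub>F n in sequentially. queue_sup (potential I) w (- int n) - potential w (- int n) + ?d < 0" by simp
  have ev3: "\<forall>\<^sub>F n in sequentially. nat (1 - k) \<le> n" by (rule eventually_ge_at_top)
  from ev1 ev2 ev3 show ?thesis
  proof eventually_elim
    case (elim n)
    define m where "m = - int n"
    define j where "j = nat (k + int n)"
    have k: "m + int j = k" "0 < j" using elim(3) by (auto simp: m_def j_def)
    then obtain i where i: "j = Suc i" by (cases j) auto
    let ?e = "min e (sojourn I w m)" and ?e' = "max e (sojourn I w m)"
    have neg: "?e' + (potential w k - potential w m) - (potential I k - potential I m) < 0"
      using elim(1,2) unfolding m_def[symmetric] by (auto simp: sojourn_def max_def)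
    have "0 \<le> wait_chain I w m ?e' j"
      unfolding i using good_nonneg[OF w] by simp
    then have "wait_chain I w m ?e j = wait_chain I w m ?e' j"
      using wait_chain_coupling[of ?e ?e' I w m j] neg unfolding k(1) by auto
    then have "wait_chain I w m e j = wait_chain I w m (sojourn I w m) j"
      by (cases "e \<le> sojourn I w m") (auto simp: min_def max_def split: if_splits)
    then show ?case
      using wait_chain_sojourn[of m j] k unfolding m_def j_def by simp
  qed
qed

subsection \<open>The Burke property\<close>

lemma sets_Collect_family:
  assumes "finite F" and X: "\<And>q. q \<in> F \<Longrightarrow> X q \<in> borel_measurable M" and "\<And>q. q \<in> F \<Longrightarrow> A q \<in> sets borel"
  shows "{\<omega>\<in>space M. \<forall>q\<in>F. X q \<omega> \<in> A q} \<in> sets M"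
proof (rule sets.sets_Collect_finite_All[OF _ assms(1)])
  fix q assume q: "q \<in> F"
  have "X q -` A q \<inter> space M \<in> sets M" by (rule measurable_sets[OF X]) (use q assms(3) in auto)
  then show "{\<omega>\<in>space M. X q \<omega> \<in> A q} \<in> sets M" by (simp add: vimage_def Int_def conj_commute)
qed

lemma indep_law_reindex:
  assumes X: "indep_law M X L K" and h: "inj_on h K'" "h ` K' \<subseteq> K"
  shows "indep_law M (\<lambda>q. X (h q)) (\<lambda>q. L (h q)) K'"
proof (rule indep_lawI)
  fix F A assume F: "finite F" "F \<subseteq> K'" and A: "\<And>q. q \<in> F \<Longrightarrow> A q \<in> sets (borel :: real measure)"
  have inj: "inj_on h F" using h F by (blast intro: inj_on_subset)
  have "measure M {\<omega>\<in>space M. \<forall>p\<in>h ` F. X p \<omega> \<in> A (inv_into F h p)} =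
      (\<Prod>p\<in>h ` F. measure (L p) (A (inv_into F h p)))"
    by (rule indep_law_prob_eq[OF X]) (use F h A inj in auto)
  then show "measure M {\<omega>\<in>space M. \<forall>q\<in>F. X (h q) \<omega> \<in> A q} = (\<Prod>q\<in>F. measure (L (h q)) (A q))"
    using inj by (simp add: prod.reindex)
qed (use X h in \<open>auto simp: indep_law_def\<close>)

lemma indep_law_single:
  assumes "prob_space N" "sets N = sets borel"
  shows "indep_law N (\<lambda>_ x. x) (\<lambda>_. N) {q}"
proof (rule indep_lawI)
  interpret N: prob_space N by fact
  have sp: "space N = UNIV" using sets_eq_imp_space_eq[OF assms(2)] by simp
  show "(\<lambda>x. x) \<in> borel_measurable N" using assms(2) by (simp add: measurable_ident_sets)
  fix F A assume "finite F" "F \<subseteq> {q}" "\<And>q. q \<in> F \<Longrightarrow> A q \<in> sets (borel :: real measure)"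
  then have "F = {} \<or> F = {q}" by auto
  then show "measure N {\<omega>\<in>space N. \<forall>q\<in>F. \<omega> \<in> A q} = (\<Prod>q\<in>F. measure N (A q))"
    using sp N.prob_space by auto
qed (use assms in auto)

lemma indep_law_product:
  assumes X: "indep_law M X L K" and X': "indep_law M' X' L' K'"
  shows "indep_law (M \<Otimes>\<^sub>M M') (\<lambda>q z. case q of Inl p \<Rightarrow> X p (fst z) | Inr p \<Rightarrow> X' p (snd z))
    (case_sum L L') (K <+> K')"
proof (rule indep_lawI)
  interpret M: prob_space M using X by (rule indep_law_prob)
  interpret M': prob_space M' using X' by (rule indep_law_prob)
  interpret P: pair_prob_space M M' ..
  show "prob_space (M \<Otimes>\<^sub>M M')" by (rule P.prob_space_axioms)
  show "(\<lambda>z. case q of Inl p \<Rightarrow> X p (fst z) | Inr p \<Rightarrow> X' p (snd z)) \<in> borel_measurable (M \<Otimes>\<^sub>M M')"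
    if "q \<in> K <+> K'" for q
    using that indep_law_measurable[OF X] indep_law_measurable[OF X'] by (cases q) auto
  show "prob_space (case_sum L L' q)" "sets (case_sum L L' q) = sets borel" if "q \<in> K <+> K'" for q
    using that indep_law_marginals[OF X] indep_law_marginals[OF X'] by (cases q; auto)+
  fix F A
  assume F: "finite F" "F \<subseteq> K <+> K'" and A: "\<And>q. q \<in> F \<Longrightarrow> A q \<in> sets (borel :: real measure)"
  define F1 where "F1 = {p. Inl p \<in> F}"
  define F2 where "F2 = {p. Inr p \<in> F}"
  have Feq: "F = Inl ` F1 \<union> Inr ` F2"
  proof (intro set_eqI)
    fix q show "q \<in> F \<longleftrightarrow> q \<in> Inl ` F1 \<union> Inr ` F2" by (cases q) (auto simp: F1_def F2_def)
  qed
  have fin: "finite F1" "finite F2" "F1 \<subseteq> K" "F2 \<subseteq> K'"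
    using F unfolding Feq by (auto dest!: finite_imageD simp: inj_on_def)
  let ?E = "{\<omega>\<in>space M. \<forall>p\<in>F1. X p \<omega> \<in> A (Inl p)}"
  let ?E' = "{\<omega>\<in>space M'. \<forall>p\<in>F2. X' p \<omega> \<in> A (Inr p)}"
  have E: "?E \<in> sets M"
    by (rule sets_Collect_family) (use fin A indep_law_measurable[OF X] in \<open>auto simp: F1_def\<close>)
  have E': "?E' \<in> sets M'"
    by (rule sets_Collect_family) (use fin A indep_law_measurable[OF X'] in \<open>auto simp: F2_def\<close>)
  have "{z\<in>space (M \<Otimes>\<^sub>M M'). \<forall>q\<in>F. (case q of Inl p \<Rightarrow> X p (fst z) | Inr p \<Rightarrow> X' p (snd z)) \<in> A q} = ?E \<times> ?E'"
    unfolding Feq ball_Un by (auto simp: space_pair_measure)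
  then have "measure (M \<Otimes>\<^sub>M M') {z\<in>space (M \<Otimes>\<^sub>M M'). \<forall>q\<in>F. (case q of Inl p \<Rightarrow> X p (fst z) | Inr p \<Rightarrow> X' p (snd z)) \<in> A q} =
      measure M ?E * measure M' ?E'"
    using M'.emeasure_pair_measure_Times[OF E E']
    by (simp add: P.emeasure_eq_measure M.emeasure_eq_measure M'.emeasure_eq_measure flip: ennreal_mult)
  also have "\<dots> = (\<Prod>p\<in>F1. measure (L p) (A (Inl p))) * (\<Prod>p\<in>F2. measure (L' p) (A (Inr p)))"
  proof -
    have "measure M ?E = (\<Prod>p\<in>F1. measure (L p) (A (Inl p)))"
      by (rule indep_law_prob_eq[OF X fin(1,3)]) (use A in \<open>simp add: F1_def\<close>)
    moreover have "measure M' ?E' = (\<Prod>p\<in>F2. measure (L' p) (A (Inr p)))"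
      by (rule indep_law_prob_eq[OF X' fin(2,4)]) (use A in \<open>simp add: F2_def\<close>)
    ultimately show ?thesis by simp
  qed
  also have "\<dots> = (\<Prod>q\<in>F. measure (case_sum L L' q) (A q))"
    unfolding Feq using fin by (subst prod.union_disjoint) (auto simp: prod.reindex)
  finally show "measure (M \<Otimes>\<^sub>M M') {z\<in>space (M \<Otimes>\<^sub>M M'). \<forall>q\<in>F. (case q of Inl p \<Rightarrow> X p (fst z) | Inr p \<Rightarrow> X' p (snd z)) \<in> A q} =
      (\<Prod>q\<in>F. measure (case_sum L L' q) (A q))" .
qed

text \<open>The family of the Burke argument: \<open>Inl (r, k)\<close> is entry \<open>k\<close> of row \<open>r\<close>, and \<open>Inr ()\<close> holds the current
  sojourn time.  Each time step rewrites the arrival, the service and the sojourn slot into the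
  rest, the departure and the next sojourn time; the queue is started at time \<open>m\<close> from the
  stationary sojourn law, and \<open>m\<close> is sent to \<open>-\<infinity>\<close>.\<close>

type_synonym slot = "(nat \<times> int) + unit"

definition chain_wait :: "nat \<Rightarrow> int \<Rightarrow> nat \<Rightarrow> (slot \<Rightarrow> 'w \<Rightarrow> real) \<Rightarrow> 'w \<Rightarrow> real" where
  "chain_wait i m n X \<omega> = wait_chain (\<lambda>k. X (Inl (Suc i, k)) \<omega>) (\<lambda>k. X (Inl (i, k)) \<omega>) m (X (Inr ()) \<omega>) n"

definition burke_family :: "nat \<Rightarrow> int \<Rightarrow> nat \<Rightarrow> (slot \<Rightarrow> 'w \<Rightarrow> real) \<Rightarrow> slot \<Rightarrow> 'w \<Rightarrow> real" where
  "burke_family i m n X q \<omega> = (case q of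
     Inr _ \<Rightarrow> chain_wait i m n X \<omega>
   | Inl (r, k) \<Rightarrow>
       if m < k \<and> k \<le> m + int n \<and> r = i then
         X (Inl (i, k)) \<omega> + max (X (Inl (Suc i, k)) \<omega> - chain_wait i m (nat (k - 1 - m)) X \<omega>) 0
       else if m < k \<and> k \<le> m + int n \<and> r = Suc i then
         min (X (Inl (Suc i, k)) \<omega>) (chain_wait i m (nat (k - 1 - m)) X \<omega>)
       else X q \<omega>)"

definition burke_law :: "nat \<Rightarrow> int \<Rightarrow> nat \<Rightarrow> (slot \<Rightarrow> real measure) \<Rightarrow> slot \<Rightarrow> real measure" where
  "burke_law i m n L q = (case q of
     Inr _ \<Rightarrow> L q
   | Inl (r, k) \<Rightarrow>
       if m < k \<and> k \<le> m + int n \<and> r = i then L (Inl (Suc i, k))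
       else if m < k \<and> k \<le> m + int n \<and> r = Suc i then L (Inl (i, k))
       else L q)"

text \<open>With arrival rate \<open>a\<close> and service rate \<open>a + c\<close> the stationary
  sojourn time is exponential of rate \<open>c\<close>. One time step is two replacements of pairs,
  each of which preserves independence.\<close>

lemma indep_law_burke_family:
  assumes X: "indep_law M X L K"
    and K: "Inr () \<in> K" "\<And>k. Inl (i, k) \<in> K" "\<And>k. Inl (Suc i, k) \<in> K"
    and a: "0 < a" and c: "0 < c"
    and L: "L (Inr ()) = exp_rate c" "\<And>k. L (Inl (i, k)) = exp_rate (a + c)" "\<And>k. L (Inl (Suc i, k)) = exp_rate a"
  shows "indep_law M (burke_family i m n X) (burke_law i m n L) K"
proof (induction n)
  case 0
  have "burke_family i m 0 X q \<omega> = X q \<omega>" "burke_law i m 0 L q = L q" for q \<omega>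
    by (auto simp: burke_family_def burke_law_def chain_wait_def split: sum.splits)
  then show ?case using X by (subst indep_law_cong) auto
next
  case (Suc n)
  define k where "k = m + int (Suc n)"
  let ?Z = "burke_family i m n X" and ?L = "burke_law i m n L"
  let ?A = "Inl (Suc i, k) :: slot" and ?W = "Inl (i, k) :: slot" and ?J = "Inr () :: slot"
  let ?f = "\<lambda>(x, y). (min x y, x - y) :: real \<times> real"
  let ?g = "\<lambda>(w, d). (w + max d 0, w + max (- d) 0) :: real \<times> real"
  have LA: "?L ?A = exp_rate a" "?L ?W = exp_rate (a + c)" "?L ?J = exp_rate c"
    by (auto simp: burke_law_def L k_def)
  \<comment> \<open>Arrival and sojourn time become their minimum, which is the rest, and their
    difference; these two are independent.\<close>
  define Z1 where "Z1 = ?Z(?A := \<lambda>\<omega>. fst (?f (?Z ?A \<omega>, ?Z ?J \<omega>)), ?J := \<lambda>\<omega>. snd (?f (?Z ?A \<omega>, ?Z ?J \<omega>)))"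
  define L1 where "L1 = ?L(?A := exp_rate (a + c), ?J := diff_law a c)"
  have 1: "indep_law M Z1 L1 K"
    unfolding Z1_def L1_def
  proof (rule indep_law_replace_pair[OF Suc.IH])
    show "distr (?L ?A \<Otimes>\<^sub>M ?L ?J) (borel \<Otimes>\<^sub>M borel) ?f = exp_rate (a + c) \<Otimes>\<^sub>M diff_law a c"
      unfolding LA by (rule exp_min_diff_law[OF a c])
    show "prob_space (exp_rate (a + c))" using a c by (intro prob_space_exponential_density) simp
    show "prob_space (diff_law a c)" using a c by (rule prob_space_diff_law)
  qed (use K in \<open>auto simp: diff_law_def\<close>)
  \<comment> \<open>Service and difference become the departure and the next sojourn time, by the
    inverse of the map \<open>?f\<close>.\<close>
  define Z2 where "Z2 = Z1(?W := \<lambda>\<omega>. fst (?g (Z1 ?W \<omega>, Z1 ?J \<omega>)), ?J := \<lambda>\<omega>. snd (?g (Z1 ?W \<omega>, Z1 ?J \<omega>)))"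
  define L2 where "L2 = L1(?W := exp_rate a, ?J := exp_rate c)"
  have L1: "L1 ?W = exp_rate (a + c)" "L1 ?J = diff_law a c" by (auto simp: L1_def LA)
  have 2: "indep_law M Z2 L2 K"
    unfolding Z2_def L2_def
  proof (rule indep_law_replace_pair[OF 1])
    show "distr (L1 ?W \<Otimes>\<^sub>M L1 ?J) (borel \<Otimes>\<^sub>M borel) ?g = exp_rate a \<Otimes>\<^sub>M exp_rate c"
      unfolding L1 by (rule exp_sum_diff_law[OF a c])
    show "prob_space (exp_rate a)" "prob_space (exp_rate c)" using a c by (auto intro: prob_space_exponential_density)
  qed (use K in auto)
  have J: "chain_wait i m (Suc n) X \<omega> = X ?W \<omega> + max (chain_wait i m n X \<omega> - X ?A \<omega>) 0" for \<omega>
    by (simp add: chain_wait_def k_def)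
  have n: "nat (k - 1 - m) = n" "\<not> k \<le> m + int n" by (simp_all add: k_def)
  have old: "?Z ?A \<omega> = X ?A \<omega>" "?Z ?W \<omega> = X ?W \<omega>" "?Z ?J \<omega> = chain_wait i m n X \<omega>" for \<omega>
    by (auto simp: burke_family_def k_def)
  have "burke_family i m (Suc n) X q \<omega> = Z2 q \<omega> \<and> burke_law i m (Suc n) L q = L2 q" for q \<omega>
  proof (cases "q = ?A \<or> q = ?W \<or> q = ?J")
    case True
    moreover have "m < k" "k \<le> m + int (Suc n)" by (auto simp: k_def)
    ultimately show ?thesis
      unfolding Z2_def Z1_def L2_def L1_def
      by (elim disjE) (auto simp: old J n burke_family_def burke_law_def L max_def min_def)
  next
    case False
    then have "Z2 q = ?Z q" "L2 q = ?L q" by (auto simp: Z2_def Z1_def L2_def L1_def)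
    moreover have "burke_family i m (Suc n) X q \<omega> = ?Z q \<omega>" "burke_law i m (Suc n) L q = ?L q"
      using False by (auto simp: burke_family_def burke_law_def k_def split: sum.splits)
    ultimately show ?thesis by simp
  qed
  then show ?case using 2 by (subst indep_law_cong) auto
qed

lemma (in prob_space) prob_tendsto_eventually_eq:
  assumes [measurable]: "\<And>n. E n \<in> sets M" "E' \<in> sets M"
    and ev: "AE \<omega> in M. \<forall>\<^sub>F n in sequentially. \<omega> \<in> E n \<longleftrightarrow> \<omega> \<in> E'"
  shows "(\<lambda>n. prob (E n)) \<longlonglongrightarrow> prob E'"
proof -
  have "(\<lambda>n. \<integral>\<omega>. indicat_real (E n) \<omega> \<partial>M) \<longlonglongrightarrow> (\<integral>\<omega>. indicat_real E' \<omega> \<partial>M)"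
  proof (rule integral_dominated_convergence[where w = "\<lambda>_. 1"])
    show "AE \<omega> in M. (\<lambda>n. indicat_real (E n) \<omega>) \<longlonglongrightarrow> indicat_real E' \<omega>"
      using ev
    proof eventually_elim
      case (elim \<omega>)
      then show ?case by (intro tendsto_eventually, eventually_elim) (auto simp: indicator_def)
    qed
  qed (auto simp: indicator_def)
  then show ?thesis by simp
qed

lemma AE_pair_fst:
  assumes "prob_space M'" "AE x in M. P x"
  shows "AE z in M \<Otimes>\<^sub>M M'. P (fst z)"
proof -
  interpret M': prob_space M' by fact
  from assms(2) obtain N where N: "{x\<in>space M. \<not> P x} \<subseteq> N" "emeasure M N = 0" "N \<in> sets M"
    by (auto elim: AE_E)
  show ?thesis
  proof (rule AE_I)
    show "{z \<in> space (M \<Otimes>\<^sub>M M'). \<not> P (fst z)} \<subseteq> N \<times> space M'"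
      using N by (auto simp: space_pair_measure)
    show "emeasure (M \<Otimes>\<^sub>M M') (N \<times> space M') = 0"
      using N by (simp add: M'.emeasure_pair_measure_Times)
    show "N \<times> space M' \<in> sets (M \<Otimes>\<^sub>M M')" using N by simp
  qed
qed

lemma swap_rows_measurable:
  assumes "\<And>r k. r \<in> R \<Longrightarrow> (\<lambda>\<omega>. z \<omega> r k) \<in> borel_measurable N" "i \<in> R" "Suc i \<in> R" "r \<in> R"
  shows "(\<lambda>\<omega>. swap_rows i (z \<omega>) r k) \<in> borel_measurable N"
proof -
  consider "r = i" | "r = Suc i" | "r \<noteq> i" "r \<noteq> Suc i" by blast
  then show ?thesis
    using assms measurable_queue_map[of "\<lambda>\<omega>. z \<omega> (Suc i)" N "\<lambda>\<omega>. z \<omega> i"]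
      measurable_queue_rest[of "\<lambda>\<omega>. z \<omega> (Suc i)" N "\<lambda>\<omega>. z \<omega> i"]
    by cases (simp_all add: swap_rows_def)
qed

definition exp_rows :: "'w measure \<Rightarrow> ('w \<Rightarrow> nat \<Rightarrow> int \<Rightarrow> real) \<Rightarrow> (nat \<Rightarrow> real) \<Rightarrow> nat set \<Rightarrow> bool" where
  "exp_rows M z \<tau> R \<longleftrightarrow>
     indep_law M (\<lambda>(r, k) \<omega>. z \<omega> r k) (\<lambda>(r, k). exponential_law (\<tau> r)) (R \<times> UNIV)"

lemma exp_rows_good:
  assumes "exp_rows M z \<tau> R" "r \<in> R" "0 < \<tau> r"
  shows "AE \<omega> in M. good (z \<omega> r) (\<tau> r)"
  using AE_good[OF assms(1)[unfolded exp_rows_def], of "\<lambda>k. (r, k)" "\<tau> r"] assms(2,3)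
  by (auto simp: inj_def)

lemma exp_rows_measurable:
  "exp_rows M z \<tau> R \<Longrightarrow> r \<in> R \<Longrightarrow> (\<lambda>\<omega>. z \<omega> r k) \<in> borel_measurable M"
  using indep_law_measurable[of M "\<lambda>(r, k) \<omega>. z \<omega> r k" _ "R \<times> UNIV" "(r, k)"] by (simp add: exp_rows_def)

text \<open>An independent coordinate supplies a stationary sojourn time at time \<open>- N\<close>.
  On any finite set of entries the family started there agrees with the exchanged rows once
  \<open>N\<close> is large, so the product formula passes to the limit.\<close>

lemma exp_rows_swap:
  assumes z: "exp_rows M z \<tau> R" and i: "i \<in> R" "Suc i \<in> R" and \<tau>: "0 < \<tau> i" "\<tau> i < \<tau> (Suc i)"
  shows "exp_rows M (\<lambda>\<omega>. swap_rows i (z \<omega>)) (\<tau>(i := \<tau> (Suc i), Suc i := \<tau> i)) R"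
proof -
  note z' = z[unfolded exp_rows_def]
  interpret M: prob_space M using z' by (rule indep_law_prob)
  \<comment> \<open>Arrival rate \<open>a\<close> and service rate
    \<open>a + c = 1 / \<tau> i\<close>; the difference \<open>c\<close> is the rate of the
    stationary sojourn time.\<close>
  define a c where "a = 1 / \<tau> (Suc i)" and "c = 1 / \<tau> i - 1 / \<tau> (Suc i)"
  have a: "0 < a" and c: "0 < c" using \<tau> by (auto simp: a_def c_def divide_simps)
  let ?E = "exp_rate c"
  interpret E: prob_space ?E using c by (rule prob_space_exponential_density)
  interpret P: pair_prob_space M ?E ..
  define X where "X = (\<lambda>q v. case q of Inl p \<Rightarrow> (\<lambda>(r, k) \<omega>. z \<omega> r k) p (fst v) | Inr p \<Rightarrow> (\<lambda>(_ :: unit) x. x) p (snd v))"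
  define L where "L = case_sum (\<lambda>(r, k :: int). exponential_law (\<tau> r)) (\<lambda>_ :: unit. ?E)"
  define K where "K = (R \<times> (UNIV :: int set)) <+> {()}"
  have X: "indep_law (M \<Otimes>\<^sub>M ?E) X L K"
  proof -
    have "indep_law ?E (\<lambda>_ x. x) (\<lambda>_. ?E) {()}"
      by (rule indep_law_single) (auto simp: E.prob_space_axioms)
    from indep_law_product[OF z' this] show ?thesis unfolding X_def L_def K_def .
  qed
  have B: "indep_law (M \<Otimes>\<^sub>M ?E) (burke_family i m n X) (burke_law i m n L) K" for m n
    by (rule indep_law_burke_family[OF X _ _ _ a c])
      (use i in \<open>auto simp: K_def L_def exponential_law_rate a_def c_def\<close>)
  have "AE \<omega> in M. good (z \<omega> i) (\<tau> i) \<and> good (z \<omega> (Suc i)) (\<tau> (Suc i))"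
    using exp_rows_good[OF z i(1)] exp_rows_good[OF z i(2)] \<tau> by simp
  then have AEg: "AE v in M \<Otimes>\<^sub>M ?E. good (z (fst v) i) (\<tau> i) \<and> good (z (fst v) (Suc i)) (\<tau> (Suc i))"
    by (rule AE_pair_fst[OF E.prob_space_axioms])
  show ?thesis unfolding exp_rows_def
  proof (rule indep_lawI)
    let ?L = "\<lambda>(r, k :: int). exponential_law ((\<tau>(i := \<tau> (Suc i), Suc i := \<tau> i)) r)"
    let ?Z = "\<lambda>(r, k) \<omega>. swap_rows i (z \<omega>) r k"
    have meas: "(\<lambda>\<omega>. swap_rows i (z \<omega>) r k) \<in> borel_measurable M" if "r \<in> R" for r k
      by (rule swap_rows_measurable[OF _ i that]) (rule exp_rows_measurable[OF z])
    have Zm: "?Z q \<in> borel_measurable M" if "q \<in> R \<times> UNIV" for q using meas that by auto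
    then show "?Z q \<in> borel_measurable M" if "q \<in> R \<times> UNIV" for q using that .
    show "prob_space (?L q)" if "q \<in> R \<times> UNIV" for q
      using indep_law_marginals(1)[OF z'] that i by (auto split: prod.splits)
    show "sets (?L q) = sets borel" for q by (auto split: prod.splits)
    fix F :: "(nat \<times> int) set" and A
    assume F: "finite F" "F \<subseteq> R \<times> UNIV" and A: "\<And>q. q \<in> F \<Longrightarrow> A q \<in> sets (borel :: real measure)"
    \<comment> \<open>The times \<open>- N + 1\<close> to \<open>N\<close>, a window that eventually
      contains any finite set of entries.\<close>
    let ?B = "\<lambda>N. burke_family i (- int N) (2 * N) X"
    define E where "E N = {v\<in>space (M \<Otimes>\<^sub>M ?E). \<forall>q\<in>F. ?B N (Inl q) v \<in> A q}" for N
    define E' where "E' = {\<omega>\<in>space M. \<forall>q\<in>F. ?Z q \<omega> \<in> A q}"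
    have E': "E' \<in> sets M" unfolding E'_def
      by (rule sets_Collect_family) (use F A Zm in auto)
    have FK: "Inl q \<in> K" if "q \<in> F" for q using that F by (auto simp: K_def)
    have E: "E N \<in> sets (M \<Otimes>\<^sub>M ?E)" for N unfolding E_def
      by (rule sets_Collect_family) (use F(1) A FK indep_law_measurable[OF B] in auto)
    have "(\<lambda>N. measure (M \<Otimes>\<^sub>M ?E) (E N)) \<longlonglongrightarrow> measure (M \<Otimes>\<^sub>M ?E) (E' \<times> space ?E)"
    proof (rule P.prob_tendsto_eventually_eq[OF E])
      show "E' \<times> space ?E \<in> sets (M \<Otimes>\<^sub>M ?E)" using E' by (intro pair_measureI) auto
      show "AE v in M \<Otimes>\<^sub>M ?E. \<forall>\<^sub>F N in sequentially. v \<in> E N \<longleftrightarrow> v \<in> E' \<times> space ?E"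
        using AEg AE_space
      proof eventually_elim
        case (elim v)
        interpret stable_queue "z (fst v) (Suc i)" "z (fst v) i" "\<tau> (Suc i)" "\<tau> i"
          using elim \<tau> by unfold_locales auto
        have "\<forall>\<^sub>F N in sequentially. ?B N (Inl q) v = ?Z q (fst v)" for q
        proof -
          obtain r k where q: "q = (r, k)" by (cases q)
          have "\<forall>\<^sub>F N in sequentially. nat \<bar>k\<bar> + 1 \<le> N" by (rule eventually_ge_at_top)
          moreover have "\<forall>\<^sub>F N in sequentially. wait_chain (z (fst v) (Suc i)) (z (fst v) i) (- int N) (snd v) (nat (k - 1 + int N))
              = sojourn (z (fst v) (Suc i)) (z (fst v) i) (k - 1)"
            by (rule wait_chain_eventually)
          ultimately show ?thesis
          proof eventually_elim
            case (elim N)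
            have "chain_wait i (- int N) (nat (k - 1 - - int N)) X v = sojourn (z (fst v) (Suc i)) (z (fst v) i) (k - 1)"
              using elim(2) by (simp add: chain_wait_def X_def)
            moreover have "- int N < k" "k \<le> - int N + int (2 * N)" using elim(1) by auto
            ultimately show ?case unfolding q
              using queue_map_sojourn[of k] queue_rest_eq[of k]
              by (auto simp: burke_family_def swap_rows_def X_def)
          qed
        qed
        then have "\<forall>\<^sub>F N in sequentially. \<forall>q\<in>F. ?B N (Inl q) v = ?Z q (fst v)"
          using F(1) by (simp add: eventually_ball_finite)
        then show ?case
        proof eventually_elim
          case (elim N)
          then show ?case using \<open>v \<in> space (M \<Otimes>\<^sub>M ?E)\<close>
            by (auto simp: E_def E'_def space_pair_measure)
        qed
      qed
    qed
    moreover have "\<forall>\<^sub>F N in sequentially. measure (M \<Otimes>\<^sub>M ?E) (E N) = (\<Prod>q\<in>F. measure (?L q) (A q))"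
    proof -
      have "\<forall>\<^sub>F N in sequentially. \<forall>q\<in>F. nat \<bar>snd q\<bar> + 1 \<le> N"
        using F(1) by (auto simp: eventually_ball_finite intro: eventually_ge_at_top)
      then show ?thesis
      proof eventually_elim
        case (elim N)
        have "measure (M \<Otimes>\<^sub>M ?E) (E N) =
            measure (M \<Otimes>\<^sub>M ?E) {v\<in>space (M \<Otimes>\<^sub>M ?E). \<forall>p\<in>Inl ` F. ?B N p v \<in> A (projl p)}"
          unfolding E_def by (intro arg_cong[where f = "measure _"]) auto
        also have "\<dots> = (\<Prod>p\<in>Inl ` F. measure (burke_law i (- int N) (2 * N) L p) (A (projl p)))"
          by (rule indep_law_prob_eq[OF B]) (use F FK A in auto)
        also have "\<dots> = (\<Prod>q\<in>F. measure (burke_law i (- int N) (2 * N) L (Inl q)) (A q))"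
          by (simp add: prod.reindex)
        also have "\<dots> = (\<Prod>q\<in>F. measure (?L q) (A q))"
        proof (intro prod.cong refl)
          fix q assume "q \<in> F"
          with elim obtain r k where q: "q = (r, k)" "nat \<bar>k\<bar> + 1 \<le> N" by (cases q) auto
          then have "- int N < k" "k \<le> - int N + int (2 * N)" by auto
          then show "measure (burke_law i (- int N) (2 * N) L (Inl q)) (A q) = measure (?L q) (A q)"
            unfolding q(1) by (auto simp: burke_law_def L_def)
        qed
        finally show ?case .
      qed
    qed
    ultimately have "measure (M \<Otimes>\<^sub>M ?E) (E' \<times> space ?E) = (\<Prod>q\<in>F. measure (?L q) (A q))"
      by (rule LIMSEQ_unique[OF _ tendsto_eventually])
    moreover have "measure (M \<Otimes>\<^sub>M ?E) (E' \<times> space ?E) = measure M E'"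
      using E.emeasure_pair_measure_Times[OF E', of "space ?E"] E.emeasure_space_1
      by (simp add: P.emeasure_eq_measure M.emeasure_eq_measure)
    ultimately show "measure M {\<omega>\<in>space M. \<forall>q\<in>F. ?Z q \<omega> \<in> A q} = (\<Prod>q\<in>F. measure (?L q) (A q))"
      by (simp add: E'_def)
  qed (rule M.prob_space_axioms)
qed

lemma measurable_sequenceI:
  "(\<And>k. (\<lambda>\<omega>. x \<omega> k) \<in> borel_measurable N) \<Longrightarrow> x \<in> measurable N sequence_space"
  using measurable_restrict[of UNIV "\<lambda>k \<omega>. x \<omega> k" N "\<lambda>_. borel"] by (simp add: restrict_UNIV)

lemma exp_rows_prob: "exp_rows M z \<tau> R \<Longrightarrow> prob_space M"
  unfolding exp_rows_def by (rule indep_law_prob)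

lemma exp_rows_subset: "exp_rows M z \<tau> R \<Longrightarrow> R' \<subseteq> R \<Longrightarrow> exp_rows M z \<tau> R'"
  unfolding exp_rows_def by (erule indep_law_subset) auto

lemma exp_rows_cong:
  assumes "\<And>r \<omega>. r \<in> R \<Longrightarrow> z \<omega> r = z' \<omega> r" "\<And>r. r \<in> R \<Longrightarrow> \<tau> r = \<tau>' r"
  shows "exp_rows M z \<tau> R \<longleftrightarrow> exp_rows M z' \<tau>' R"
  unfolding exp_rows_def by (rule indep_law_cong) (use assms in auto)

lemma exp_rows_push:
  assumes z: "exp_rows M z \<tau> R" and R: "{p..p + n} \<subseteq> R"
    and \<tau>: "0 < \<tau> p" "\<And>i. i < n \<Longrightarrow> \<tau> p < \<tau> (Suc (p + i))"
  shows "exp_rows M (\<lambda>\<omega>. push_row p n (z \<omega>)) (push_index p n \<tau>) R"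
  using R \<tau>(2)
proof (induction n)
  case (Suc n)
  have "exp_rows M (\<lambda>\<omega>. push_row p n (z \<omega>)) (push_index p n \<tau>) R"
  proof (rule Suc.IH)
    show "{p..p + n} \<subseteq> R" using Suc.prems(1) by auto
    show "\<tau> p < \<tau> (Suc (p + i))" if "i < n" for i using Suc.prems(2)[of i] that by simp
  qed
  moreover have "p + n \<in> R" "Suc (p + n) \<in> R" using Suc.prems(1) by auto
  ultimately show ?case unfolding push_row_Suc push_index_Suc
    by (rule exp_rows_swap) (use \<tau>(1) Suc.prems(2)[of n] in \<open>auto simp: push_index_def\<close>)
qed (use z in simp)

lemma exp_rows_lift:
  assumes "exp_rows M z \<tau> R" "{p..q} \<subseteq> R" "p \<le> q"
    "\<And>j. p \<le> j \<Longrightarrow> j < q \<Longrightarrow> 0 < \<tau> j \<and> \<tau> j < \<tau> q"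
  shows "\<exists>\<tau>'. exp_rows M (\<lambda>\<omega>. fold swap_rows (rev [p..<q]) (z \<omega>)) \<tau>' R \<and> \<tau>' p = \<tau> q \<and> (\<forall>j<p. \<tau>' j = \<tau> j)"
  using assms(3,1,2,4)
proof (induction q arbitrary: z \<tau> rule: dec_induct)
  case base
  then show ?case by auto
next
  case (step q)
  have *: "rev [p..<Suc q] = q # rev [p..<q]" using step by simp
  let ?\<tau> = "\<tau>(q := \<tau> (Suc q), Suc q := \<tau> q)"
  have "exp_rows M (\<lambda>\<omega>. swap_rows q (z \<omega>)) ?\<tau> R"
    by (rule exp_rows_swap[OF step.prems(1)]) (use step in auto)
  from step.IH[OF this] step.prems step.hyps
  obtain \<tau>' where "exp_rows M (\<lambda>\<omega>. fold swap_rows (rev [p..<q]) (swap_rows q (z \<omega>))) \<tau>' R"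
      "\<tau>' p = ?\<tau> q" "\<forall>j<p. \<tau>' j = ?\<tau> j"
    by (auto simp: subset_eq)
  then show ?case unfolding * using step.hyps by (intro exI[of _ \<tau>']) auto
qed

text \<open>The rows above \<open>p\<close> are untouched while row \<open>q\<close> is lifted, so
  they stay independent of its departures. This gives the law of the evolved sequence at the moment
  it reaches the rows of weights.\<close>

lemma exp_rows_departures:
  assumes z: "exp_rows M z \<tau> {..q}" and "p \<le> q"
    and "\<And>j. p \<le> j \<Longrightarrow> j < q \<Longrightarrow> 0 < \<tau> j \<and> \<tau> j < \<tau> q"
  shows "exp_rows M (\<lambda>\<omega>. (z \<omega>)(p := foldl queue_map (z \<omega> q) (map (z \<omega>) (rev [p..<q])))) (\<tau>(p := \<tau> q)) {..p}"
proof -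
  obtain \<tau>' where \<tau>': "exp_rows M (\<lambda>\<omega>. fold swap_rows (rev [p..<q]) (z \<omega>)) \<tau>' {..q}"
      "\<tau>' p = \<tau> q" "\<forall>j<p. \<tau>' j = \<tau> j"
    using exp_rows_lift[OF z _ assms(2,3)] by auto
  have "exp_rows M (\<lambda>\<omega>. fold swap_rows (rev [p..<q]) (z \<omega>)) \<tau>' {..p}"
    using assms(2) by (intro exp_rows_subset[OF \<tau>'(1)]) auto
  then show ?thesis
    by (rule iffD1[OF exp_rows_cong, rotated 2])
      (use \<tau>'(2,3) lift_row[OF assms(2)] in \<open>auto simp: le_less\<close>)
qed

section \<open>The multiclass measure as the law of stacked rows\<close>

lemma exp_rows_distr:
  assumes z: "exp_rows M z \<tau> R" and "R \<noteq> {}"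
  shows "distr M (\<Pi>\<^sub>M i\<in>R. sequence_space) (\<lambda>\<omega>. \<lambda>i\<in>R. z \<omega> i) =
    (\<Pi>\<^sub>M i\<in>R. \<Pi>\<^sub>M k\<in>(UNIV :: int set). exponential_law (\<tau> i))"
proof -
  note z' = z[unfolded exp_rows_def]
  interpret M: prob_space M using z by (rule exp_rows_prob)
  have rv: "(\<lambda>\<omega>. z \<omega> i) \<in> measurable M sequence_space" if "i \<in> R" for i
    by (rule measurable_sequenceI) (rule exp_rows_measurable[OF z that])
  have "M.indep_vars (\<lambda>i. \<Pi>\<^sub>M q\<in>{i} \<times> UNIV. borel)
      (\<lambda>i \<omega>. restrict (\<lambda>q. (case q of (r, k) \<Rightarrow> \<lambda>\<omega>. z \<omega> r k) \<omega>) ({i} \<times> UNIV)) R"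
    by (rule M.indep_vars_restrict[OF indep_law_indep_vars[OF z']]) (auto simp: disjoint_family_on_def)
  moreover have "(\<lambda>x k. x (i, k)) \<in> measurable (\<Pi>\<^sub>M q\<in>{i} \<times> (UNIV :: int set). (borel :: real measure)) sequence_space" for i :: nat
    by (rule measurable_sequenceI) (simp add: measurable_component_singleton)
  ultimately have "M.indep_vars (\<lambda>_. sequence_space)
      (\<lambda>i \<omega>. (\<lambda>x k. x (i, k)) (restrict (\<lambda>q. (case q of (r, k) \<Rightarrow> \<lambda>\<omega>. z \<omega> r k) \<omega>) ({i} \<times> UNIV))) R"
    by (rule M.indep_vars_compose2)
  then have "M.indep_vars (\<lambda>_. sequence_space) (\<lambda>i \<omega>. z \<omega> i) R" by simp
  then have "distr M (\<Pi>\<^sub>M i\<in>R. sequence_space) (\<lambda>\<omega>. \<lambda>i\<in>R. z \<omega> i) = (\<Pi>\<^sub>M i\<in>R. distr M sequence_space (\<lambda>\<omega>. z \<omega> i))"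
    by (subst (asm) M.indep_vars_iff_distr_eq_PiM'[OF \<open>R \<noteq> {}\<close> rv])
  also have "\<dots> = (\<Pi>\<^sub>M i\<in>R. \<Pi>\<^sub>M k\<in>(UNIV :: int set). exponential_law (\<tau> i))"
  proof (rule PiM_cong[OF refl])
    fix i assume "i \<in> R"
    then have "indep_law M (\<lambda>k. (\<lambda>(r, k) \<omega>. z \<omega> r k) (i, k)) (\<lambda>k. (\<lambda>(r, k). exponential_law (\<tau> r)) (i, k)) (UNIV :: int set)"
      by (intro indep_law_reindex[OF z']) (auto simp: inj_on_def)
    from indep_law_distr[OF this]
    show "distr M sequence_space (\<lambda>\<omega>. z \<omega> i) = (\<Pi>\<^sub>M k\<in>(UNIV :: int set). exponential_law (\<tau> i))"
      by (simp add: restrict_UNIV)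
  qed
  finally show ?thesis .
qed

lemma measurable_queue_stack:
  assumes "\<And>i k. i \<le> j \<Longrightarrow> (\<lambda>\<omega>. z \<omega> i k) \<in> borel_measurable N"
  shows "(\<lambda>\<omega>. queue_stack (z \<omega>) j) \<in> measurable N sequence_space"
proof -
  have "(\<lambda>\<omega>. queue_stack (z \<omega>) j k) \<in> borel_measurable N" for k
    unfolding queue_stack_def
    using measurable_foldl_queue_map[of "\<lambda>\<omega>. z \<omega> j" N "rev [0..<j]" "\<lambda>i \<omega>. z \<omega> i" k] assms by simp
  then show ?thesis by (rule measurable_sequenceI)
qed

lemma multiclass_law:
  assumes z: "exp_rows M z \<tau> {..<length \<sigma>}" and \<sigma>: "\<sigma> \<noteq> []" "\<And>i. i < length \<sigma> \<Longrightarrow> \<tau> i = \<sigma> ! i"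
  shows "distr M (\<Pi>\<^sub>M i\<in>{..<length \<sigma>}. sequence_space) (\<lambda>\<omega>. \<lambda>i\<in>{..<length \<sigma>}. queue_stack (z \<omega>) i) =
    multiclass_measure \<sigma>"
proof -
  let ?R = "{..<length \<sigma>}" and ?S = "\<Pi>\<^sub>M i\<in>{..<length \<sigma>}. sequence_space"
  let ?f = "\<lambda>I. \<lambda>i\<in>?R. queue_map_iter (map I (rev [0..<Suc i]))"
  have f: "?f \<in> measurable ?S ?S"
  proof (rule measurable_restrict)
    fix i assume "i \<in> ?R"
    then have "(\<lambda>I. I j k) \<in> borel_measurable ?S" if "j \<le> i" for j k
      using that by (intro measurable_component_singleton[THEN measurable_compose]
          measurable_component_singleton) auto
    then show "(\<lambda>I. queue_map_iter (map I (rev [0..<Suc i]))) \<in> measurable ?S sequence_space"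
      unfolding queue_stack_eq by (intro measurable_queue_stack)
  qed
  have z_meas: "(\<lambda>\<omega>. \<lambda>i\<in>?R. z \<omega> i) \<in> measurable M ?S"
  proof (rule measurable_restrict)
    fix i assume "i \<in> ?R"
    then show "(\<lambda>\<omega>. z \<omega> i) \<in> measurable M sequence_space"
      by (intro measurable_sequenceI exp_rows_measurable[OF z])
  qed
  have "multiclass_measure \<sigma> = distr (\<Pi>\<^sub>M i\<in>?R. \<Pi>\<^sub>M k\<in>(UNIV :: int set). exponential_law (\<tau> i)) ?S ?f"
    unfolding multiclass_measure_def using \<sigma> by (intro arg_cong[where f = "\<lambda>N. distr N _ _"] PiM_cong) auto
  also have "\<dots> = distr (distr M ?S (\<lambda>\<omega>. \<lambda>i\<in>?R. z \<omega> i)) ?S ?f"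
    using \<sigma> by (subst exp_rows_distr[OF z]) auto
  also have "\<dots> = distr M ?S (\<lambda>\<omega>. ?f (\<lambda>i\<in>?R. z \<omega> i))"
    unfolding distr_distr[OF f z_meas] comp_def ..
  also have "(\<lambda>\<omega>. ?f (\<lambda>i\<in>?R. z \<omega> i)) = (\<lambda>\<omega>. \<lambda>i\<in>?R. queue_stack (z \<omega>) i)"
    unfolding queue_stack_eq
    by (intro ext restrict_ext queue_stack_cong) auto
  finally show ?thesis ..
qed

text \<open>Each induction step pushes the lowest row of mean one below all rows of
  \<open>\<rho>\<close>, where it is discarded. Row \<open>0\<close> is never moved, which keeps the
  top weights in the joint law; for \<open>N = 0\<close> the stacks are those that define the
  measure.\<close>

lemma multiclass_law_stationary:
  assumes z: "exp_rows M z \<tau> {..<Suc N + length \<rho>}"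
    and one: "\<And>i. i \<le> N \<Longrightarrow> \<tau> i = 1" and \<tau>: "\<And>i. i < length \<rho> \<Longrightarrow> \<tau> (Suc N + i) = \<rho> ! i"
    and \<rho>: "sorted_wrt (<) (1 # \<rho>)"
  shows "distr M (\<Pi>\<^sub>M i\<in>{..<Suc (length \<rho>)}. sequence_space)
      (\<lambda>\<omega>. \<lambda>i\<in>{..<Suc (length \<rho>)}. case i of 0 \<Rightarrow> z \<omega> 0 | Suc j \<Rightarrow> queue_stack (z \<omega>) (Suc N + j)) =
    multiclass_measure (1 # \<rho>)"
  using z one \<tau>
proof (induction N arbitrary: z \<tau>)
  case 0
  have "distr M (\<Pi>\<^sub>M i\<in>{..<length (1 # \<rho>)}. sequence_space) (\<lambda>\<omega>. \<lambda>i\<in>{..<length (1 # \<rho>)}. queue_stack (z \<omega>) i) =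
      multiclass_measure (1 # \<rho>)"
    by (rule multiclass_law[where \<tau> = \<tau>]) (use 0 in \<open>auto simp: nth_Cons split: nat.splits\<close>)
  moreover have "(case i of 0 \<Rightarrow> z \<omega> 0 | Suc j \<Rightarrow> queue_stack (z \<omega>) (Suc 0 + j)) = queue_stack (z \<omega>) i" for i \<omega>
    by (cases i) (auto simp: queue_stack_def)
  ultimately show ?case by (simp only: list.size add_0_right add_Suc_right)
next
  case (Suc N)
  let ?n = "length \<rho>" and ?R = "{..<Suc (length \<rho>)}"
  have gt1: "1 < \<rho> ! i" if "i < ?n" for i using \<rho> that by simp
  have inc: "\<rho> ! i < \<rho> ! j" if "i < j" "j < ?n" for i j using \<rho> that by (simp add: sorted_wrt_nth_less)
  let ?z = "\<lambda>\<omega>. push_row (Suc N) ?n (z \<omega>)" and ?\<tau> = "push_index (Suc N) ?n \<tau>"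
  have \<tau>1: "\<tau> i = 1" if "i \<le> Suc N" for i using Suc.prems(2) that by auto
  have \<tau>2: "\<tau> j = \<rho> ! (j - Suc (Suc N))" if "Suc N < j" "j < Suc (Suc N) + ?n" for j
  proof -
    have "Suc (Suc N) \<le> j" using that by simp
    then obtain i where "j = Suc (Suc N) + i" using le_Suc_ex by blast
    then show ?thesis using Suc.prems(3)[of i] that by simp
  qed
  have top: "\<tau> i < \<tau> j" if "Suc N < j" "j \<le> Suc N + ?n" "i < j" for i j
    using \<tau>1[of i] \<tau>2[of i] \<tau>2[of j] gt1[of "j - Suc (Suc N)"] inc[of "i - Suc (Suc N)" "j - Suc (Suc N)"] that
    by (cases "i \<le> Suc N") auto
  have pos: "0 < \<tau> i" if "i \<le> Suc N + ?n" for i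
    using \<tau>1[of i] top[of i 0] \<tau>1[of 0] that by (cases "i \<le> Suc N") auto
  have z': "exp_rows M ?z ?\<tau> {..<Suc (Suc N) + ?n}"
    by (rule exp_rows_push[OF Suc.prems(1)]) (use pos top in auto)
  have IH: "distr M (\<Pi>\<^sub>M i\<in>?R. sequence_space)
      (\<lambda>\<omega>. \<lambda>i\<in>?R. case i of 0 \<Rightarrow> ?z \<omega> 0 | Suc j \<Rightarrow> queue_stack (?z \<omega>) (Suc N + j)) = multiclass_measure (1 # \<rho>)"
  proof (rule Suc.IH[where \<tau> = ?\<tau>])
    show "exp_rows M ?z ?\<tau> {..<Suc N + ?n}" by (rule exp_rows_subset[OF z']) auto
    show "?\<tau> i = 1" if "i \<le> N" for i using that \<tau>1 by (simp add: push_index_def)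
    show "?\<tau> (Suc N + i) = \<rho> ! i" if "i < ?n" for i using that Suc.prems(3)[of i] by (simp add: push_index_def)
  qed
  have meas: "(\<lambda>\<omega>. \<lambda>i\<in>?R. case i of 0 \<Rightarrow> y \<omega> 0 | Suc j \<Rightarrow> queue_stack (y \<omega>) (m + j)) \<in>
      measurable M (\<Pi>\<^sub>M i\<in>?R. sequence_space)" if y: "exp_rows M y \<upsilon> {..<Suc (Suc N) + ?n}" and m: "m \<le> Suc (Suc N)" for y \<upsilon> m
  proof (rule measurable_restrict)
    fix i assume i: "i \<in> ?R"
    show "(\<lambda>\<omega>. case i of 0 \<Rightarrow> y \<omega> 0 | Suc j \<Rightarrow> queue_stack (y \<omega>) (m + j)) \<in> measurable M sequence_space"
    proof (cases i)
      case 0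
      then show ?thesis
        by (auto intro!: measurable_sequenceI exp_rows_measurable[OF y])
    next
      case (Suc j)
      then show ?thesis
        using i m by (auto intro!: measurable_queue_stack exp_rows_measurable[OF y])
    qed
  qed
  \<comment> \<open>The pushing identity is pathwise but asks for rows with the right slopes, hence
    holds almost surely.\<close>
  have "AE \<omega> in M. \<forall>j\<in>{..<Suc (Suc N) + ?n}. good (z \<omega> j) (\<tau> j)"
    by (subst AE_ball_countable) (use exp_rows_good[OF Suc.prems(1)] pos in auto)
  then have "AE \<omega> in M. (\<lambda>i\<in>?R. case i of 0 \<Rightarrow> ?z \<omega> 0 | Suc j \<Rightarrow> queue_stack (?z \<omega>) (Suc N + j)) =
      (\<lambda>i\<in>?R. case i of 0 \<Rightarrow> z \<omega> 0 | Suc j \<Rightarrow> queue_stack (z \<omega>) (Suc (Suc N) + j))"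
  proof eventually_elim
    case (elim \<omega>)
    have "queue_stack (?z \<omega>) (Suc N + j) = queue_stack (z \<omega>) (Suc (Suc N + j))" if "j < ?n" for j
      by (rule queue_stack_push_row[where \<tau> = \<tau>]) (use elim top that in auto)
    then show ?case by (intro restrict_ext) (auto simp: push_row_above split: nat.splits)
  qed
  then have "distr M (\<Pi>\<^sub>M i\<in>?R. sequence_space)
      (\<lambda>\<omega>. \<lambda>i\<in>?R. case i of 0 \<Rightarrow> ?z \<omega> 0 | Suc j \<Rightarrow> queue_stack (?z \<omega>) (Suc N + j)) =
    distr M (\<Pi>\<^sub>M i\<in>?R. sequence_space)
      (\<lambda>\<omega>. \<lambda>i\<in>?R. case i of 0 \<Rightarrow> z \<omega> 0 | Suc j \<Rightarrow> queue_stack (z \<omega>) (Suc (Suc N) + j))"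
    by (intro distr_cong_AE meas[OF z'] meas[OF Suc.prems(1)]) auto
  from trans[OF this[symmetric] IH] show ?case .
qed

subsection \<open>Busemann rows\<close>

lemma indep_law_AE_cong:
  assumes X: "indep_law M X L K" and X': "\<And>q. q \<in> K \<Longrightarrow> X' q \<in> borel_measurable M"
    and eq: "\<And>q. q \<in> K \<Longrightarrow> AE \<omega> in M. X q \<omega> = X' q \<omega>"
  shows "indep_law M X' L K"
proof (rule indep_lawI)
  interpret M: prob_space M using X by (rule indep_law_prob)
  fix F A assume F: "finite F" "F \<subseteq> K" and A: "\<And>q. q \<in> F \<Longrightarrow> A q \<in> sets (borel :: real measure)"
  have "AE \<omega> in M. \<forall>q\<in>F. X q \<omega> = X' q \<omega>" using F eq by (intro AE_finite_allI) auto
  then have "measure M {\<omega>\<in>space M. \<forall>q\<in>F. X' q \<omega> \<in> A q} = measure M {\<omega>\<in>space M. \<forall>q\<in>F. X q \<omega> \<in> A q}"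
    by (intro M.finite_measure_eq_AE sets_Collect_family)
      (use F A X' indep_law_measurable[OF X] in auto)
  also have "\<dots> = (\<Prod>q\<in>F. measure (L q) (A q))" using F A by (rule indep_law_prob_eq[OF X])
  finally show "measure M {\<omega>\<in>space M. \<forall>q\<in>F. X' q \<omega> \<in> A q} = (\<Prod>q\<in>F. measure (L q) (A q))" .
qed (use X X' in \<open>auto simp: indep_law_def\<close>)

lemma path_bounds:
  "p \<noteq> [] \<Longrightarrow> successively (\<lambda>x y. y - x \<in> {e1, e2}) p \<Longrightarrow>
    (\<forall>x\<in>set p. fst (hd p) \<le> fst x \<and> fst x \<le> fst (last p) \<and> snd (hd p) \<le> snd x \<and> snd x \<le> snd (last p)) \<and>
    int (length p) = 1 + (fst (last p) - fst (hd p)) + (snd (last p) - snd (hd p))"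
proof (induction p)
  case (Cons x p)
  show ?case
  proof (cases p)
    case (Cons y q)
    then have s: "y - x \<in> {e1, e2}" "successively (\<lambda>x y. y - x \<in> {e1, e2}) p" using Cons.prems by auto
    then have "y = x + e1 \<or> y = x + e2" by (auto simp: algebra_simps)
    then have "fst y = fst x + 1 \<and> snd y = snd x \<or> fst y = fst x \<and> snd y = snd x + 1" by (auto simp: e1_def e2_def)
    then show ?thesis using Cons.IH s(2) Cons by fastforce
  qed simp
qed simp

lemma up_right_paths_le:
  "p \<in> up_right_paths u v \<Longrightarrow> x \<in> set p \<Longrightarrow> snd x \<le> snd v"
  using path_bounds[of p] by (auto simp: up_right_paths_def)

lemma finite_up_right_paths: "finite (up_right_paths u v)"
proof (rule finite_subset)
  let ?box = "{fst u..fst v} \<times> {snd u..snd v}"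
  let ?n = "nat (1 + (fst v - fst u) + (snd v - snd u))"
  show "up_right_paths u v \<subseteq> {p. set p \<subseteq> ?box \<and> length p \<le> ?n}"
  proof
    fix p assume "p \<in> up_right_paths u v"
    then have p: "p \<noteq> []" "hd p = u" "last p = v" "successively (\<lambda>x y. y - x \<in> {e1, e2}) p"
      by (auto simp: up_right_paths_def)
    show "p \<in> {p. set p \<subseteq> ?box \<and> length p \<le> ?n}"
      using path_bounds[OF p(1,4)] p(2,3) by (auto simp: mem_Times_iff)
  qed
  show "finite {p. set p \<subseteq> ?box \<and> length p \<le> ?n}"
    by (rule finite_lists_length_le) simp
qed

text \<open>A path to \<open>v\<close> never rises above the level of \<open>v\<close>; the product
  over levels up to \<open>s\<close> records this dependence.\<close>

lemma measurable_last_passage: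
  assumes "snd v \<le> s"
  shows "(\<lambda>w. last_passage w u v) \<in> borel_measurable (\<Pi>\<^sub>M z\<in>{z :: site. snd z \<le> s}. (borel :: real measure))"
  unfolding last_passage_def
proof (rule borel_measurable_Max[OF finite_up_right_paths])
  fix p assume "p \<in> up_right_paths u v"
  then have "\<forall>x\<in>set p. snd x \<le> s" using up_right_paths_le assms by (meson order_trans)
  then show "(\<lambda>w. \<Sum>x\<leftarrow>p. w x) \<in> borel_measurable (\<Pi>\<^sub>M z\<in>{z :: site. snd z \<le> s}. (borel :: real measure))"
    by (induction p) (auto intro!: borel_measurable_add measurable_component_singleton)
qed

lemma last_passage_restrict:
  assumes "snd v \<le> s"
  shows "last_passage (restrict w {z. snd z \<le> s}) u v = last_passage w u v"
proof -
  have "(\<Sum>x\<leftarrow>p. restrict w {z. snd z \<le> s} x) = (\<Sum>x\<leftarrow>p. w x)" if "p \<in> up_right_paths u v" for p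
    using up_right_paths_le[OF that] assms by (intro arg_cong[where f = sum_list] map_cong) force+
  then show ?thesis unfolding last_passage_def by (metis (mono_tags, lifting) image_cong)
qed

lemma distributed_exponential_law:
  assumes "distributed M lborel X (exponential_density l)" "m = 1 / l"
  shows "X \<in> borel_measurable M" "distr M borel X = exponential_law m"
proof -
  show "X \<in> borel_measurable M" using assms(1) by (auto simp: distributed_def)
  have "distr M borel X = distr M lborel X" by (rule distr_cong) auto
  also have "\<dots> = exp_rate l" using assms(1) by (rule distributed_distr_eq_density)
  finally show "distr M borel X = exponential_law m" by (simp add: exponential_law_rate assms(2))
qed

locale exponential_cgm = busemann_process M Y B
  for M :: "'w measure" and Y B +
  assumes Y_indep: "indep_vars (\<lambda>_. borel) Y UNIV"
    and Y_exp: "\<And>x. distributed M lborel (Y x) (exponential_density 1)"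
begin

lemma Y_law: "indep_law M Y (\<lambda>_. exponential_law 1) UNIV"
  by (rule indep_lawI_indep_vars[OF prob_space_axioms Y_indep])
    (rule distributed_exponential_law(2)[OF Y_exp], simp)

lemma B_measurable:
  assumes "1 < \<rho>" shows "B \<rho> x y \<in> borel_measurable M"
proof -
  obtain f where f: "f \<in> borel_measurable (\<Pi>\<^sub>M z\<in>UNIV. borel)" "\<And>\<omega>. \<omega> \<in> space M \<Longrightarrow> B \<rho> x y \<omega> = f (\<lambda>z. Y z \<omega>)"
    using borel_function_of_weights[OF assms] by blast
  have "(\<lambda>\<omega>. \<lambda>z\<in>UNIV. Y z \<omega>) \<in> measurable M (\<Pi>\<^sub>M z\<in>UNIV. borel)"
    by (rule measurable_restrict_family) (use indep_law_measurable[OF Y_law] in auto)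
  then have "(\<lambda>\<omega>. \<lambda>z. Y z \<omega>) \<in> measurable M (\<Pi>\<^sub>M z\<in>UNIV. borel)" by (simp add: restrict_UNIV)
  from measurable_compose[OF this f(1)] show ?thesis
    using f(2) by (simp cong: measurable_cong)
qed

lemma AE_B_cocycle:
  assumes "1 < \<rho>"
  shows "AE \<omega> in M. \<forall>x y z. B \<rho> x y \<omega> + B \<rho> y z \<omega> = B \<rho> x z \<omega> \<and>
    Y x \<omega> = min (B \<rho> (x - e1) x \<omega>) (B \<rho> (x - e2) x \<omega>)"
  using monotone_additive_recovery
proof eventually_elim
  case (elim \<omega>)
  \<comment> \<open>Cocycle and recovery are given for the larger of two parameters, so some
    parameter between 1 and \<open>\<rho>\<close> has to serve as the smaller one.\<close>
  have "1 < (1 + \<rho>) / 2" "(1 + \<rho>) / 2 < \<rho>" using assms by simp_all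
  then show ?case using elim by blast
qed

lemma AE_B_mono:
  assumes "1 < \<kappa>" "\<kappa> \<le> \<rho>"
  shows "AE \<omega> in M. \<forall>k s. B \<kappa> (k - 1, s) (k, s) \<omega> \<le> B \<rho> (k - 1, s) (k, s) \<omega>"
proof (cases "\<kappa> = \<rho>")
  case False
  then have "\<kappa> < \<rho>" using assms by simp
  from monotone_additive_recovery show ?thesis
  proof eventually_elim
    case (elim \<omega>)
    show ?case
    proof (intro allI)
      fix k s :: int
      have "B \<kappa> (k - 1, s) ((k - 1, s) + e1) \<omega> \<le> B \<rho> (k - 1, s) ((k - 1, s) + e1) \<omega>"
        using elim assms(1) \<open>\<kappa> < \<rho>\<close> by blast
      then show "B \<kappa> (k - 1, s) (k, s) \<omega> \<le> B \<rho> (k - 1, s) (k, s) \<omega>" by (simp add: e1_def)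
    qed
  qed
qed simp

lemma B_row_law:
  assumes "1 < \<rho>"
  shows "indep_law M (\<lambda>k. B \<rho> (k - 1, s) (k, s)) (\<lambda>_. exponential_law \<rho>) UNIV"
proof (rule indep_lawI_indep_vars[OF prob_space_axioms])
  show "indep_vars (\<lambda>_. borel) (\<lambda>k. B \<rho> (k - 1, s) (k, s)) UNIV"
    using down_right_independent[OF assms, of "\<lambda>k. (k - 1, s)"] by (simp add: e1_def)
  show "distr M borel (B \<rho> (k - 1, s) (k, s)) = exponential_law \<rho>" for k
    using distributed_exponential_law(2)[OF horizontal_exponential[OF assms, of "(k, s)"], of \<rho>]
    by (simp add: e1_def inverse_eq_divide)
qed

lemma B_column_law:
  assumes "1 < \<rho>"
  shows "indep_law M (\<lambda>k. B \<rho> (c, k - 1) (c, k)) (\<lambda>_. exponential_law (\<rho> / (\<rho> - 1))) UNIV"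
proof -
  \<comment> \<open>Down-right paths run down the column, so the independent increments come with
    reversed sign and index; the cocycle property turns them around almost surely.\<close>
  have "indep_vars (\<lambda>_. borel) (\<lambda>k. B \<rho> (c, - k) (c, - k - 1)) UNIV"
    using down_right_independent[OF assms, of "\<lambda>k. (c, - k)"] by (simp add: e2_def)
  from indep_vars_compose2[OF this, of "\<lambda>_ x. - x" "\<lambda>_. borel"]
  have ind: "indep_vars (\<lambda>_. borel) (\<lambda>k \<omega>. - B \<rho> (c, - k) (c, - k - 1) \<omega>) UNIV" by simp
  have AE: "AE \<omega> in M. - B \<rho> (c, - k) (c, - k - 1) \<omega> = B \<rho> (c, - k - 1) (c, - k) \<omega>" for k
    using AE_B_cocycle[OF assms]
  proof eventually_elim
    case (elim \<omega>)
    have "B \<rho> (c, - k) (c, - k) \<omega> + B \<rho> (c, - k) (c, - k) \<omega> = B \<rho> (c, - k) (c, - k) \<omega>"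
      "B \<rho> (c, - k) (c, - k - 1) \<omega> + B \<rho> (c, - k - 1) (c, - k) \<omega> = B \<rho> (c, - k) (c, - k) \<omega>"
      using elim by blast+
    then show ?case by simp
  qed
  have law: "distr M borel (B \<rho> (c, k - 1) (c, k)) = exponential_law (\<rho> / (\<rho> - 1))" for k
    using distributed_exponential_law(2)[OF vertical_exponential[OF assms, of "(c, k)"], of "\<rho> / (\<rho> - 1)"] assms
    by (simp add: e2_def field_simps)
  have "indep_law M (\<lambda>k \<omega>. - B \<rho> (c, - k) (c, - k - 1) \<omega>) (\<lambda>_. exponential_law (\<rho> / (\<rho> - 1))) UNIV"
  proof (rule indep_lawI_indep_vars[OF prob_space_axioms ind])
    fix k
    have "distr M borel (\<lambda>\<omega>. - B \<rho> (c, - k) (c, - k - 1) \<omega>) = distr M borel (B \<rho> (c, - k - 1) (c, - k))"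
      by (rule distr_cong_AE) (use AE B_measurable[OF assms] in auto)
    then show "distr M borel (\<lambda>\<omega>. - B \<rho> (c, - k) (c, - k - 1) \<omega>) = exponential_law (\<rho> / (\<rho> - 1))"
      using law[of "- k"] by simp
  qed
  then have "indep_law M (\<lambda>k. B \<rho> (c, - k - 1) (c, - k)) (\<lambda>_. exponential_law (\<rho> / (\<rho> - 1))) UNIV"
    by (rule indep_law_AE_cong) (use AE B_measurable[OF assms] in auto)
  from indep_law_reindex[OF this, of uminus UNIV] show ?thesis by (simp add: inj_on_def)
qed

text \<open>Busemann functions are limits of passage values started far to the south-west, and paths
  ending at level at most \<open>s\<close> see no weights above \<open>s\<close>. This makes a
  Busemann row independent of the weights above it.\<close>

lemma B_past:
  assumes \<rho>: "1 < \<rho>" and x: "snd x \<le> s" and y: "snd y \<le> s"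
  obtains g where "g \<in> borel_measurable (\<Pi>\<^sub>M z\<in>{z :: site. snd z \<le> s}. (borel :: real measure))"
    "AE \<omega> in M. B \<rho> x y \<omega> = g (\<lambda>z\<in>{z. snd z \<le> s}. Y z \<omega>)"
proof -
  define a b where "a = fst (busemann_direction \<rho>)" and "b = snd (busemann_direction \<rho>)"
  \<comment> \<open>Rounding down multiples of the direction vector gives one admissible sequence;
    its first coordinate tends to -infinity because \<open>a < 0\<close>.\<close>
  define u where "u n = (\<lfloor>a * real n\<rfloor>, \<lfloor>b * real n\<rfloor>)" for n :: nat
  have fl: "(\<lambda>n. real_of_int \<lfloor>c * real n\<rfloor> / real n) \<longlonglongrightarrow> c" for c :: real
  proof (rule tendsto_sandwich)
    show "\<forall>\<^sub>F n in sequentially. c - 1 / real n \<le> real_of_int \<lfloor>c * real n\<rfloor> / real n"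
      using eventually_gt_at_top[of 0]
    proof eventually_elim
      case (elim n)
      have "c * real n - 1 \<le> real_of_int \<lfloor>c * real n\<rfloor>" by linarith
      then have "(c * real n - 1) / real n \<le> real_of_int \<lfloor>c * real n\<rfloor> / real n"
        by (intro divide_right_mono) auto
      then show ?case using elim by (simp add: diff_divide_distrib)
    qed
    show "\<forall>\<^sub>F n in sequentially. real_of_int \<lfloor>c * real n\<rfloor> / real n \<le> c"
      using eventually_gt_at_top[of 0] by eventually_elim (simp add: field_simps)
    show "(\<lambda>n. c - 1 / real n) \<longlonglongrightarrow> c" using lim_1_over_n[where 'a = real] by (auto intro!: tendsto_eq_intros)
  qed simp
  have dir: "(\<lambda>n. (real_of_int (fst (u n)) / real n, real_of_int (snd (u n)) / real n)) \<longlonglongrightarrow> busemann_direction \<rho>"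
    using tendsto_Pair[OF fl[of a] fl[of b]] by (simp add: u_def a_def b_def)
  have neg: "a < 0"
  proof -
    have "0 < 1 + (\<rho> - 1)\<^sup>2" by (intro add_pos_nonneg) auto
    then show ?thesis by (simp add: a_def busemann_direction_def)
  qed
  have "filterlim (\<lambda>n. \<bar>fst (u n)\<bar> + \<bar>snd (u n)\<bar>) at_top sequentially"
  proof (rule filterlim_at_top_mono)
    show "filterlim (\<lambda>n. - \<lfloor>a * real n\<rfloor>) at_top sequentially"
      unfolding filterlim_at_top
    proof
      fix Z :: int
      obtain n0 :: nat where n0: "of_int Z / - a < n0" using reals_Archimedean2 by blast
      show "\<forall>\<^sub>F n in sequentially. Z \<le> - \<lfloor>a * real n\<rfloor>"
        using eventually_ge_at_top[of n0]
      proof eventually_elim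
        case (elim n)
        then have "of_int Z / - a < n" using n0 by linarith
        then have "of_int Z < - (a * n)" using neg by (simp add: field_simps)
        then show ?case by linarith
      qed
    qed
    show "\<forall>\<^sub>F n in sequentially. - \<lfloor>a * real n\<rfloor> \<le> \<bar>fst (u n)\<bar> + \<bar>snd (u n)\<bar>"
      by (intro always_eventually allI) (simp add: u_def)
  qed
  note fil = this
  have lim:
    "AE \<omega> in M. (\<lambda>n. last_passage (\<lambda>z. Y z \<omega>) (u n) y - last_passage (\<lambda>z. Y z \<omega>) (u n) x) \<longlonglongrightarrow> B \<rho> x y \<omega>"
    using busemann_limit[OF \<rho>]
  proof eventually_elim
    case (elim \<omega>)
    then show ?case using fil dir by blast
  qed
  \<comment> \<open>\<open>lim\<close> has a fixed value where the sequence diverges, so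
    \<open>g\<close> is measurable on the whole space.\<close>
  define g where "g w = lim (\<lambda>n. last_passage w (u n) y - last_passage w (u n) x)" for w
  show ?thesis
  proof (rule that)
    show "g \<in> borel_measurable (\<Pi>\<^sub>M z\<in>{z :: site. snd z \<le> s}. (borel :: real measure))"
      unfolding g_def
      by (intro borel_measurable_lim_metric borel_measurable_diff measurable_last_passage x y)
    show "AE \<omega> in M. B \<rho> x y \<omega> = g (\<lambda>z\<in>{z. snd z \<le> s}. Y z \<omega>)"
      using lim
    proof eventually_elim
      case (elim \<omega>)
      then show ?case unfolding g_def
        by (simp add: last_passage_restrict[OF x] last_passage_restrict[OF y] limI)
    qed
  qed
qed

text \<open>Rows are counted downwards from level \<open>t\<close>: \<open>N\<close> rows of weights
  above the Busemann row at level \<open>t - N\<close>. This is the one-parameter picture with which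
  the evolved sequence is compared.\<close>

definition level_rows :: "real \<Rightarrow> int \<Rightarrow> nat \<Rightarrow> 'w \<Rightarrow> nat \<Rightarrow> int \<Rightarrow> real" where
  "level_rows \<rho> t N \<omega> r k =
     (if r < N then Y (k, t - int r) \<omega> else B \<rho> (k - 1, t - int N) (k, t - int N) \<omega>)"

text \<open>The Busemann row is a function of the weights on levels up to \<open>t - N\<close>, and
  the rows of weights lie strictly above, so the independence of \<open>Y\<close> separates
  them.\<close>

lemma exp_rows_level_rows:
  assumes \<rho>: "1 < \<rho>"
  shows "exp_rows M (level_rows \<rho> t N) ((\<lambda>_. 1)(N := \<rho>)) {..N}"
  unfolding exp_rows_def
proof (rule indep_lawI[OF prob_space_axioms])
  define s where "s = t - int N"
  let ?S = "{z :: site. snd z \<le> s}" and ?T = "{z :: site. s < snd z}"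
  let ?X = "\<lambda>(r, k) \<omega>. level_rows \<rho> t N \<omega> r k" and ?L = "\<lambda>(r, k :: int). exponential_law (((\<lambda>_. 1)(N := \<rho>)) r)"
  have Ym: "Y z \<in> borel_measurable M" for z using indep_law_measurable[OF Y_law] by simp
  show Xm: "?X q \<in> borel_measurable M" for q
    using B_measurable[OF \<rho>] Ym by (auto simp: level_rows_def split: prod.splits)
  show "prob_space (?L q)" for q using \<rho> by (auto intro!: prob_space_exponential_law split: prod.splits)
  show "sets (?L q) = sets borel" for q by (auto split: prod.splits)
  fix F :: "(nat \<times> int) set" and A
  assume F: "finite F" "F \<subseteq> {..N} \<times> UNIV" and A: "\<And>q. q \<in> F \<Longrightarrow> A q \<in> sets (borel :: real measure)"
  define F1 where "F1 = {k. (N, k) \<in> F}"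
  define F2 where "F2 = {q \<in> F. fst q < N}"
  define F3 where "F3 = (\<lambda>(r, k). (k, t - int r)) ` F2"
  have Feq: "F = Pair N ` F1 \<union> F2" "Pair N ` F1 \<inter> F2 = {}" using F(2) by (force simp: F1_def F2_def)+
  have fin: "finite F1" "finite F2" using F(1) unfolding Feq by (auto dest: finite_imageD simp: inj_on_def)
  have inj2: "inj_on (\<lambda>(r, k). (k, t - int r)) F2" by (auto simp: inj_on_def)
  have "\<exists>g. g \<in> borel_measurable (\<Pi>\<^sub>M z\<in>?S. (borel :: real measure)) \<and>
      (AE \<omega> in M. B \<rho> (k - 1, s) (k, s) \<omega> = g (\<lambda>z\<in>?S. Y z \<omega>))" for k
  proof -
    have "snd (k - 1, s) \<le> s" "snd (k, s) \<le> s" by simp_all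
    from B_past[OF \<rho> this] show ?thesis by blast
  qed
  then have "\<forall>k. \<exists>g. g \<in> borel_measurable (\<Pi>\<^sub>M z\<in>?S. (borel :: real measure)) \<and>
      (AE \<omega> in M. B \<rho> (k - 1, s) (k, s) \<omega> = g (\<lambda>z\<in>?S. Y z \<omega>))" ..
  from choice[OF this] obtain g where g': "\<forall>k. g k \<in> borel_measurable (\<Pi>\<^sub>M z\<in>?S. (borel :: real measure)) \<and>
      (AE \<omega> in M. B \<rho> (k - 1, s) (k, s) \<omega> = g k (\<lambda>z\<in>?S. Y z \<omega>))" ..
  have g: "\<And>k. g k \<in> borel_measurable (\<Pi>\<^sub>M z\<in>?S. (borel :: real measure))"
      "\<And>k. AE \<omega> in M. B \<rho> (k - 1, s) (k, s) \<omega> = g k (\<lambda>z\<in>?S. Y z \<omega>)"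
    using g' by blast+
  define E1 where "E1 = {x \<in> space (\<Pi>\<^sub>M z\<in>?S. (borel :: real measure)). \<forall>k\<in>F1. g k x \<in> A (N, k)}"
  define E2 where "E2 = {x \<in> space (\<Pi>\<^sub>M z\<in>?T. (borel :: real measure)). \<forall>q\<in>F2. (case q of (r, k) \<Rightarrow> x (k, t - int r)) \<in> A q}"
  have E1: "E1 \<in> sets (\<Pi>\<^sub>M z\<in>?S. borel)" unfolding E1_def
    by (rule sets_Collect_family) (use fin g A in \<open>auto simp: F1_def\<close>)
  have E2: "E2 \<in> sets (\<Pi>\<^sub>M z\<in>?T. borel)" unfolding E2_def
    by (rule sets_Collect_family)
      (use fin A in \<open>auto simp: F2_def s_def split: prod.splits intro!: measurable_component_singleton\<close>)
  have YS: "(\<lambda>\<omega>. \<lambda>z\<in>S. Y z \<omega>) \<in> measurable M (\<Pi>\<^sub>M z\<in>S. borel)" for S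
    using Ym by (rule measurable_restrict_family)
  have m1: "{\<omega>\<in>space M. (\<lambda>z\<in>?S. Y z \<omega>) \<in> E1} \<in> sets M" "{\<omega>\<in>space M. (\<lambda>z\<in>?T. Y z \<omega>) \<in> E2} \<in> sets M"
    using measurable_sets[OF YS E1] measurable_sets[OF YS E2] by (simp_all add: vimage_def Int_def conj_commute)
  have ae: "AE \<omega> in M. \<forall>k\<in>F1. B \<rho> (k - 1, s) (k, s) \<omega> = g k (\<lambda>z\<in>?S. Y z \<omega>)"
    using fin g(2) by (intro AE_finite_allI) auto
  have r2: "(\<lambda>z\<in>?T. Y z \<omega>) \<in> E2 \<longleftrightarrow> (\<forall>q\<in>F2. ?X q \<omega> \<in> A q)" if "\<omega> \<in> space M" for \<omega>
    using measurable_space[OF YS that, of ?T] by (auto simp: E2_def F2_def level_rows_def s_def split: prod.splits)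
  have r1: "AE \<omega> in M. (\<lambda>z\<in>?S. Y z \<omega>) \<in> E1 \<longleftrightarrow> (\<forall>k\<in>F1. ?X (N, k) \<omega> \<in> A (N, k))"
    using ae AE_space
  proof eventually_elim
    case (elim \<omega>)
    then show ?case using measurable_space[OF YS elim(2), of ?S] by (auto simp: E1_def level_rows_def s_def)
  qed
  have "measure M {\<omega>\<in>space M. \<forall>q\<in>F. ?X q \<omega> \<in> A q} =
      measure M {\<omega>\<in>space M. (\<lambda>z\<in>?S. Y z \<omega>) \<in> E1 \<and> (\<lambda>z\<in>?T. Y z \<omega>) \<in> E2}"
  proof (rule finite_measure_eq_AE)
    show "AE \<omega> in M. \<omega> \<in> {\<omega>\<in>space M. \<forall>q\<in>F. ?X q \<omega> \<in> A q} \<longleftrightarrow>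
        \<omega> \<in> {\<omega>\<in>space M. (\<lambda>z\<in>?S. Y z \<omega>) \<in> E1 \<and> (\<lambda>z\<in>?T. Y z \<omega>) \<in> E2}"
      using r1 AE_space
    proof eventually_elim
      case (elim \<omega>)
      have "(\<forall>q\<in>F. ?X q \<omega> \<in> A q) \<longleftrightarrow> (\<forall>k\<in>F1. ?X (N, k) \<omega> \<in> A (N, k)) \<and> (\<forall>q\<in>F2. ?X q \<omega> \<in> A q)"
        unfolding Feq(1) ball_Un by blast
      then show ?case using elim r2[OF elim(2)] by simp
    qed
    show "{\<omega>\<in>space M. \<forall>q\<in>F. ?X q \<omega> \<in> A q} \<in> sets M"
      by (rule sets_Collect_family[OF F(1) Xm]) (rule A)
    have "{\<omega>\<in>space M. (\<lambda>z\<in>?S. Y z \<omega>) \<in> E1 \<and> (\<lambda>z\<in>?T. Y z \<omega>) \<in> E2} =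
        {\<omega>\<in>space M. (\<lambda>z\<in>?S. Y z \<omega>) \<in> E1} \<inter> {\<omega>\<in>space M. (\<lambda>z\<in>?T. Y z \<omega>) \<in> E2}" by auto
    then show "{\<omega>\<in>space M. (\<lambda>z\<in>?S. Y z \<omega>) \<in> E1 \<and> (\<lambda>z\<in>?T. Y z \<omega>) \<in> E2} \<in> sets M" using m1 by simp
  qed
  also have "\<dots> = measure M {\<omega>\<in>space M. (\<lambda>z\<in>?S. Y z \<omega>) \<in> E1} * measure M {\<omega>\<in>space M. (\<lambda>z\<in>?T. Y z \<omega>) \<in> E2}"
    by (rule indep_law_events[OF Y_law _ _ _ E1 E2]) auto
  also have "measure M {\<omega>\<in>space M. (\<lambda>z\<in>?S. Y z \<omega>) \<in> E1} = measure M {\<omega>\<in>space M. \<forall>k\<in>F1. B \<rho> (k - 1, s) (k, s) \<omega> \<in> A (N, k)}"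
  proof (rule finite_measure_eq_AE[OF _ m1(1)])
    show "{\<omega>\<in>space M. \<forall>k\<in>F1. B \<rho> (k - 1, s) (k, s) \<omega> \<in> A (N, k)} \<in> sets M"
      by (rule sets_Collect_family) (use fin B_measurable[OF \<rho>] A in \<open>auto simp: F1_def\<close>)
    show "AE \<omega> in M. \<omega> \<in> {\<omega>\<in>space M. (\<lambda>z\<in>?S. Y z \<omega>) \<in> E1} \<longleftrightarrow>
        \<omega> \<in> {\<omega>\<in>space M. \<forall>k\<in>F1. B \<rho> (k - 1, s) (k, s) \<omega> \<in> A (N, k)}"
      using r1 by eventually_elim (auto simp: level_rows_def s_def)
  qed
  also have "\<dots> = (\<Prod>k\<in>F1. measure (exponential_law \<rho>) (A (N, k)))"
    by (rule indep_law_prob_eq[OF B_row_law[OF \<rho>] fin(1)]) (use A in \<open>auto simp: F1_def\<close>)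
  also have "{\<omega>\<in>space M. (\<lambda>z\<in>?T. Y z \<omega>) \<in> E2} = {\<omega>\<in>space M. \<forall>q\<in>F2. (case q of (r, k) \<Rightarrow> Y (k, t - int r)) \<omega> \<in> A q}"
    using r2 by (auto simp: F2_def level_rows_def split: prod.splits)
  also have "measure M \<dots> = (\<Prod>q\<in>F2. measure (exponential_law 1) (A q))"
  proof (rule indep_law_prob_eq)
    have "indep_law M (\<lambda>q. Y (case q of (r, k) \<Rightarrow> (k, t - int r))) (\<lambda>_. exponential_law 1) F2"
      by (rule indep_law_reindex[OF Y_law inj2]) simp
    then show "indep_law M (\<lambda>q. case q of (r, k) \<Rightarrow> Y (k, t - int r)) (\<lambda>_. exponential_law 1) F2"
      by (rule iffD1[OF indep_law_cong, rotated 2]) (auto split: prod.splits)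
  qed (use fin A in \<open>auto simp: F2_def\<close>)
  also have "(\<Prod>k\<in>F1. measure (exponential_law \<rho>) (A (N, k))) * (\<Prod>q\<in>F2. measure (exponential_law 1) (A q)) =
      (\<Prod>q\<in>F. measure (?L q) (A q))"
  proof -
    have "(\<Prod>q\<in>F2. measure (exponential_law 1) (A q)) = (\<Prod>q\<in>F2. measure (?L q) (A q))"
      by (intro prod.cong) (auto simp: F2_def split: prod.splits)
    moreover have "(\<Prod>k\<in>F1. measure (exponential_law \<rho>) (A (N, k))) = (\<Prod>q\<in>Pair N ` F1. measure (?L q) (A q))"
      by (subst prod.reindex) (auto simp: inj_on_def)
    ultimately show ?thesis
      using fin Feq by (simp add: prod.union_disjoint)
  qed
  finally show "measure M {\<omega>\<in>space M. \<forall>q\<in>F. ?X q \<omega> \<in> A q} = (\<Prod>q\<in>F. measure (?L q) (A q))" .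
qed

end

subsection \<open>Exit points\<close>

text \<open>Stacked rows are numbered downwards and passage values upwards, hence the reversal; row
  \<open>N\<close> is the boundary.\<close>

definition rows_exit_left :: "(nat \<Rightarrow> int \<Rightarrow> real) \<Rightarrow> nat \<Rightarrow> int \<Rightarrow> int \<Rightarrow> bool" where
  "rows_exit_left z N j l \<longleftrightarrow> exit_left (\<lambda>s. z (N - 1 - s)) (N - 1) (potential (z N)) j l"

definition rows_exit_right :: "(nat \<Rightarrow> int \<Rightarrow> real) \<Rightarrow> nat \<Rightarrow> int \<Rightarrow> int \<Rightarrow> bool" where
  "rows_exit_right z N j l \<longleftrightarrow> exit_right (\<lambda>s. z (N - 1 - s)) (N - 1) (potential (z N)) j l"

lemma measurable_lp:
  assumes "\<And>r k. r \<le> s \<Longrightarrow> (\<lambda>\<omega>. w \<omega> r k) \<in> borel_measurable N"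
  shows "(\<lambda>\<omega>. lp (w \<omega>) j s n) \<in> borel_measurable N"
  using assms
proof (induction s arbitrary: n)
  case 0
  then show ?case by (induction n) auto
next
  case (Suc s)
  have 1: "(\<lambda>\<omega>. lp (w \<omega>) j s n) \<in> borel_measurable N" for n using Suc by simp
  have 2: "(\<lambda>\<omega>. w \<omega> (Suc s) k) \<in> borel_measurable N" for k using Suc.prems by simp
  note [measurable] = 1 2
  show ?case
  proof (induction n)
    case (Suc n)
    note [measurable] = Suc
    show ?case by simp
  qed simp
qed

lemma measurable_rows_exit:
  assumes z: "\<And>r k. r \<le> N \<Longrightarrow> (\<lambda>\<omega>. z \<omega> r k) \<in> borel_measurable M"
  shows "Measurable.pred M (\<lambda>\<omega>. rows_exit_left (z \<omega>) N j l)" "Measurable.pred M (\<lambda>\<omega>. rows_exit_right (z \<omega>) N j l)"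
proof -
  have 1: "(\<lambda>\<omega>. lp (\<lambda>s. z \<omega> (N - 1 - s)) j (N - 1) n) \<in> borel_measurable M" for j n
    by (rule measurable_lp) (use z in auto)
  have 2: "(\<lambda>\<omega>. potential (z \<omega> N) k) \<in> borel_measurable M" for k
    by (rule measurable_potential) (use z in auto)
  note [measurable] = 1 2
  show "Measurable.pred M (\<lambda>\<omega>. rows_exit_left (z \<omega>) N j l)" "Measurable.pred M (\<lambda>\<omega>. rows_exit_right (z \<omega>) N j l)"
    unfolding rows_exit_left_def rows_exit_right_def exit_left_def exit_right_def lp_to_def by measurable
qed

text \<open>Carries exit probabilities from one coupling to another. The hypothesis
  \<open>dep\<close> bridges the gap between full arrays of rows and the rows in \<open>R\<close>,
  whose law is controlled.\<close>

lemma exp_rows_prob_eq: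
  assumes z: "exp_rows M z \<tau> R" and z': "exp_rows M' z' \<tau> R"
    and Q: "Measurable.pred (\<Pi>\<^sub>M q\<in>R \<times> UNIV. borel) (\<lambda>x. Q (\<lambda>r k. x (r, k)))"
    and dep: "\<And>y y'. (\<And>r. r \<in> R \<Longrightarrow> y r = y' r) \<Longrightarrow> Q y \<longleftrightarrow> Q y'"
  shows "measure M {\<omega>\<in>space M. Q (z \<omega>)} = measure M' {\<omega>\<in>space M'. Q (z' \<omega>)}"
proof -
  let ?P = "\<Pi>\<^sub>M q\<in>R \<times> (UNIV :: int set). (borel :: real measure)"
  let ?D = "\<Pi>\<^sub>M q\<in>R \<times> (UNIV :: int set). (\<lambda>(r, k). exponential_law (\<tau> r)) q"
  let ?S = "{x \<in> space ?P. Q (\<lambda>r k. x (r, k))}"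
  have *: "measure M {\<omega>\<in>space M. Q (z \<omega>)} = measure ?D ?S" if z: "exp_rows M z \<tau> R" for M :: "'c measure" and z
  proof -
    let ?f = "\<lambda>\<omega>. \<lambda>q\<in>R \<times> UNIV. (case q of (r, k) \<Rightarrow> \<lambda>\<omega>. z \<omega> r k) \<omega>"
    have f: "?f \<in> measurable M ?P"
      by (rule measurable_restrict_family) (use exp_rows_measurable[OF z] in auto)
    have "?D = distr M ?P ?f" using indep_law_distr[OF z[unfolded exp_rows_def]] by simp
    then have "measure ?D ?S = measure M (?f -` ?S \<inter> space M)"
      using Q by (simp add: measure_distr[OF f] pred_def)
    also have "?f -` ?S \<inter> space M = {\<omega>\<in>space M. Q (z \<omega>)}"
    proof -
      have "Q (\<lambda>r k. ?f \<omega> (r, k)) \<longleftrightarrow> Q (z \<omega>)" for \<omega> by (rule dep) auto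
      then show ?thesis using measurable_space[OF f] by auto
    qed
    finally show ?thesis ..
  qed
  show ?thesis using *[OF z] *[OF z'] by simp
qed

lemma rows_exit_prob_eq:
  assumes "exp_rows M z \<tau> {..N}" "exp_rows M' z' \<tau> {..N}"
  shows "measure M {\<omega>\<in>space M. \<not> rows_exit_left (z \<omega>) N j l} = measure M' {\<omega>\<in>space M'. \<not> rows_exit_left (z' \<omega>) N j l}"
    "measure M {\<omega>\<in>space M. \<not> rows_exit_right (z \<omega>) N j l} = measure M' {\<omega>\<in>space M'. \<not> rows_exit_right (z' \<omega>) N j l}"
proof -
  have m: "(\<lambda>x. x (r, k)) \<in> borel_measurable (\<Pi>\<^sub>M q\<in>{..N} \<times> (UNIV :: int set). (borel :: real measure))" if "r \<le> N" for r k
    using that by (intro measurable_component_singleton) auto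
  note me = measurable_rows_exit[where z = "\<lambda>x r k. x (r, k)" and M = "\<Pi>\<^sub>M q\<in>{..N} \<times> (UNIV :: int set). (borel :: real measure)", OF m]
  have lpc: "lp w j s n = lp w' j s n" if "\<And>r. r \<le> s \<Longrightarrow> w r = w' r" for w w' :: "nat \<Rightarrow> int \<Rightarrow> real" and j s n
    using that
  proof (induction s arbitrary: n)
    case 0
    then show ?case by (induction n) auto
  next
    case (Suc s)
    have "lp w j s n = lp w' j s n" for n using Suc by simp
    then show ?case using Suc.prems by (induction n) auto
  qed
  have dep: "rows_exit_left y N j l \<longleftrightarrow> rows_exit_left y' N j l" "rows_exit_right y N j l \<longleftrightarrow> rows_exit_right y' N j l"
    if "\<And>r. r \<in> {..N} \<Longrightarrow> y r = y' r" for y y' :: "nat \<Rightarrow> int \<Rightarrow> real"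
  proof -
    have "lp_to (\<lambda>s. y (N - 1 - s)) (N - 1) i l = lp_to (\<lambda>s. y' (N - 1 - s)) (N - 1) i l" for i l
      unfolding lp_to_def by (rule lpc) (use that in auto)
    moreover have "y N = y' N" using that by simp
    ultimately show "rows_exit_left y N j l \<longleftrightarrow> rows_exit_left y' N j l" "rows_exit_right y N j l \<longleftrightarrow> rows_exit_right y' N j l"
      unfolding rows_exit_left_def rows_exit_right_def exit_left_def exit_right_def by simp_all
  qed
  show "measure M {\<omega>\<in>space M. \<not> rows_exit_left (z \<omega>) N j l} = measure M' {\<omega>\<in>space M'. \<not> rows_exit_left (z' \<omega>) N j l}"
  proof (rule exp_rows_prob_eq[OF assms, where Q = "\<lambda>y. \<not> rows_exit_left y N j l"])
    show "Measurable.pred (\<Pi>\<^sub>M q\<in>{..N} \<times> UNIV. borel) (\<lambda>x. \<not> rows_exit_left (\<lambda>r k. x (r, k)) N j l)"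
      by (rule pred_intros_logic(2)) (rule me)
    show "(\<not> rows_exit_left y N j l) \<longleftrightarrow> (\<not> rows_exit_left y' N j l)" if "\<And>r. r \<in> {..N} \<Longrightarrow> y r = y' r" for y y'
      using dep[OF that] by simp
  qed
  show "measure M {\<omega>\<in>space M. \<not> rows_exit_right (z \<omega>) N j l} = measure M' {\<omega>\<in>space M'. \<not> rows_exit_right (z' \<omega>) N j l}"
  proof (rule exp_rows_prob_eq[OF assms, where Q = "\<lambda>y. \<not> rows_exit_right y N j l"])
    show "Measurable.pred (\<Pi>\<^sub>M q\<in>{..N} \<times> UNIV. borel) (\<lambda>x. \<not> rows_exit_right (\<lambda>r k. x (r, k)) N j l)"
      by (rule pred_intros_logic(2)) (rule me)
    show "(\<not> rows_exit_right y N j l) \<longleftrightarrow> (\<not> rows_exit_right y' N j l)" if "\<And>r. r \<in> {..N} \<Longrightarrow> y r = y' r" for y y'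
      using dep[OF that] by simp
  qed
qed

text \<open>The characteristic of parameter \<open>\<kappa>\<close> through the origin meets level \<open>- N\<close> at this column.\<close>

definition exit_column :: "real \<Rightarrow> nat \<Rightarrow> int" where
  "exit_column \<kappa> N = - \<lfloor>real N / (\<kappa> - 1)\<^sup>2\<rfloor>"

context exponential_cgm
begin

text \<open>Anchored at column \<open>0\<close> of the boundary level, to agree with the
  normalisation of \<open>potential\<close>.\<close>

definition B_field :: "real \<Rightarrow> int \<Rightarrow> nat \<Rightarrow> 'w \<Rightarrow> nat \<Rightarrow> int \<Rightarrow> real" where
  "B_field \<rho> t N \<omega> s l = B \<rho> (0, t - int N) (l, t - int N + int s) \<omega>"

lemma AE_row_good:
  assumes "1 < \<rho>"
  shows "AE \<omega> in M. \<forall>s. good (\<lambda>k. B \<rho> (k - 1, s) (k, s) \<omega>) \<rho> \<and> good (\<lambda>k. Y (k, s) \<omega>) 1"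
  unfolding AE_all_countable
proof
  fix s
  have "AE \<omega> in M. good (\<lambda>k. B \<rho> (k - 1, s) (k, s) \<omega>) \<rho>"
    using AE_good[OF B_row_law[OF assms, of s], of id \<rho>] assms by simp
  moreover have "AE \<omega> in M. good (\<lambda>k. Y (k, s) \<omega>) 1"
    using AE_good[OF Y_law, of "\<lambda>k. (k, s)" 1] by (simp add: inj_on_def)
  ultimately show "AE \<omega> in M. good (\<lambda>k. B \<rho> (k - 1, s) (k, s) \<omega>) \<rho> \<and> good (\<lambda>k. Y (k, s) \<omega>) 1"
    by simp
qed

text \<open>Recovery of the weights as minima of increments is the last-passage recursion in
  disguise. Since each row has slope \<open>\<rho> \<noteq> 1\<close>, no maximising path can run
  for ever along a row of weights of mean one.\<close>

lemma AE_B_field: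
  assumes \<rho>: "1 < \<rho>"
  shows "AE \<omega> in M. lpp_field (\<lambda>s k. Y (k, t - int (N - 1 - s)) \<omega>) N (B_field \<rho> t N \<omega>) \<and>
    (\<forall>s k. B_field \<rho> t N \<omega> s k - B_field \<rho> t N \<omega> s (k - 1) = B \<rho> (k - 1, t - int N + int s) (k, t - int N + int s) \<omega>) \<and>
    B_field \<rho> t N \<omega> 0 = potential (\<lambda>k. B \<rho> (k - 1, t - int N) (k, t - int N) \<omega>)"
  using AE_row_good[OF \<rho>] AE_B_cocycle[OF \<rho>]
proof eventually_elim
  case (elim \<omega>)
  let ?F = "B_field \<rho> t N \<omega>"
  have add: "B \<rho> x y \<omega> + B \<rho> y z \<omega> = B \<rho> x z \<omega>" for x y z using elim(2) by blast
  have rec: "Y x \<omega> = min (B \<rho> (x - e1) x \<omega>) (B \<rho> (x - e2) x \<omega>)" for x using elim(2) by blast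
  have inc: "?F s k - ?F s (k - 1) = B \<rho> (k - 1, t - int N + int s) (k, t - int N + int s) \<omega>" for s k
    unfolding B_field_def using add[of "(0, t - int N)" "(k - 1, t - int N + int s)" "(k, t - int N + int s)"] by simp
  have "lpp_field (\<lambda>s k. Y (k, t - int (N - 1 - s)) \<omega>) N ?F"
  proof (rule lpp_fieldI_drift[where a = \<rho> and b = "\<lambda>_. 1"])
    fix s assume s: "s < N"
    show "drift (?F (Suc s)) \<rho>"
      by (rule good_drift[of "\<lambda>k. B \<rho> (k - 1, t - int N + int (Suc s)) (k, t - int N + int (Suc s)) \<omega>"])
        (use elim(1) inc in auto)
    show "good (\<lambda>k. Y (k, t - int (N - 1 - s)) \<omega>) 1 \<and> (1::real) \<noteq> \<rho>" using elim(1) \<rho> by auto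
    fix l
    let ?x = "(l, t - int N + int (Suc s)) :: site"
    have x: "(l, t - int (N - 1 - s)) = ?x" "?x - e1 = (l - 1, t - int N + int (Suc s))" "?x - e2 = (l, t - int N + int s)"
      using s by (auto simp: e1_def e2_def)
    show "?F (Suc s) l = Y (l, t - int (N - 1 - s)) \<omega> + max (?F (Suc s) (l - 1)) (?F s l)"
      unfolding x(1) B_field_def using rec[of ?x] unfolding x(2,3)
      using add[of "(0, t - int N)" "(l - 1, t - int N + int (Suc s))" ?x] add[of "(0, t - int N)" "(l, t - int N + int s)" ?x]
      by linarith
  qed
  moreover have "?F 0 = potential (\<lambda>k. B \<rho> (k - 1, t - int N) (k, t - int N) \<omega>)"
  proof
    fix k
    have "potential (\<lambda>k. B \<rho> (k - 1, t - int N) (k, t - int N) \<omega>) k = ?F 0 k - ?F 0 0"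
      by (rule potential_unique) (use inc[of 0] in simp)
    moreover have "?F 0 0 = 0" using add[of "(0, t - int N)" "(0, t - int N)" "(0, t - int N)"] by (simp add: B_field_def)
    ultimately show "?F 0 k = potential (\<lambda>k. B \<rho> (k - 1, t - int N) (k, t - int N) \<omega>) k" by simp
  qed
  ultimately show ?case using inc by blast
qed

lemma level_rows_weights:
  "0 < N \<Longrightarrow> (\<lambda>s. level_rows \<rho> t N \<omega> (N - 1 - s)) = (\<lambda>s k. Y (k, t - int (N - 1 - s)) \<omega>)"
  by (auto simp: level_rows_def fun_eq_iff)

lemma level_rows_bottom: "level_rows \<rho> t N \<omega> N = (\<lambda>k. B \<rho> (k - 1, t - int N) (k, t - int N) \<omega>)"
  by (auto simp: level_rows_def)

text \<open>Turns a wrong exit into an inequality between passage increments of two parameters; when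
  \<open>j\<close> lies on the characteristic of \<open>\<kappa>\<close> this goes against their
  means.\<close>

lemma AE_not_exit:
  assumes N: "0 < N" and \<rho>: "1 < \<rho>" and \<kappa>: "1 < \<kappa>"
  shows "AE \<omega> in M. (\<rho> < \<kappa> \<and> \<not> rows_exit_left (level_rows \<rho> t N \<omega>) N j l) \<or>
      (\<kappa> < \<rho> \<and> \<not> rows_exit_right (level_rows \<rho> t N \<omega>) N j l) \<longrightarrow>
    B \<rho> (j, t - int N) (l, t) \<omega> \<le> B \<kappa> (j, t - int N) (l, t) \<omega>"
proof -
  have mono: "AE \<omega> in M. r \<le> r' \<longrightarrow> (\<forall>k s. B r (k - 1, s) (k, s) \<omega> \<le> B r' (k - 1, s) (k, s) \<omega>)" if "1 < r" for r r'
    using AE_B_mono[OF that, of r'] by (cases "r \<le> r'") auto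
  show ?thesis
    using AE_B_field[OF \<rho>, of t N] AE_B_field[OF \<kappa>, of t N] mono[OF \<rho>, of \<kappa>] mono[OF \<kappa>, of \<rho>]
      AE_B_cocycle[OF \<rho>] AE_B_cocycle[OF \<kappa>]
  proof eventually_elim
    case (elim \<omega>)
    let ?w = "\<lambda>s k. Y (k, t - int (N - 1 - s)) \<omega>" and ?F = "\<lambda>r. B_field r t N \<omega>"
    have F: "lpp_field ?w N (?F \<rho>)" "lpp_field ?w N (?F \<kappa>)" and N': "N - 1 < N" using elim(1,2) N by auto
    have inc: "?F r 0 k - ?F r 0 (k - 1) = B r (k - 1, t - int N + int 0) (k, t - int N + int 0) \<omega>" if "r = \<rho> \<or> r = \<kappa>" for r k
      using elim(1,2) that by blast
    have B: "B r (j, t - int N) (l, t) \<omega> = ?F r (Suc (N - 1)) l - ?F r 0 j" if "r = \<rho> \<or> r = \<kappa>" for r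
    proof -
      have "B r (0, t - int N) (j, t - int N) \<omega> + B r (j, t - int N) (l, t) \<omega> = B r (0, t - int N) (l, t) \<omega>"
        using elim(5,6) that by blast
      then show ?thesis using N by (simp add: B_field_def)
    qed
    have F0: "?F \<rho> 0 = potential (level_rows \<rho> t N \<omega> N)" using elim(1) unfolding level_rows_bottom by blast
    show ?case
    proof (rule impI, elim disjE conjE)
      assume "\<rho> < \<kappa>" and ex: "\<not> rows_exit_left (level_rows \<rho> t N \<omega>) N j l"
      then have "?F \<rho> 0 k - ?F \<rho> 0 (k - 1) \<le> ?F \<kappa> 0 k - ?F \<kappa> 0 (k - 1)" for k
        using elim(3) by (simp only: inc simp_thms less_imp_le)
      then show "B \<rho> (j, t - int N) (l, t) \<omega> \<le> B \<kappa> (j, t - int N) (l, t) \<omega>"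
        using not_exit_left_le[OF F N'] ex unfolding rows_exit_left_def level_rows_weights[OF N] F0[symmetric]
        by (simp only: B simp_thms)
    next
      assume "\<kappa> < \<rho>" and ex: "\<not> rows_exit_right (level_rows \<rho> t N \<omega>) N j l"
      then have "?F \<kappa> 0 k - ?F \<kappa> 0 (k - 1) \<le> ?F \<rho> 0 k - ?F \<rho> 0 (k - 1)" for k
        using elim(4) by (simp only: inc simp_thms less_imp_le)
      then show "B \<rho> (j, t - int N) (l, t) \<omega> \<le> B \<kappa> (j, t - int N) (l, t) \<omega>"
        using not_exit_right_le[OF F N'] ex unfolding rows_exit_right_def level_rows_weights[OF N] F0[symmetric]
        by (simp only: B simp_thms)
    qed
  qed
qed

text \<open>By the cocycle property the increment may be computed along any path; along the boundary
  row and then up a column it becomes two sums, each over independent exponential variables.\<close>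

lemma B_passage_split:
  assumes add: "\<And>x y z. B \<rho> x y \<omega> + B \<rho> y z \<omega> = B \<rho> x z \<omega>" and "j \<le> l"
  shows "B \<rho> (j, t - int N) (l, t) \<omega> = (\<Sum>k=j+1..l. B \<rho> (k - 1, t - int N) (k, t - int N) \<omega>) +
    (\<Sum>k=t - int N + 1..t. B \<rho> (l, k - 1) (l, k) \<omega>)"
proof -
  let ?b = "t - int N"
  have z: "B \<rho> x x \<omega> = 0" for x using add[of x x x] by simp
  have row: "B \<rho> (k - 1, ?b) (k, ?b) \<omega> = B \<rho> (j, ?b) (k, ?b) \<omega> - B \<rho> (j, ?b) (k - 1, ?b) \<omega>" for k
    using add[of "(j, ?b)" "(k - 1, ?b)" "(k, ?b)"] by linarith
  have col: "B \<rho> (l, k - 1) (l, k) \<omega> = B \<rho> (l, ?b) (l, k) \<omega> - B \<rho> (l, ?b) (l, k - 1) \<omega>" for k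
    using add[of "(l, ?b)" "(l, k - 1)" "(l, k)"] by linarith
  have "(\<Sum>k=j+1..l. B \<rho> (k - 1, ?b) (k, ?b) \<omega>) = B \<rho> (j, ?b) (l, ?b) \<omega> - B \<rho> (j, ?b) (j + 1 - 1, ?b) \<omega>"
    by (rule sum_telescope[where G = "\<lambda>k. B \<rho> (j, ?b) (k, ?b) \<omega>", OF row]) (use assms(2) in simp)
  moreover have "(\<Sum>k=?b + 1..t. B \<rho> (l, k - 1) (l, k) \<omega>) = B \<rho> (l, ?b) (l, t) \<omega> - B \<rho> (l, ?b) (l, ?b + 1 - 1) \<omega>"
    by (rule sum_telescope[where G = "\<lambda>k. B \<rho> (l, ?b) (l, k) \<omega>", OF col]) simp
  ultimately show ?thesis using add[of "(j, ?b)" "(l, ?b)" "(l, t)"] z by simp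
qed

text \<open>With \<open>a = 1 / (\<kappa> - 1)\<^sup>2\<close> the mean of the passage increment of parameter \<open>\<rho>\<close> is about
  \<open>N (\<rho> a + \<rho> / (\<rho> - 1))\<close>, which is strictly minimal at \<open>\<rho> = \<kappa>\<close>.\<close>

lemma passage_gap:
  assumes \<rho>: "1 < \<rho>" and \<kappa>: "1 < \<kappa>" and ne: "\<rho> \<noteq> \<kappa>"
  shows "(\<lambda>N. prob {\<omega>\<in>space M. B \<rho> (exit_column \<kappa> N, t - int N) (l, t) \<omega> \<le>
      B \<kappa> (exit_column \<kappa> N, t - int N) (l, t) \<omega>}) \<longlonglongrightarrow> 0"
proof -
  define a where "a = 1 / (\<kappa> - 1)\<^sup>2"
  define v where "v r = r / (r - 1)" for r :: real
  define g where "g = (\<rho> - \<kappa>)\<^sup>2 / ((\<kappa> - 1)\<^sup>2 * (\<rho> - 1))"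
  have a: "0 < a" using \<kappa> by (simp add: a_def)
  have g: "0 < g" using \<rho> \<kappa> ne by (simp add: g_def)
  \<comment> \<open>The gap of the means per level is a square over positive factors, hence positive
    on either side of \<open>\<kappa>\<close>.\<close>
  have geq: "(\<rho> - \<kappa>) * a + v \<rho> - v \<kappa> = g"
  proof -
    have "v \<rho> - v \<kappa> = - ((\<rho> - \<kappa>) / ((\<rho> - 1) * (\<kappa> - 1)))"
      using \<rho> \<kappa> by (simp add: v_def divide_simps) (simp add: algebra_simps)
    moreover have "(\<rho> - \<kappa>) * a - (\<rho> - \<kappa>) / ((\<rho> - 1) * (\<kappa> - 1)) = g"
      using \<rho> \<kappa> by (simp add: g_def a_def divide_simps) (simp add: algebra_simps power2_eq_square)
    ultimately show ?thesis by simp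
  qed
  \<comment> \<open>Deviations of at most \<open>\<delta>\<close> per summand in two row sums and
    two column sums cost about \<open>2 * \<delta> * (a + 1) = g / 2\<close> per level, half of the
    gap.\<close>
  define \<delta> where "\<delta> = g / (4 * (a + 1))"
  have \<delta>: "0 < \<delta>" "4 * \<delta> * (a + 1) = g"
    unfolding \<delta>_def using a g by (simp, simp add: divide_simps)
  have v: "0 < v \<rho>" "0 < v \<kappa>" using \<rho> \<kappa> by (simp_all add: v_def)
  define j where "j N = exit_column \<kappa> N" for N
  define n where "n N = nat (l - j N)" for N
  have jb: "a * real N - 1 < - real_of_int (j N)" "- real_of_int (j N) \<le> a * real N" for N
  proof -
    have "a * real N = real N / (\<kappa> - 1)\<^sup>2" by (simp add: a_def)
    then show "a * real N - 1 < - real_of_int (j N)" "- real_of_int (j N) \<le> a * real N"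
      unfolding j_def exit_column_def by linarith+
  qed
  define Rw where "Rw r N \<omega> = (\<Sum>k\<in>{j N + 1..l}. B r (k - 1, t - int N) (k, t - int N) \<omega>)" for r N \<omega>
  define Cl where "Cl r N \<omega> = (\<Sum>k\<in>{t - int N + 1..t}. B r (l, k - 1) (l, k) \<omega>)" for r N \<omega>
  define bR where "bR r N = {\<omega>\<in>space M. \<delta> * n N \<le> \<bar>Rw r N \<omega> - r * n N\<bar>}" for r N
  define bC where "bC r N = {\<omega>\<in>space M. \<delta> * N \<le> \<bar>Cl r N \<omega> - v r * N\<bar>}" for r N
  have pR: "prob (bR r N) \<le> 2 * chernoff_rate r \<delta> ^ n N" if "1 < r" for r N
  proof -
    have "card {j N + 1..l} = n N" by (simp add: n_def)
    then show ?thesis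
      using chernoff_sum[OF B_row_law[OF that, of "t - int N"], of "{j N + 1..l}" r \<delta>] \<delta>(1) that
      by (simp add: bR_def Rw_def)
  qed
  have pC: "prob (bC r N) \<le> 2 * chernoff_rate (v r) \<delta> ^ N" if "1 < r" for r N
    using chernoff_sum[OF B_column_law[OF that, of l], of "{t - int N + 1..t}" "v r" \<delta>] \<delta>(1) that
    by (simp add: bC_def Cl_def v_def)
  have mB: "(\<lambda>\<omega>. B r x y \<omega>) \<in> borel_measurable M" if "1 < r" for r x y using B_measurable[OF that] .
  have meas: "bR r N \<in> sets M" "bC r N \<in> sets M" if "1 < r" for r N
  proof -
    note [measurable] = mB[OF that]
    show "bR r N \<in> sets M" unfolding bR_def Rw_def by measurable
    show "bC r N \<in> sets M" unfolding bC_def Cl_def by measurable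
  qed
  let ?E = "\<lambda>N. {\<omega>\<in>space M. B \<rho> (j N, t - int N) (l, t) \<omega> \<le> B \<kappa> (j N, t - int N) (l, t) \<omega>}"
  let ?b = "\<lambda>N. bR \<rho> N \<union> bR \<kappa> N \<union> (bC \<rho> N \<union> bC \<kappa> N)"
  \<comment> \<open>Total error of replacing the row length \<open>n N\<close> by
    \<open>a * N\<close>, from which it differs by at most \<open>\<bar>l\<bar> + 1\<close>: once in
    the means, once in the allowed deviations.\<close>
  define c where "c = (\<bar>\<rho> - \<kappa>\<bar> + 2 * \<delta>) * (\<bar>real_of_int l\<bar> + 1)"
  \<comment> \<open>The first summand makes \<open>c\<close> smaller than the other half of the gap,
    the second brings the exit column to the left of \<open>l\<close>.\<close>
  obtain N0 :: nat where N0: "2 * c / g + (\<bar>real_of_int l\<bar> + 1) / a < N0" using reals_Archimedean2 by blast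
  have incl: "prob (?E N) \<le> prob (?b N)" if "N0 \<le> N" for N
  proof (rule finite_measure_mono_AE)
    show "?b N \<in> sets M" using meas \<rho> \<kappa> by auto
    have c0: "0 \<le> c" using \<delta> by (simp add: c_def)
    have big: "2 * c / g + (\<bar>real_of_int l\<bar> + 1) / a < N" using N0 that by linarith
    moreover have "0 \<le> 2 * c / g" "0 \<le> (\<bar>real_of_int l\<bar> + 1) / a" using c0 g a by simp_all
    ultimately have "2 * c / g < N" "(\<bar>real_of_int l\<bar> + 1) / a < N" by linarith+
    then have Nc: "c < g * N / 2" and "\<bar>real_of_int l\<bar> + 1 < a * N" using g a by (simp_all add: field_simps)
    then have jl: "j N \<le> l" using jb(1)[of N] by linarith
    have nN: "real (n N) = l - j N" using jl by (simp add: n_def)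
    have nd: "\<bar>real (n N) - a * N\<bar> \<le> \<bar>real_of_int l\<bar> + 1" unfolding nN using jb[of N] by linarith
    show "AE \<omega> in M. \<omega> \<in> ?E N \<longrightarrow> \<omega> \<in> ?b N"
      using AE_B_cocycle[OF \<rho>] AE_B_cocycle[OF \<kappa>]
    proof eventually_elim
      case (elim \<omega>)
      have sp: "B r (j N, t - int N) (l, t) \<omega> = Rw r N \<omega> + Cl r N \<omega>" if "r = \<rho> \<or> r = \<kappa>" for r
        unfolding Rw_def Cl_def by (rule B_passage_split) (use elim that jl in auto)
      show ?case
      proof (rule impI, rule ccontr)
        assume E: "\<omega> \<in> ?E N" and nb: "\<omega> \<notin> ?b N"
        then have b: "\<bar>Rw \<rho> N \<omega> - \<rho> * n N\<bar> < \<delta> * n N" "\<bar>Rw \<kappa> N \<omega> - \<kappa> * n N\<bar> < \<delta> * n N"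
            "\<bar>Cl \<rho> N \<omega> - v \<rho> * N\<bar> < \<delta> * N" "\<bar>Cl \<kappa> N \<omega> - v \<kappa> * N\<bar> < \<delta> * N"
          by (auto simp: bR_def bC_def)
        have "Rw \<rho> N \<omega> + Cl \<rho> N \<omega> \<le> Rw \<kappa> N \<omega> + Cl \<kappa> N \<omega>" using E sp by auto
        then have "\<rho> * n N - \<kappa> * n N + (v \<rho> * N - v \<kappa> * N) < 2 * (\<delta> * n N) + 2 * (\<delta> * N)"
          using b unfolding abs_less_iff by linarith
        then have 1: "(\<rho> - \<kappa>) * n N + (v \<rho> - v \<kappa>) * N < 2 * \<delta> * n N + 2 * \<delta> * N" by (simp add: algebra_simps)
        have "(\<rho> - \<kappa>) * (a * N - n N) \<le> \<bar>\<rho> - \<kappa>\<bar> * \<bar>a * N - n N\<bar>" by (metis abs_ge_self abs_mult)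
        also have "\<dots> \<le> \<bar>\<rho> - \<kappa>\<bar> * (\<bar>real_of_int l\<bar> + 1)" using nd by (intro mult_left_mono) (auto simp: abs_minus_commute)
        finally have 2: "(\<rho> - \<kappa>) * (a * N) - (\<rho> - \<kappa>) * n N \<le> \<bar>\<rho> - \<kappa>\<bar> * (\<bar>real_of_int l\<bar> + 1)"
          by (simp add: right_diff_distrib)
        have "2 * \<delta> * n N \<le> 2 * \<delta> * (a * N + (\<bar>real_of_int l\<bar> + 1))" using nd \<delta> by (intro mult_left_mono) auto
        then have 3: "2 * \<delta> * n N \<le> 2 * \<delta> * (a * N) + 2 * \<delta> * (\<bar>real_of_int l\<bar> + 1)" by (simp add: algebra_simps)
        have 4: "(\<rho> - \<kappa>) * (a * N) + (v \<rho> - v \<kappa>) * N = g * N" unfolding geq[symmetric] by (simp add: algebra_simps)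
        have 5: "2 * \<delta> * (a * N) + 2 * \<delta> * N = g * N / 2" unfolding \<delta>(2)[symmetric] by (simp add: algebra_simps)
        have "c = \<bar>\<rho> - \<kappa>\<bar> * (\<bar>real_of_int l\<bar> + 1) + 2 * \<delta> * (\<bar>real_of_int l\<bar> + 1)" by (simp add: c_def algebra_simps)
        with 1 2 3 4 5 Nc show False by linarith
      qed
    qed
  qed
  have union: "prob (?b N) \<le> 2 * chernoff_rate \<rho> \<delta> ^ n N + 2 * chernoff_rate \<kappa> \<delta> ^ n N +
      (2 * chernoff_rate (v \<rho>) \<delta> ^ N + 2 * chernoff_rate (v \<kappa>) \<delta> ^ N)" for N
  proof -
    have "prob (?b N) \<le> prob (bR \<rho> N \<union> bR \<kappa> N) + prob (bC \<rho> N \<union> bC \<kappa> N)"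
      by (rule measure_Un_le) (use meas \<rho> \<kappa> in auto)
    moreover have "prob (bR \<rho> N \<union> bR \<kappa> N) \<le> prob (bR \<rho> N) + prob (bR \<kappa> N)"
      "prob (bC \<rho> N \<union> bC \<kappa> N) \<le> prob (bC \<rho> N) + prob (bC \<kappa> N)"
      by (rule measure_Un_le; use meas \<rho> \<kappa> in auto)+
    ultimately show ?thesis using pR[OF \<rho>, of N] pR[OF \<kappa>, of N] pC[OF \<rho>, of N] pC[OF \<kappa>, of N] by linarith
  qed
  have ntop: "filterlim n at_top sequentially"
    unfolding filterlim_at_top
  proof
    fix Z :: nat
    obtain N1 :: nat where N1: "(real Z + \<bar>real_of_int l\<bar> + 1) / a < N1" using reals_Archimedean2 by blast
    show "\<forall>\<^sub>F N in sequentially. Z \<le> n N"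
      using eventually_ge_at_top[of N1]
    proof eventually_elim
      case (elim N)
      then have "(real Z + \<bar>real_of_int l\<bar> + 1) / a < N" using N1 by linarith
      then have "real Z + \<bar>real_of_int l\<bar> + 1 < a * N" using a by (simp add: field_simps)
      then have "real Z \<le> real_of_int (l - j N)" using jb(1)[of N] by simp
      then show ?case unfolding n_def by linarith
    qed
  qed
  have p0: "(\<lambda>N. chernoff_rate m \<delta> ^ N) \<longlonglongrightarrow> 0" if "0 < m" for m
    using chernoff_rate_bounds[OF that \<delta>(1)] by (intro LIMSEQ_power_zero) simp
  have pn0: "(\<lambda>N. chernoff_rate m \<delta> ^ n N) \<longlonglongrightarrow> 0" if "0 < m" for m
    using filterlim_compose[OF p0[OF that] ntop] .
  have "(\<lambda>N. prob (?E N)) \<longlonglongrightarrow> 0"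
  proof (rule tendsto_sandwich[where f = "\<lambda>_. 0"])
    show "\<forall>\<^sub>F N in sequentially. prob (?E N) \<le> 2 * chernoff_rate \<rho> \<delta> ^ n N + 2 * chernoff_rate \<kappa> \<delta> ^ n N +
      (2 * chernoff_rate (v \<rho>) \<delta> ^ N + 2 * chernoff_rate (v \<kappa>) \<delta> ^ N)"
      using eventually_ge_at_top[of N0] by eventually_elim (rule order_trans[OF incl union])
    show "(\<lambda>N. 2 * chernoff_rate \<rho> \<delta> ^ n N + 2 * chernoff_rate \<kappa> \<delta> ^ n N +
      (2 * chernoff_rate (v \<rho>) \<delta> ^ N + 2 * chernoff_rate (v \<kappa>) \<delta> ^ N)) \<longlonglongrightarrow> 0"
    proof -
      have "(\<lambda>N. 2 * chernoff_rate \<rho> \<delta> ^ n N + 2 * chernoff_rate \<kappa> \<delta> ^ n N +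
        (2 * chernoff_rate (v \<rho>) \<delta> ^ N + 2 * chernoff_rate (v \<kappa>) \<delta> ^ N)) \<longlonglongrightarrow> 2 * 0 + 2 * 0 + (2 * 0 + 2 * 0)"
        by (intro tendsto_add tendsto_mult tendsto_const p0 pn0) (use \<rho> \<kappa> v in simp_all)
      then show ?thesis by simp
    qed
  qed auto
  then show ?thesis by (simp add: j_def)
qed

lemma exit_prob:
  assumes "1 < \<rho>" "1 < \<kappa>"
  shows "\<rho> < \<kappa> \<Longrightarrow> (\<lambda>N. prob {\<omega>\<in>space M. \<not> rows_exit_left (level_rows \<rho> t N \<omega>) N (exit_column \<kappa> N) l}) \<longlonglongrightarrow> 0"
    and "\<kappa> < \<rho> \<Longrightarrow> (\<lambda>N. prob {\<omega>\<in>space M. \<not> rows_exit_right (level_rows \<rho> t N \<omega>) N (exit_column \<kappa> N) l}) \<longlonglongrightarrow> 0"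
proof -
  let ?E = "\<lambda>N. {\<omega>\<in>space M. B \<rho> (exit_column \<kappa> N, t - int N) (l, t) \<omega> \<le> B \<kappa> (exit_column \<kappa> N, t - int N) (l, t) \<omega>}"
  have lim: "(\<lambda>N. prob (D N)) \<longlonglongrightarrow> 0"
    if "\<rho> \<noteq> \<kappa>" and D: "\<And>N. 0 < N \<Longrightarrow> AE \<omega> in M. \<omega> \<in> D N \<longrightarrow> \<omega> \<in> ?E N" for D
  proof (rule tendsto_sandwich[OF _ _ tendsto_const passage_gap[OF assms that(1), of t l]])
    have "?E N \<in> sets M" for N
      using B_measurable[OF assms(1)] B_measurable[OF assms(2)] by measurable
    then have "prob (D N) \<le> prob (?E N)" if "0 < N" for N
      using D[OF that] by (intro finite_measure_mono_AE)
    then show "\<forall>\<^sub>F N in sequentially. prob (D N) \<le> prob (?E N)"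
      by (rule eventually_mono[OF eventually_gt_at_top])
  qed simp
  show "(\<lambda>N. prob {\<omega>\<in>space M. \<not> rows_exit_left (level_rows \<rho> t N \<omega>) N (exit_column \<kappa> N) l}) \<longlonglongrightarrow> 0" if "\<rho> < \<kappa>"
  proof (rule lim)
    fix N :: nat assume "0 < N"
    show "AE \<omega> in M. \<omega> \<in> {\<omega>\<in>space M. \<not> rows_exit_left (level_rows \<rho> t N \<omega>) N (exit_column \<kappa> N) l} \<longrightarrow> \<omega> \<in> ?E N"
      using AE_not_exit[OF \<open>0 < N\<close> assms, of t "exit_column \<kappa> N" l] by eventually_elim (use that in auto)
  qed (use that in simp)
  show "(\<lambda>N. prob {\<omega>\<in>space M. \<not> rows_exit_right (level_rows \<rho> t N \<omega>) N (exit_column \<kappa> N) l}) \<longlonglongrightarrow> 0" if "\<kappa> < \<rho>"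
  proof (rule lim)
    fix N :: nat assume "0 < N"
    show "AE \<omega> in M. \<omega> \<in> {\<omega>\<in>space M. \<not> rows_exit_right (level_rows \<rho> t N \<omega>) N (exit_column \<kappa> N) l} \<longrightarrow> \<omega> \<in> ?E N"
      using AE_not_exit[OF \<open>0 < N\<close> assms, of t "exit_column \<kappa> N" l] by eventually_elim (use that in auto)
  qed (use that in simp)
qed

end

subsection \<open>Convergence of laws\<close>

text \<open>Half-lines are replaced by Borel sets one coordinate at a time. Each replacement
  compares two finite measures on the line, the laws of one coordinate on the event fixed by the
  others, through their distribution functions.\<close>

lemma measure_box_borel:
  assumes "prob_space M" "prob_space M'" and F: "finite F"
    and X: "\<And>q. q \<in> F \<Longrightarrow> X q \<in> borel_measurable M" and X': "\<And>q. q \<in> F \<Longrightarrow> X' q \<in> borel_measurable M'"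
    and cdf: "\<And>c. measure M {\<omega>\<in>space M. \<forall>q\<in>F. X q \<omega> \<le> (c q :: real)} = measure M' {\<omega>\<in>space M'. \<forall>q\<in>F. X' q \<omega> \<le> c q}"
    and A: "\<And>q. q \<in> F \<Longrightarrow> A q \<in> sets borel"
  shows "measure M {\<omega>\<in>space M. \<forall>q\<in>F. X q \<omega> \<in> A q} = measure M' {\<omega>\<in>space M'. \<forall>q\<in>F. X' q \<omega> \<in> A q}"
proof -
  interpret M: prob_space M by fact
  interpret M': prob_space M' by fact
  have "measure M {\<omega>\<in>space M. \<forall>q\<in>F. X q \<omega> \<in> (if q \<in> S then A q else {..c q})} =
      measure M' {\<omega>\<in>space M'. \<forall>q\<in>F. X' q \<omega> \<in> (if q \<in> S then A q else {..c q})}"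
    if "finite S" "S \<subseteq> F" for S c
    using that
  proof (induction S arbitrary: c)
    case empty
    then show ?case using cdf by simp
  next
    case (insert p S)
    let ?A = "\<lambda>q. if q \<in> S then A q else {..c q}"
    define E where "E = {\<omega>\<in>space M. \<forall>q\<in>F - {p}. X q \<omega> \<in> ?A q}"
    define E' where "E' = {\<omega>\<in>space M'. \<forall>q\<in>F - {p}. X' q \<omega> \<in> ?A q}"
    define N where "N = distr (density M (indicator E)) borel (X p)"
    define N' where "N' = distr (density M' (indicator E')) borel (X' p)"
    have p: "p \<in> F" using insert by simp
    note [measurable] = X[OF p] X'[OF p]
    have E: "E \<in> sets M" unfolding E_def by (rule sets_Collect_family) (use F X A in auto)
    have E': "E' \<in> sets M'" unfolding E'_def by (rule sets_Collect_family) (use F X' A in auto)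
    have eN: "emeasure N B = emeasure M {\<omega>\<in>space M. X p \<omega> \<in> B \<and> (\<forall>q\<in>F - {p}. X q \<omega> \<in> ?A q)}"
      if "B \<in> sets borel" for B
      unfolding N_def using E that
      by (subst emeasure_distr_restricted) (auto simp: E_def intro!: arg_cong[where f = "emeasure M"])
    have eN': "emeasure N' B = emeasure M' {\<omega>\<in>space M'. X' p \<omega> \<in> B \<and> (\<forall>q\<in>F - {p}. X' q \<omega> \<in> ?A q)}"
      if "B \<in> sets borel" for B
      unfolding N'_def using E' that
      by (subst emeasure_distr_restricted) (auto simp: E'_def intro!: arg_cong[where f = "emeasure M'"])
    have fin: "finite_borel_measure N" "finite_borel_measure N'"
      unfolding finite_borel_measure_def finite_borel_measure_axioms_def
      by (auto intro!: finite_measureI simp: eN eN' M.emeasure_eq_measure M'.emeasure_eq_measure)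
        (auto simp: N_def N'_def eN[unfolded N_def] eN'[unfolded N'_def] M.emeasure_eq_measure M'.emeasure_eq_measure)
    have box: "{\<omega>\<in>space M. \<forall>q\<in>F. X q \<omega> \<in> (if q \<in> S then A q else {..(c(p := x)) q})} =
        {\<omega>\<in>space M. X p \<omega> \<in> {..x} \<and> (\<forall>q\<in>F - {p}. X q \<omega> \<in> ?A q)}"
      "{\<omega>\<in>space M'. \<forall>q\<in>F. X' q \<omega> \<in> (if q \<in> S then A q else {..(c(p := x)) q})} =
        {\<omega>\<in>space M'. X' p \<omega> \<in> {..x} \<and> (\<forall>q\<in>F - {p}. X' q \<omega> \<in> ?A q)}" for x
      using p insert.hyps by (auto split: if_splits)
    have "cdf N = cdf N'"
    proof
      fix x
      have "measure M {\<omega>\<in>space M. X p \<omega> \<in> {..x} \<and> (\<forall>q\<in>F - {p}. X q \<omega> \<in> ?A q)} =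
          measure M' {\<omega>\<in>space M'. X' p \<omega> \<in> {..x} \<and> (\<forall>q\<in>F - {p}. X' q \<omega> \<in> ?A q)}"
        using insert.IH[of "c(p := x)"] insert.prems unfolding box by simp
      then have "emeasure N {..x} = emeasure N' {..x}"
        using eN[of "{..x}"] eN'[of "{..x}"] by (simp add: M.emeasure_eq_measure M'.emeasure_eq_measure)
      then show "cdf N x = cdf N' x" by (simp add: cdf_def measure_def)
    qed
    then have "N = N'" by (rule cdf_unique'[OF fin])
    then have "emeasure N (A p) = emeasure N' (A p)" by simp
    then have "measure M {\<omega>\<in>space M. X p \<omega> \<in> A p \<and> (\<forall>q\<in>F - {p}. X q \<omega> \<in> ?A q)} =
        measure M' {\<omega>\<in>space M'. X' p \<omega> \<in> A p \<and> (\<forall>q\<in>F - {p}. X' q \<omega> \<in> ?A q)}"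
      using A[OF p] by (simp add: eN eN' M.emeasure_eq_measure M'.emeasure_eq_measure)
    moreover have "{\<omega>\<in>space M. \<forall>q\<in>F. X q \<omega> \<in> (if q \<in> insert p S then A q else {..c q})} =
        {\<omega>\<in>space M. X p \<omega> \<in> A p \<and> (\<forall>q\<in>F - {p}. X q \<omega> \<in> ?A q)}"
      "{\<omega>\<in>space M'. \<forall>q\<in>F. X' q \<omega> \<in> (if q \<in> insert p S then A q else {..c q})} =
        {\<omega>\<in>space M'. X' p \<omega> \<in> A p \<and> (\<forall>q\<in>F - {p}. X' q \<omega> \<in> ?A q)}"
      using p by (auto split: if_splits)
    ultimately show ?case by simp
  qed
  from this[OF F order_refl] show ?thesis by simp
qed

lemma tendsto_shifted_box:
  assumes "prob_space M" and F: "finite F" and X: "\<And>q. q \<in> F \<Longrightarrow> X q \<in> borel_measurable M"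
  shows "(\<lambda>n. measure M {\<omega>\<in>space M. \<forall>q\<in>F. X q \<omega> \<le> c q + 1 / real (Suc n)}) \<longlonglongrightarrow>
    measure M {\<omega>\<in>space M. \<forall>q\<in>F. X q \<omega> \<le> c q}"
proof -
  interpret prob_space M by fact
  let ?A = "\<lambda>n. {\<omega>\<in>space M. \<forall>q\<in>F. X q \<omega> \<le> c q + 1 / real (Suc n)}"
  have "(\<lambda>n. measure M (?A n)) \<longlonglongrightarrow> measure M (\<Inter>n. ?A n)"
  proof (rule finite_Lim_measure_decseq)
    have "{\<omega>\<in>space M. \<forall>q\<in>F. X q \<omega> \<in> {..c q + 1 / real (Suc n)}} \<in> sets M" for n
      by (rule sets_Collect_family[OF F X]) auto
    then show "range ?A \<subseteq> sets M" by auto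
    show "decseq ?A"
    proof (rule decseq_SucI, rule subsetI)
      fix n \<omega> assume "\<omega> \<in> ?A (Suc n)"
      moreover have "1 / real (Suc (Suc n)) \<le> 1 / real (Suc n)" by (simp add: divide_simps)
      ultimately show "\<omega> \<in> ?A n" by force
    qed
  qed
  also have "(\<Inter>n. ?A n) = {\<omega>\<in>space M. \<forall>q\<in>F. X q \<omega> \<le> c q}"
  proof (intro set_eqI iffI)
    fix \<omega> assume \<omega>: "\<omega> \<in> (\<Inter>n. ?A n)"
    have "X q \<omega> \<le> c q" if "q \<in> F" for q
    proof (rule field_le_epsilon)
      fix e :: real assume "0 < e"
      then obtain n where "1 / real (Suc n) < e" using nat_approx_posE by blast
      moreover have "X q \<omega> \<le> c q + 1 / real (Suc n)" using \<omega> that by auto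
      ultimately show "X q \<omega> \<le> c q + e" by linarith
    qed
    then show "\<omega> \<in> {\<omega>\<in>space M. \<forall>q\<in>F. X q \<omega> \<le> c q}" using \<omega> by auto
  qed (auto intro: add_increasing2)
  finally show ?thesis .
qed

lemma measure_box_le_shifted:
  fixes U W :: "'i \<Rightarrow> 'w \<Rightarrow> real"
  assumes "prob_space P" and F: "finite F"
    and U: "\<And>q. q \<in> F \<Longrightarrow> U q \<in> borel_measurable P" and W: "\<And>q. q \<in> F \<Longrightarrow> W q \<in> borel_measurable P"
  shows "measure P {\<omega>\<in>space P. \<forall>q\<in>F. U q \<omega> \<le> c q} \<le>
    measure P {\<omega>\<in>space P. \<forall>q\<in>F. W q \<omega> \<le> c q + e} + (\<Sum>q\<in>F. measure P {\<omega>\<in>space P. e < \<bar>U q \<omega> - W q \<omega>\<bar>})"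
proof -
  interpret P: prob_space P by fact
  let ?d = "\<lambda>q. {\<omega>\<in>space P. e < \<bar>U q \<omega> - W q \<omega>\<bar>}" and ?B = "{\<omega>\<in>space P. \<forall>q\<in>F. W q \<omega> \<le> c q + e}"
  have B: "?B \<in> sets P" using sets_Collect_family[OF F W, where A = "\<lambda>q. {..c q + e}"] by simp
  have d: "?d q \<in> sets P" if "q \<in> F" for q
  proof -
    note [measurable] = U[OF that] W[OF that]
    show ?thesis by measurable
  qed
  have dU: "(\<Union>q\<in>F. ?d q) \<in> sets P" by (rule sets.finite_UN[OF F d])
  have "measure P {\<omega>\<in>space P. \<forall>q\<in>F. U q \<omega> \<le> c q} \<le> measure P (?B \<union> (\<Union>q\<in>F. ?d q))"
  proof (rule P.finite_measure_mono[OF subsetI])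
    fix \<omega> assume w: "\<omega> \<in> {\<omega>\<in>space P. \<forall>q\<in>F. U q \<omega> \<le> c q}"
    show "\<omega> \<in> ?B \<union> (\<Union>q\<in>F. ?d q)"
    proof (rule ccontr)
      assume "\<not> ?thesis"
      then obtain q where "q \<in> F" "\<not> W q \<omega> \<le> c q + e" "\<bar>U q \<omega> - W q \<omega>\<bar> \<le> e" using w by force
      moreover have "U q \<omega> \<le> c q" using w \<open>q \<in> F\<close> by simp
      ultimately show False by linarith
    qed
  qed (rule sets.Un[OF B dU])
  also have "\<dots> \<le> measure P ?B + measure P (\<Union>q\<in>F. ?d q)" by (rule measure_Un_le[OF B dU])
  also have "measure P (\<Union>q\<in>F. ?d q) \<le> (\<Sum>q\<in>F. measure P (?d q))"
    by (rule P.finite_measure_subadditive_finite[OF F]) (use d in auto)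
  finally show ?thesis by simp
qed

text \<open>All \<open>X N\<close> share one law, so sending \<open>N\<close> to infinity first
  leaves a comparison of two distribution functions at points shifted by \<open>e\<close>; right
  continuity then removes the shift.\<close>

lemma law_eq_of_tendsto_prob:
  fixes X :: "nat \<Rightarrow> 'i \<Rightarrow> 'w \<Rightarrow> real" and V :: "'i \<Rightarrow> 'w \<Rightarrow> real"
  assumes "prob_space P" and K: "finite F"
    and X: "\<And>N q. q \<in> F \<Longrightarrow> X N q \<in> borel_measurable P" and V: "\<And>q. q \<in> F \<Longrightarrow> V q \<in> borel_measurable P"
    and law: "\<And>N c. measure P {\<omega>\<in>space P. \<forall>q\<in>F. X N q \<omega> \<le> c q} = measure P {\<omega>\<in>space P. \<forall>q\<in>F. X 0 q \<omega> \<le> c q}"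
    and conv: "\<And>q \<epsilon>. q \<in> F \<Longrightarrow> 0 < \<epsilon> \<Longrightarrow> (\<lambda>N. measure P {\<omega>\<in>space P. \<epsilon> < \<bar>X N q \<omega> - V q \<omega>\<bar>}) \<longlonglongrightarrow> 0"
    and A: "\<And>q. q \<in> F \<Longrightarrow> A q \<in> sets borel"
  shows "measure P {\<omega>\<in>space P. \<forall>q\<in>F. V q \<omega> \<in> A q} = measure P {\<omega>\<in>space P. \<forall>q\<in>F. X 0 q \<omega> \<in> A q}"
proof (rule measure_box_borel[OF assms(1,1) K V X _ A])
  interpret P: prob_space P by fact
  let ?p = "\<lambda>c. measure P {\<omega>\<in>space P. \<forall>q\<in>F. V q \<omega> \<le> c q}"
  let ?q = "\<lambda>N c. measure P {\<omega>\<in>space P. \<forall>q\<in>F. X N q \<omega> \<le> c q}"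
  let ?s = "\<lambda>e N. \<Sum>q\<in>F. measure P {\<omega>\<in>space P. e < \<bar>X N q \<omega> - V q \<omega>\<bar>}"
  have close: "?s e \<longlonglongrightarrow> 0" if "0 < e" for e
    using tendsto_sum[of F "\<lambda>q N. measure P {\<omega>\<in>space P. e < \<bar>X N q \<omega> - V q \<omega>\<bar>}" "\<lambda>_. 0"] conv that by simp
  have bound: "a \<le> b" if "0 < e" "\<And>N. a \<le> b + ?s e N" for a b e
    by (rule tendsto_lowerbound[OF tendsto_add[OF tendsto_const close[OF that(1)], of b, simplified]])
      (use that(2) in auto)
  have 1: "?q 0 c \<le> ?p (\<lambda>q. c q + e)" if "0 < e" for c e
  proof (rule bound[OF that])
    fix N
    have "?q N c \<le> ?p (\<lambda>q. c q + e) + ?s e N" by (rule measure_box_le_shifted[OF assms(1) K X V])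
    then show "?q 0 c \<le> ?p (\<lambda>q. c q + e) + ?s e N" unfolding law[of N] .
  qed
  have 2: "?p c \<le> ?q 0 (\<lambda>q. c q + e)" if "0 < e" for c e
  proof (rule bound[OF that])
    fix N
    have "?p c \<le> ?q N (\<lambda>q. c q + e) + (\<Sum>q\<in>F. measure P {\<omega>\<in>space P. e < \<bar>V q \<omega> - X N q \<omega>\<bar>})"
      by (rule measure_box_le_shifted[OF assms(1) K V X])
    then show "?p c \<le> ?q 0 (\<lambda>q. c q + e) + ?s e N"
      unfolding law[of N] by (simp only: abs_minus_commute)
  qed
  fix c
  show "?p c = ?q 0 c"
  proof (rule antisym)
    show "?p c \<le> ?q 0 c"
      by (rule tendsto_lowerbound[OF tendsto_shifted_box[OF assms(1) K X]]) (use 2 in auto)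
    show "?q 0 c \<le> ?p c"
      by (rule tendsto_lowerbound[OF tendsto_shifted_box[OF assms(1) K V]]) (use 1 in auto)
  qed
qed

text \<open>The nested product is the image of a flat product over pairs, on which finite boxes
  decide equality.\<close>

lemma distr_rows_eqI:
  fixes z :: "'w \<Rightarrow> 'r \<Rightarrow> int \<Rightarrow> real" and z' :: "'v \<Rightarrow> 'r \<Rightarrow> int \<Rightarrow> real"
  assumes "prob_space M" "prob_space M'"
    and z: "\<And>i k. i \<in> R \<Longrightarrow> (\<lambda>\<omega>. z \<omega> i k) \<in> borel_measurable M"
    and z': "\<And>i k. i \<in> R \<Longrightarrow> (\<lambda>\<omega>. z' \<omega> i k) \<in> borel_measurable M'"
    and eq: "\<And>F A. finite F \<Longrightarrow> F \<subseteq> R \<times> UNIV \<Longrightarrow> (\<And>q. q \<in> F \<Longrightarrow> A q \<in> sets borel) \<Longrightarrow>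
      measure M {\<omega>\<in>space M. \<forall>(i, k)\<in>F. z \<omega> i k \<in> A (i, k)} = measure M' {\<omega>\<in>space M'. \<forall>(i, k)\<in>F. z' \<omega> i k \<in> A (i, k)}"
  shows "distr M (\<Pi>\<^sub>M i\<in>R. sequence_space) (\<lambda>\<omega>. \<lambda>i\<in>R. z \<omega> i) = distr M' (\<Pi>\<^sub>M i\<in>R. sequence_space) (\<lambda>\<omega>. \<lambda>i\<in>R. z' \<omega> i)"
proof -
  interpret M: prob_space M by fact
  interpret M': prob_space M' by fact
  let ?P = "\<Pi>\<^sub>M q\<in>R \<times> (UNIV :: int set). (borel :: real measure)"
  let ?f = "\<lambda>\<omega>. \<lambda>q\<in>R \<times> (UNIV :: int set). z \<omega> (fst q) (snd q)"
  let ?f' = "\<lambda>\<omega>. \<lambda>q\<in>R \<times> (UNIV :: int set). z' \<omega> (fst q) (snd q)"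
  let ?u = "\<lambda>x. \<lambda>i\<in>R. \<lambda>k. x (i, k)"
  have f: "?f \<in> measurable M ?P" "?f' \<in> measurable M' ?P"
    using z z' by (auto intro!: measurable_restrict)
  have u: "?u \<in> measurable ?P (\<Pi>\<^sub>M i\<in>R. sequence_space)"
    by (intro measurable_restrict measurable_sequenceI measurable_component_singleton) auto
  have flat: "distr M ?P ?f = distr M' ?P ?f'"
  proof (rule measure_eqI_PiM_infinite)
    show "finite_measure (distr M ?P ?f)" by (intro M.finite_measure_distr f)
    fix A and J :: "('r \<times> int) set"
    assume J: "finite J" "J \<subseteq> R \<times> UNIV" and A: "\<And>q. q \<in> J \<Longrightarrow> A q \<in> sets (borel :: real measure)"
    have S: "prod_emb (R \<times> UNIV) (\<lambda>_. borel) J (Pi\<^sub>E J A) \<in> sets ?P"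
      using J A by (intro sets_PiM_I) auto
    have "?f -` prod_emb (R \<times> UNIV) (\<lambda>_. borel) J (Pi\<^sub>E J A) \<inter> space M = {\<omega>\<in>space M. \<forall>(i, k)\<in>J. z \<omega> i k \<in> A (i, k)}"
      using J by (fastforce simp: prod_emb_def PiE_iff extensional_def)
    moreover have "?f' -` prod_emb (R \<times> UNIV) (\<lambda>_. borel) J (Pi\<^sub>E J A) \<inter> space M' = {\<omega>\<in>space M'. \<forall>(i, k)\<in>J. z' \<omega> i k \<in> A (i, k)}"
      using J by (fastforce simp: prod_emb_def PiE_iff extensional_def)
    ultimately show "emeasure (distr M ?P ?f) (prod_emb (R \<times> UNIV) (\<lambda>_. borel) J (Pi\<^sub>E J A)) =
        emeasure (distr M' ?P ?f') (prod_emb (R \<times> UNIV) (\<lambda>_. borel) J (Pi\<^sub>E J A))"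
      using eq[OF J A] by (simp add: emeasure_distr[OF f(1) S] emeasure_distr[OF f(2) S] M.emeasure_eq_measure M'.emeasure_eq_measure)
  qed auto
  have "distr M (\<Pi>\<^sub>M i\<in>R. sequence_space) (?u \<circ> ?f) = distr M' (\<Pi>\<^sub>M i\<in>R. sequence_space) (?u \<circ> ?f')"
    using flat by (simp flip: distr_distr[OF u f(1)] distr_distr[OF u f(2)])
  moreover have "?u \<circ> ?f = (\<lambda>\<omega>. \<lambda>i\<in>R. z \<omega> i)" "?u \<circ> ?f' = (\<lambda>\<omega>. \<lambda>i\<in>R. z' \<omega> i)"
    by (auto simp: fun_eq_iff)
  ultimately show ?thesis by simp
qed

lemma measure_pair_fst:
  assumes "prob_space M" "prob_space M'" and E: "{\<omega>\<in>space M. Q \<omega>} \<in> sets M"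
  shows "measure (M \<Otimes>\<^sub>M M') {v\<in>space (M \<Otimes>\<^sub>M M'). Q (fst v)} = measure M {\<omega>\<in>space M. Q \<omega>}"
proof -
  interpret M: prob_space M by fact
  interpret M': prob_space M' by fact
  have "{v\<in>space (M \<Otimes>\<^sub>M M'). Q (fst v)} = {\<omega>\<in>space M. Q \<omega>} \<times> space M'"
    by (auto simp: space_pair_measure)
  then have "emeasure (M \<Otimes>\<^sub>M M') {v\<in>space (M \<Otimes>\<^sub>M M'). Q (fst v)} = emeasure M {\<omega>\<in>space M. Q \<omega>}"
    using M'.emeasure_pair_measure_Times[OF E, of "space M'"] M'.emeasure_space_1 by simp
  then show ?thesis by (simp add: measure_def)
qed

lemma indep_law_PiM:
  assumes "\<And>q. q \<in> K \<Longrightarrow> prob_space (L q)" "\<And>q. q \<in> K \<Longrightarrow> sets (L q) = sets borel"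
  shows "indep_law (PiM K L) (\<lambda>q x. x q) L K"
  unfolding indep_law_def
proof (intro conjI ballI)
  show "prob_space (PiM K L)" using assms(1) by (rule prob_space_PiM)
  have sets: "sets (PiM K L) = sets (PiM K (\<lambda>_. borel :: real measure))"
    using assms(2) by (intro sets_PiM_cong) auto
  show "distr (PiM K L) (\<Pi>\<^sub>M q\<in>K. borel) (\<lambda>\<omega>. \<lambda>q\<in>K. \<omega> q) = PiM K L"
  proof -
    have "distr (PiM K L) (\<Pi>\<^sub>M q\<in>K. borel) (\<lambda>\<omega>. \<lambda>q\<in>K. \<omega> q) = distr (PiM K L) (PiM K L) (\<lambda>\<omega>. \<omega>)"
      by (rule distr_cong) (auto simp: sets space_PiM PiE_restrict)
    then show ?thesis by simp
  qed
  show "(\<lambda>x. x q) \<in> borel_measurable (PiM K L)" if "q \<in> K" for q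
    using measurable_component_singleton[OF that, of L] assms(2)[OF that] by (simp cong: measurable_cong_sets)
qed (use assms in auto)

subsection \<open>Coupling with the multiclass measure\<close>

context exponential_cgm
begin

text \<open>By monotonicity the difference is almost surely nonnegative, so Markov's inequality
  applies to it, with mean \<open>\<kappa> - \<rho>\<close>.\<close>

lemma B_spread:
  assumes "1 < \<rho>" "\<rho> \<le> \<kappa>" "0 < \<epsilon>"
  shows "prob {\<omega>\<in>space M. \<epsilon> \<le> B \<kappa> (k - 1, s) (k, s) \<omega> - B \<rho> (k - 1, s) (k, s) \<omega>} \<le> (\<kappa> - \<rho>) / \<epsilon>"
proof -
  have B: "integrable M (B r (k - 1, s) (k, s))" "expectation (B r (k - 1, s) (k, s)) = r" if "1 < r" for r
  proof -
    have D: "distributed M lborel (B r (k - 1, s) (k, s)) (exponential_density (inverse r))"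
      using horizontal_exponential[OF that, of "(k, s)"] by (simp add: e1_def)
    show "integrable M (B r (k - 1, s) (k, s))"
      using erlang_ith_moment_integrable[OF _ D, of 1] that by simp
    show "expectation (B r (k - 1, s) (k, s)) = r"
      using exponential_distributed_expectation[OF _ D] that by (simp add: inverse_eq_divide)
  qed
  have "prob {\<omega>\<in>space M. \<epsilon> \<le> B \<kappa> (k - 1, s) (k, s) \<omega> - B \<rho> (k - 1, s) (k, s) \<omega>} \<le>
      expectation (\<lambda>\<omega>. B \<kappa> (k - 1, s) (k, s) \<omega> - B \<rho> (k - 1, s) (k, s) \<omega>) / \<epsilon>"
  proof (rule integral_Markov_inequality_measure[where A = "{}"])
    show "AE \<omega> in M. 0 \<le> B \<kappa> (k - 1, s) (k, s) \<omega> - B \<rho> (k - 1, s) (k, s) \<omega>"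
      using AE_B_mono[OF assms(1,2)] by eventually_elim simp
  qed (use B assms in auto)
  also have "expectation (\<lambda>\<omega>. B \<kappa> (k - 1, s) (k, s) \<omega> - B \<rho> (k - 1, s) (k, s) \<omega>) = \<kappa> - \<rho>"
    using B assms by simp
  finally show ?thesis .
qed

lemma exit_column_eventually_less:
  assumes "1 < \<kappa>" shows "\<forall>\<^sub>F N in sequentially. exit_column \<kappa> N < k"
proof -
  define a where "a = 1 / (\<kappa> - 1)\<^sup>2"
  have a: "0 < a" using assms by (simp add: a_def)
  obtain n0 :: nat where n0: "(\<bar>real_of_int k\<bar> + 2) / a < n0" using reals_Archimedean2 by blast
  show ?thesis using eventually_ge_at_top[of n0]
  proof eventually_elim
    case (elim N)
    then have "(\<bar>real_of_int k\<bar> + 2) / a < N" using n0 by linarith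
    then have "\<bar>real_of_int k\<bar> + 2 < a * N" using a by (simp add: field_simps)
    also have "a * N = real N / (\<kappa> - 1)\<^sup>2" by (simp add: a_def)
    finally show ?case unfolding exit_column_def by linarith
  qed
qed

text \<open>The auxiliary rows are the same for all \<open>N\<close>, so all evolved sequences and
  the Busemann rows live on one space, as convergence in probability requires.\<close>

definition coupling_space :: "real list \<Rightarrow> (nat \<times> int \<Rightarrow> real) measure" where
  "coupling_space \<rho> = (\<Pi>\<^sub>M q\<in>{..<length \<rho>} \<times> UNIV. exponential_law (\<rho> ! fst q))"

definition coupled_rows :: "int \<Rightarrow> nat \<Rightarrow> 'w \<times> (nat \<times> int \<Rightarrow> real) \<Rightarrow> nat \<Rightarrow> int \<Rightarrow> real" where
  "coupled_rows t N v r k = (if r < N then Y (k, t - int r) (fst v) else snd v (r - N, k))"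

lemma exp_rows_coupled_rows:
  assumes \<rho>: "\<And>j. j < length \<rho> \<Longrightarrow> 0 < \<rho> ! j"
  shows "exp_rows (M \<Otimes>\<^sub>M coupling_space \<rho>) (coupled_rows t N) (\<lambda>r. if r < N then 1 else \<rho> ! (r - N)) {..<N + length \<rho>}"
proof -
  let ?K = "{..<length \<rho>} \<times> (UNIV :: int set)"
  have "indep_law (coupling_space \<rho>) (\<lambda>q x. x q) (\<lambda>q. exponential_law (\<rho> ! fst q)) ?K"
    unfolding coupling_space_def by (rule indep_law_PiM) (use \<rho> prob_space_exponential_law in auto)
  note P = indep_law_product[OF Y_law this]
  define h :: "nat \<times> int \<Rightarrow> site + nat \<times> int" where
    "h = (\<lambda>(r, k). if r < N then Inl (k, t - int r) else Inr (r - N, k))"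
  have "inj_on h ({..<N + length \<rho>} \<times> UNIV)" "h ` ({..<N + length \<rho>} \<times> UNIV) \<subseteq> UNIV <+> ?K"
    by (auto simp: h_def inj_on_def split: if_splits)
  from indep_law_reindex[OF P this] show ?thesis
    unfolding exp_rows_def
    by (rule iffD1[OF indep_law_cong, rotated 2]) (auto simp: h_def coupled_rows_def)
qed

text \<open>The auxiliary row \<open>j\<close> first passes the auxiliary rows above it and then all
  \<open>N\<close> rows of weights, ending at level \<open>t\<close>.\<close>

definition evolved :: "int \<Rightarrow> nat \<Rightarrow> nat \<Rightarrow> 'w \<times> (nat \<times> int \<Rightarrow> real) \<Rightarrow> int \<Rightarrow> real" where
  "evolved t N j v = queue_stack (coupled_rows t N v) (N + j)"

text \<open>Each inequality is \<open>exit_increment_le\<close> at a column separating the exit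
  points of two parameters. The four exit conditions fail with vanishing probability; for the
  evolved sequence this holds because its boundary row and weights have the law of the Busemann
  problem of parameter \<open>\<rho> ! j\<close>.\<close>

lemma evolved_sandwich:
  assumes \<rho>: "sorted_wrt (<) (1 # \<rho>)" and j: "j < length \<rho>"
    and \<kappa>: "1 < \<kappa>'" "\<kappa>' < \<rho> ! j" "\<rho> ! j < \<kappa>"
  shows "\<exists>bad. bad \<longlonglongrightarrow> 0 \<and> (\<forall>\<^sub>F N in sequentially. \<exists>E \<in> sets (M \<Otimes>\<^sub>M coupling_space \<rho>).
    measure (M \<Otimes>\<^sub>M coupling_space \<rho>) E \<le> bad N \<and>
    (AE v in M \<Otimes>\<^sub>M coupling_space \<rho>. v \<notin> E \<longrightarrow>
      B \<kappa>' (k - 1, t) (k, t) (fst v) \<le> evolved t N j v k \<and> evolved t N j v k \<le> B \<kappa> (k - 1, t) (k, t) (fst v)))"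
proof -
  let ?P = "M \<Otimes>\<^sub>M coupling_space \<rho>" and ?r = "\<rho> ! j"
  have gt1: "1 < \<rho> ! i" if "i < length \<rho>" for i using \<rho> that by simp
  have inc: "\<rho> ! i < \<rho> ! i'" if "i < i'" "i' < length \<rho>" for i i' using \<rho> that by (simp add: sorted_wrt_nth_less)
  have r1: "1 < ?r" using gt1[OF j] .
  have \<kappa>1: "1 < \<kappa>" using \<kappa> r1 by simp
  interpret Q: prob_space "coupling_space \<rho>"
    unfolding coupling_space_def using gt1 by (intro prob_space_PiM prob_space_exponential_law) force
  interpret P: pair_prob_space M "coupling_space \<rho>" ..
  \<comment> \<open>Midpoints: the characteristic of \<open>l1\<close> separates the exits of
    \<open>\<rho> ! j\<close> and \<open>\<kappa>\<close>, that of \<open>l2\<close> those of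
    \<open>\<kappa>'\<close> and \<open>\<rho> ! j\<close>.\<close>
  define l1 where "l1 = (?r + \<kappa>) / 2"
  define l2 where "l2 = (\<kappa>' + ?r) / 2"
  have l: "1 < l1" "?r < l1" "l1 < \<kappa>" "1 < l2" "\<kappa>' < l2" "l2 < ?r" using \<kappa> r1 by (simp_all add: l1_def l2_def)
  \<comment> \<open>The sequence as it leaves the auxiliary rows; it is the boundary below the
    \<open>N\<close> rows of weights.\<close>
  define A where "A N v = foldl queue_map (coupled_rows t N v (N + j)) (map (coupled_rows t N v) (rev [N..<N + j]))" for N v
  define zA where "zA N v = (coupled_rows t N v)(N := A N v)" for N v
  have zA: "exp_rows ?P (zA N) ((\<lambda>_. 1)(N := ?r)) {..N}" for N
  proof -
    have "exp_rows ?P (coupled_rows t N) (\<lambda>r. if r < N then 1 else \<rho> ! (r - N)) {..N + j}"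
      by (rule exp_rows_subset[OF exp_rows_coupled_rows]) (use gt1 j in \<open>force+\<close>)
    note dep = exp_rows_departures[OF this, of N]
    have "0 < (if i < N then 1 else \<rho> ! (i - N)) \<and>
        (if i < N then 1 else \<rho> ! (i - N)) < (if N + j < N then 1 else \<rho> ! (N + j - N))"
      if "N \<le> i" "i < N + j" for i
    proof -
      have "i - N < j" using that by simp
      then have "1 < \<rho> ! (i - N)" "\<rho> ! (i - N) < \<rho> ! j" using gt1[of "i - N"] inc[of "i - N" j] j by simp_all
      then show ?thesis using that by simp
    qed
    from dep[OF _ this]
    have "exp_rows ?P (zA N) ((\<lambda>r. if r < N then 1 else \<rho> ! (r - N))(N := ?r)) {..N}"
      unfolding zA_def A_def by simp
    then show ?thesis
      by (rule iffD1[OF exp_rows_cong, rotated 2]) auto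
  qed
  \<comment> \<open>\<open>b1\<close> and \<open>b2\<close> spoil the upper bound, \<open>b3\<close>
    and \<open>b4\<close> the lower one; the endpoints \<open>k\<close> and \<open>k - 1\<close> are
    those of \<open>exit_increment_le\<close>.\<close>
  define b1 where "b1 N = {v\<in>space ?P. \<not> rows_exit_left (zA N v) N (exit_column l1 N) k}" for N
  define b2 where "b2 N = {\<omega>\<in>space M. \<not> rows_exit_right (level_rows \<kappa> t N \<omega>) N (exit_column l1 N) (k - 1)}" for N
  define b3 where "b3 N = {\<omega>\<in>space M. \<not> rows_exit_left (level_rows \<kappa>' t N \<omega>) N (exit_column l2 N) k}" for N
  define b4 where "b4 N = {v\<in>space ?P. \<not> rows_exit_right (zA N v) N (exit_column l2 N) (k - 1)}" for N
  have m14: "b1 N \<in> sets ?P" "b4 N \<in> sets ?P" for N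
    using measurable_rows_exit[where z = "zA N" and N = N and M = ?P] exp_rows_measurable[OF zA, of _ N]
    unfolding b1_def b4_def by (simp_all add: pred_def)
  have m23: "b2 N \<in> sets M" "b3 N \<in> sets M" for N
    using measurable_rows_exit[where z = "level_rows \<kappa> t N" and N = N and M = M] exp_rows_measurable[OF exp_rows_level_rows[OF \<kappa>1], of _ N]
      measurable_rows_exit[where z = "level_rows \<kappa>' t N" and N = N and M = M] exp_rows_measurable[OF exp_rows_level_rows[OF \<kappa>(1)], of _ N]
    unfolding b2_def b3_def by (simp_all add: pred_def)
  have p14: "measure ?P (b1 N) = prob {\<omega>\<in>space M. \<not> rows_exit_left (level_rows ?r t N \<omega>) N (exit_column l1 N) k}"
    "measure ?P (b4 N) = prob {\<omega>\<in>space M. \<not> rows_exit_right (level_rows ?r t N \<omega>) N (exit_column l2 N) (k - 1)}" for N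
    unfolding b1_def b4_def using rows_exit_prob_eq[OF zA exp_rows_level_rows[OF r1]] by simp_all
  define bad where "bad N = measure ?P (b1 N) + prob (b2 N) + (prob (b3 N) + measure ?P (b4 N))" for N
  have "bad \<longlonglongrightarrow> 0 + 0 + (0 + 0)"
    unfolding bad_def p14 b2_def b3_def
    by (intro tendsto_add exit_prob) (use l \<kappa> r1 in auto)
  then have "bad \<longlonglongrightarrow> 0" by simp
  moreover have "\<forall>\<^sub>F N in sequentially. \<exists>E \<in> sets ?P. measure ?P E \<le> bad N \<and> (AE v in ?P. v \<notin> E \<longrightarrow>
      B \<kappa>' (k - 1, t) (k, t) (fst v) \<le> evolved t N j v k \<and> evolved t N j v k \<le> B \<kappa> (k - 1, t) (k, t) (fst v))"
    using exit_column_eventually_less[OF l(1), of k] exit_column_eventually_less[OF l(4), of k] eventually_gt_at_top[of 0]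
  proof eventually_elim
    case (elim N)
    let ?c2 = "b2 N \<times> space (coupling_space \<rho>)" and ?c3 = "b3 N \<times> space (coupling_space \<rho>)"
    have c: "?c2 \<in> sets ?P" "?c3 \<in> sets ?P" using m23 by auto
    have pc: "measure ?P ?c2 = prob (b2 N)" "measure ?P ?c3 = prob (b3 N)"
      using Q.emeasure_pair_measure_Times[OF m23(1), of "space (coupling_space \<rho>)"]
        Q.emeasure_pair_measure_Times[OF m23(2), of "space (coupling_space \<rho>)"] Q.emeasure_space_1
      by (simp_all add: measure_def)
    let ?E = "(b1 N \<union> ?c2) \<union> (?c3 \<union> b4 N)"
    have "measure ?P ?E \<le> bad N"
    proof -
      have "measure ?P ?E \<le> measure ?P (b1 N \<union> ?c2) + measure ?P (?c3 \<union> b4 N)"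
        by (rule measure_Un_le) (use m14 c in auto)
      moreover have "measure ?P (b1 N \<union> ?c2) \<le> measure ?P (b1 N) + measure ?P ?c2"
        by (rule measure_Un_le) (use m14 c in auto)
      moreover have "measure ?P (?c3 \<union> b4 N) \<le> measure ?P ?c3 + measure ?P (b4 N)"
        by (rule measure_Un_le) (use m14 c in auto)
      ultimately show ?thesis unfolding bad_def pc by linarith
    qed
    moreover have "AE v in ?P. v \<notin> ?E \<longrightarrow>
      B \<kappa>' (k - 1, t) (k, t) (fst v) \<le> evolved t N j v k \<and> evolved t N j v k \<le> B \<kappa> (k - 1, t) (k, t) (fst v)"
    proof -
      have "AE v in ?P. \<forall>r\<in>{..N}. good (zA N v r) (((\<lambda>_. 1)(N := ?r)) r)"
        by (subst AE_ball_countable) (use exp_rows_good[OF zA] r1 in auto)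
      moreover note AE_pair_fst[OF Q.prob_space_axioms AE_B_field[OF \<kappa>1, of t N]]
        AE_pair_fst[OF Q.prob_space_axioms AE_B_field[OF \<kappa>(1), of t N]]
      ultimately show ?thesis
        using AE_space
      proof eventually_elim
        case v: (elim v)
        let ?w = "\<lambda>s k. Y (k, t - int (N - 1 - s)) (fst v)"
        let ?F = "queue_field (A N v) ?w"
        have N: "N - 1 < N" "Suc (N - 1) = N" using elim by auto
        have wA: "(\<lambda>s. zA N v (N - 1 - s)) = ?w" "zA N v N = A N v"
          using elim by (auto simp: zA_def coupled_rows_def fun_eq_iff)
        have good: "good (A N v) ?r" "good (?w s) 1" for s
        proof -
          have "good (zA N v N) (((\<lambda>_. 1)(N := ?r)) N)"
            "good (zA N v (N - 1 - s)) (((\<lambda>_. 1)(N := ?r)) (N - 1 - s))"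
            using bspec[OF v(1), of N] bspec[OF v(1), of "N - 1 - s"] by simp_all
          moreover have "N - 1 - s \<noteq> N" using elim(3) by simp
          ultimately show "good (A N v) ?r" "good (?w s) 1"
            using wA(2) fun_cong[OF wA(1), of s] by simp_all
        qed
        have wgood: "\<exists>b<?r. good (?w s) b" for s using good(2)[of s] r1 by blast
        have F: "lpp_field ?w N ?F" by (rule lpp_field_queue_field[OF good(1) wgood])
        have Fk: "evolved t N j v k = ?F N k - ?F N (k - 1)"
        proof -
          \<comment> \<open>The servers split into the auxiliary ones, already accounted for in
            \<open>A\<close>, and the rows of weights; reversing \<open>[0..<N]\<close> makes the
            numbering run upwards.\<close>
          have rv: "rev [0..<N + j] = rev [N..<N + j] @ rev [0..<N]"
            using upt_add_eq_append[of 0 N j] by simp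
          have "map (coupled_rows t N v) (rev [0..<N]) = map ?w [0..<N]"
            by (rule nth_equalityI) (auto simp: rev_nth coupled_rows_def fun_eq_iff)
          then have "evolved t N j v = foldl queue_map (A N v) (map ?w [0..<N])"
            unfolding evolved_def queue_stack_def rv by (simp add: A_def)
          then show ?thesis using queue_field_increments[OF good(1) wgood, where s = N and k = k] by simp
        qed
        have BF: "B_field r t N (fst v) N k - B_field r t N (fst v) N (k - 1) = B r (k - 1, t) (k, t) (fst v)"
          if "r = \<kappa> \<or> r = \<kappa>'" for r
        proof -
          have "B_field r t N (fst v) N k - B_field r t N (fst v) N (k - 1) =
              B r (k - 1, t - int N + int N) (k, t - int N + int N) (fst v)"
            using that v(2,3) by blast
          then show ?thesis by simp
        qed
        show ?case
        proof (intro impI conjI)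
          assume nE: "v \<notin> ?E"
          have "rows_exit_left (zA N v) N (exit_column l1 N) k" "rows_exit_right (zA N v) N (exit_column l2 N) (k - 1)"
            using nE v(4) by (auto simp: b1_def b4_def)
          then have A14: "exit_left ?w (N - 1) (?F 0) (exit_column l1 N) k"
            "exit_right ?w (N - 1) (?F 0) (exit_column l2 N) (k - 1)"
            unfolding rows_exit_left_def rows_exit_right_def wA by simp_all
          have B0: "level_rows \<kappa> t N (fst v) N = (\<lambda>k. B \<kappa> (k - 1, t - int N) (k, t - int N) (fst v))"
            "level_rows \<kappa>' t N (fst v) N = (\<lambda>k. B \<kappa>' (k - 1, t - int N) (k, t - int N) (fst v))"
            by (rule level_rows_bottom)+
          have "rows_exit_right (level_rows \<kappa> t N (fst v)) N (exit_column l1 N) (k - 1)"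
            "rows_exit_left (level_rows \<kappa>' t N (fst v)) N (exit_column l2 N) k"
            using nE v(4) by (auto simp: b2_def b3_def space_pair_measure mem_Times_iff)
          then have B23: "exit_right ?w (N - 1) (B_field \<kappa> t N (fst v) 0) (exit_column l1 N) (k - 1)"
            "exit_left ?w (N - 1) (B_field \<kappa>' t N (fst v) 0) (exit_column l2 N) k"
            unfolding rows_exit_left_def rows_exit_right_def level_rows_weights[OF elim(3)] B0
            using v(2,3) by simp_all
          note A14(1)
          moreover note B23(1)
          ultimately have "?F (Suc (N - 1)) k - ?F (Suc (N - 1)) (k - 1) \<le>
              B_field \<kappa> t N (fst v) (Suc (N - 1)) k - B_field \<kappa> t N (fst v) (Suc (N - 1)) (k - 1)"
            using v(2) elim(1) by (intro exit_increment_le[OF F _ N(1)]) auto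
          then show "evolved t N j v k \<le> B \<kappa> (k - 1, t) (k, t) (fst v)"
            unfolding N(2) Fk using BF[of \<kappa>] by simp
          note B23(2)
          moreover note A14(2)
          ultimately have "B_field \<kappa>' t N (fst v) (Suc (N - 1)) k - B_field \<kappa>' t N (fst v) (Suc (N - 1)) (k - 1) \<le>
              ?F (Suc (N - 1)) k - ?F (Suc (N - 1)) (k - 1)"
            using v(3) elim(2) by (intro exit_increment_le[OF _ F N(1)]) auto
          then show "B \<kappa>' (k - 1, t) (k, t) (fst v) \<le> evolved t N j v k"
            unfolding N(2) Fk using BF[of \<kappa>'] by simp
        qed
      qed
    qed
    ultimately show ?case using m14 c by (intro bexI[of _ ?E]) auto
  qed
  ultimately show ?thesis by blast
qed

lemma evolved_tendsto:
  assumes \<rho>: "sorted_wrt (<) (1 # \<rho>)" and j: "j < length \<rho>" and e: "0 < \<epsilon>"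
  shows "(\<lambda>N. measure (M \<Otimes>\<^sub>M coupling_space \<rho>) {v\<in>space (M \<Otimes>\<^sub>M coupling_space \<rho>).
    \<epsilon> < \<bar>evolved t N j v k - B (\<rho> ! j) (k - 1, t) (k, t) (fst v)\<bar>}) \<longlonglongrightarrow> 0"
proof (rule LIMSEQ_I)
  let ?P = "M \<Otimes>\<^sub>M coupling_space \<rho>" and ?r = "\<rho> ! j"
  let ?D = "\<lambda>N. {v\<in>space ?P. \<epsilon> < \<bar>evolved t N j v k - B ?r (k - 1, t) (k, t) (fst v)\<bar>}"
  have gt1: "1 < \<rho> ! i" if "i < length \<rho>" for i using \<rho> that by simp
  have r1: "1 < ?r" using gt1[OF j] .
  interpret Q: prob_space "coupling_space \<rho>"
    unfolding coupling_space_def using gt1 by (intro prob_space_PiM prob_space_exponential_law) force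
  interpret P: pair_prob_space M "coupling_space \<rho>" ..
  fix d :: real assume d: "0 < d"
  \<comment> \<open>The first bound keeps \<open>\<kappa>'\<close> above 1; the second makes the
    Markov bound \<open>2 * \<eta> / \<epsilon>\<close> at most \<open>d / 4\<close>.\<close>
  define \<eta> where "\<eta> = min ((?r - 1) / 2) (d * \<epsilon> / 8)"
  have "0 < \<eta>" unfolding \<eta>_def using r1 d e by simp
  moreover have "\<eta> \<le> (?r - 1) / 2" unfolding \<eta>_def by (rule min.cobounded1)
  moreover have "\<eta> \<le> d * \<epsilon> / 8" unfolding \<eta>_def by (rule min.cobounded2)
  ultimately have \<eta>: "0 < \<eta>" "\<eta> \<le> (?r - 1) / 2" "\<eta> \<le> d * \<epsilon> / 8" .
  define \<kappa>' \<kappa> where "\<kappa>' = ?r - \<eta>" and "\<kappa> = ?r + \<eta>"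
  have \<kappa>: "1 < \<kappa>'" "\<kappa>' < ?r" "?r < \<kappa>" "1 < \<kappa>" "\<kappa>' \<le> \<kappa>" "\<kappa> - \<kappa>' = 2 * \<eta>"
    using \<eta> r1 by (simp_all add: \<kappa>'_def \<kappa>_def field_simps)
  obtain bad where bad: "bad \<longlonglongrightarrow> (0::real)" and ev: "\<forall>\<^sub>F N in sequentially. \<exists>E \<in> sets ?P.
    measure ?P E \<le> bad N \<and> (AE v in ?P. v \<notin> E \<longrightarrow>
      B \<kappa>' (k - 1, t) (k, t) (fst v) \<le> evolved t N j v k \<and> evolved t N j v k \<le> B \<kappa> (k - 1, t) (k, t) (fst v))"
    using evolved_sandwich[OF \<rho> j \<kappa>(1-3), of k t] by blast
  \<comment> \<open>Off \<open>S\<close> and the exceptional set \<open>E\<close>, both the evolved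
    increment and the Busemann increment of parameter \<open>\<rho> ! j\<close> lie in an interval
    shorter than \<open>\<epsilon>\<close>.\<close>
  define S where "S = {\<omega>\<in>space M. \<epsilon> \<le> B \<kappa> (k - 1, t) (k, t) \<omega> - B \<kappa>' (k - 1, t) (k, t) \<omega>}"
  have S: "S \<in> sets M"
    unfolding S_def using B_measurable[OF \<kappa>(1)] B_measurable[OF \<kappa>(4)] by measurable
  have pS: "prob S \<le> d / 4"
  proof -
    have "prob S \<le> (\<kappa> - \<kappa>') / \<epsilon>" unfolding S_def by (rule B_spread[OF \<kappa>(1,5) e])
    also have "\<dots> \<le> d / 4" using \<eta>(3) e unfolding \<kappa>(6) by (simp add: field_simps)
    finally show ?thesis .
  qed
  have S': "S \<times> space (coupling_space \<rho>) \<in> sets ?P" "measure ?P (S \<times> space (coupling_space \<rho>)) = prob S"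
    using S Q.emeasure_pair_measure_Times[OF S, of "space (coupling_space \<rho>)"] Q.emeasure_space_1
    by (auto simp: measure_def)
  have "\<forall>\<^sub>F N in sequentially. bad N < d / 2"
    using bad d by (intro order_tendstoD) auto
  with ev have "\<forall>\<^sub>F N in sequentially. norm (measure ?P (?D N) - 0) < d"
  proof eventually_elim
    case (elim N)
    then obtain E where E: "E \<in> sets ?P" "measure ?P E \<le> bad N"
      "AE v in ?P. v \<notin> E \<longrightarrow> B \<kappa>' (k - 1, t) (k, t) (fst v) \<le> evolved t N j v k \<and> evolved t N j v k \<le> B \<kappa> (k - 1, t) (k, t) (fst v)"
      by blast
    have "measure ?P (?D N) \<le> measure ?P (E \<union> S \<times> space (coupling_space \<rho>))"
    proof (rule P.finite_measure_mono_AE)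
      show "AE v in ?P. v \<in> ?D N \<longrightarrow> v \<in> E \<union> S \<times> space (coupling_space \<rho>)"
        using E(3) AE_pair_fst[OF Q.prob_space_axioms AE_B_mono[OF \<kappa>(1) less_imp_le[OF \<kappa>(2)]]]
          AE_pair_fst[OF Q.prob_space_axioms AE_B_mono[OF r1 less_imp_le[OF \<kappa>(3)]]]
      proof eventually_elim
        case (elim v)
        show ?case
        proof (rule impI, rule ccontr)
          assume D: "v \<in> ?D N" and n: "v \<notin> E \<union> S \<times> space (coupling_space \<rho>)"
          then have "B \<kappa>' (k - 1, t) (k, t) (fst v) \<le> evolved t N j v k"
            "evolved t N j v k \<le> B \<kappa> (k - 1, t) (k, t) (fst v)" using elim(1) by auto
          moreover have "B \<kappa>' (k - 1, t) (k, t) (fst v) \<le> B ?r (k - 1, t) (k, t) (fst v)"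
            "B ?r (k - 1, t) (k, t) (fst v) \<le> B \<kappa> (k - 1, t) (k, t) (fst v)" using elim(2,3) by auto
          moreover have "B \<kappa> (k - 1, t) (k, t) (fst v) - B \<kappa>' (k - 1, t) (k, t) (fst v) < \<epsilon>"
            using D n by (auto simp: S_def space_pair_measure mem_Times_iff)
          moreover have "\<epsilon> < \<bar>evolved t N j v k - B ?r (k - 1, t) (k, t) (fst v)\<bar>" using D by simp
          ultimately show False by linarith
        qed
      qed
    qed (use E S' in auto)
    also have "\<dots> \<le> measure ?P E + prob S"
      using measure_Un_le[OF E(1) S'(1)] S'(2) by simp
    finally show ?case using E(2) elim(2) pS d by simp
  qed
  then show "\<exists>no. \<forall>N\<ge>no. norm (measure ?P (?D N) - 0) < d"
    by (simp add: eventually_sequentially)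
qed

lemma busemann_multiclass:
  assumes \<rho>: "sorted_wrt (<) (1 # \<rho>)"
  shows "distr M (\<Pi>\<^sub>M i\<in>{..<Suc (length \<rho>)}. sequence_space)
      (\<lambda>\<omega>. \<lambda>i\<in>{..<Suc (length \<rho>)}. case i of 0 \<Rightarrow> (\<lambda>k. Y (k, t) \<omega>) | Suc j \<Rightarrow> (\<lambda>k. B (\<rho> ! j) (k - 1, t) (k, t) \<omega>)) =
    multiclass_measure (1 # \<rho>)"
proof -
  let ?P = "M \<Otimes>\<^sub>M coupling_space \<rho>" and ?R = "{..<Suc (length \<rho>)}"
  let ?S = "\<Pi>\<^sub>M i\<in>{..<Suc (length \<rho>)}. sequence_space"
  have gt1: "1 < \<rho> ! i" if "i < length \<rho>" for i using \<rho> that by simp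
  interpret Q: prob_space "coupling_space \<rho>"
    unfolding coupling_space_def using gt1 by (intro prob_space_PiM prob_space_exponential_law) force
  interpret P: pair_prob_space M "coupling_space \<rho>" ..
  define V where "V \<omega> i = (case i of 0 \<Rightarrow> (\<lambda>k. Y (k, t) \<omega>) | Suc j \<Rightarrow> (\<lambda>k. B (\<rho> ! j) (k - 1, t) (k, t) \<omega>))" for \<omega> i
  \<comment> \<open>There are \<open>Suc N\<close> rows of weights, because the top one is itself a
    component of the tuple.\<close>
  define X where "X N v i = (case i of 0 \<Rightarrow> coupled_rows t (Suc N) v 0 | Suc j \<Rightarrow> queue_stack (coupled_rows t (Suc N) v) (Suc N + j))" for N v i
  have rows: "exp_rows ?P (coupled_rows t N) (\<lambda>r. if r < N then 1 else \<rho> ! (r - N)) {..<N + length \<rho>}" for N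
    by (rule exp_rows_coupled_rows) (use gt1 in force)
  have law: "distr ?P ?S (\<lambda>v. \<lambda>i\<in>?R. X N v i) = multiclass_measure (1 # \<rho>)" for N
    unfolding X_def by (rule multiclass_law_stationary[OF rows[of "Suc N"]]) (use \<rho> in auto)
  have Vm: "(\<lambda>\<omega>. V \<omega> i k) \<in> borel_measurable M" if "i \<in> ?R" for i k
    using that gt1 B_measurable indep_law_measurable[OF Y_law] by (cases i) (auto simp: V_def)
  have Xm: "(\<lambda>v. X N v i k) \<in> borel_measurable ?P" if i: "i \<in> ?R" for N i k
  proof (cases i)
    case 0
    then show ?thesis using exp_rows_measurable[OF rows[of "Suc N"], of 0 k] by (simp add: X_def)
  next
    case (Suc j)
    have "(\<lambda>v. queue_stack (coupled_rows t (Suc N) v) (Suc N + j)) \<in> measurable ?P sequence_space"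
      by (rule measurable_queue_stack, rule exp_rows_measurable[OF rows[of "Suc N"]]) (use i Suc in auto)
    from measurable_compose[OF this measurable_component_singleton[of k]]
    show ?thesis using Suc by (simp add: X_def)
  qed
  have fdd: "measure ?P {v\<in>space ?P. \<forall>(i, k)\<in>F. X N v i k \<in> A (i, k)} =
      measure (multiclass_measure (1 # \<rho>)) {x\<in>space ?S. \<forall>(i, k)\<in>F. x i k \<in> A (i, k)}"
    if F: "finite F" "F \<subseteq> ?R \<times> UNIV" and A: "\<And>q. q \<in> F \<Longrightarrow> A q \<in> sets (borel :: real measure)" for N F A
  proof -
    have f: "(\<lambda>v. \<lambda>i\<in>?R. X N v i) \<in> measurable ?P ?S"
      by (intro measurable_restrict measurable_sequenceI Xm)
    have "{x\<in>space ?S. \<forall>q\<in>F. (\<lambda>q x. x (fst q) (snd q)) q x \<in> A q} \<in> sets ?S"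
    proof (rule sets_Collect_family[OF F(1)])
      fix q assume "q \<in> F"
      then have "fst q \<in> ?R" using F(2) by auto
      show "(\<lambda>x. x (fst q) (snd q)) \<in> borel_measurable ?S"
        by (rule measurable_compose[OF measurable_component_singleton[OF \<open>fst q \<in> ?R\<close>]]) simp
    qed (rule A)
    then have S: "{x\<in>space ?S. \<forall>(i, k)\<in>F. x i k \<in> A (i, k)} \<in> sets ?S" by (simp add: case_prod_unfold)
    have "measure (multiclass_measure (1 # \<rho>)) {x\<in>space ?S. \<forall>(i, k)\<in>F. x i k \<in> A (i, k)} =
        measure ?P ((\<lambda>v. \<lambda>i\<in>?R. X N v i) -` {x\<in>space ?S. \<forall>(i, k)\<in>F. x i k \<in> A (i, k)} \<inter> space ?P)"
      unfolding law[of N, symmetric] by (rule measure_distr[OF f S])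
    also have "(\<lambda>v. \<lambda>i\<in>?R. X N v i) -` {x\<in>space ?S. \<forall>(i, k)\<in>F. x i k \<in> A (i, k)} \<inter> space ?P =
        {v\<in>space ?P. \<forall>(i, k)\<in>F. X N v i k \<in> A (i, k)}"
      using measurable_space[OF f] F(2) by fastforce
    finally show ?thesis ..
  qed
  have "distr M ?S (\<lambda>\<omega>. \<lambda>i\<in>?R. V \<omega> i) = distr ?P ?S (\<lambda>v. \<lambda>i\<in>?R. X 0 v i)"
  proof (rule distr_rows_eqI[OF prob_space_axioms P.prob_space_axioms Vm Xm])
    fix F :: "(nat \<times> int) set" and A
    assume F: "finite F" "F \<subseteq> ?R \<times> UNIV" and A: "\<And>q. q \<in> F \<Longrightarrow> A q \<in> sets (borel :: real measure)"
    let ?X = "\<lambda>N q v. X N v (fst q) (snd q)" and ?V = "\<lambda>q v. V (fst v) (fst q) (snd q)"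
    have Vf: "{\<omega>\<in>space M. \<forall>q\<in>F. V \<omega> (fst q) (snd q) \<in> A q} \<in> sets M"
      by (rule sets_Collect_family) (use F A Vm in auto)
    have "measure M {\<omega>\<in>space M. \<forall>q\<in>F. V \<omega> (fst q) (snd q) \<in> A q} = measure ?P {v\<in>space ?P. \<forall>q\<in>F. ?V q v \<in> A q}"
      by (rule measure_pair_fst[OF prob_space_axioms Q.prob_space_axioms Vf, symmetric])
    also have "\<dots> = measure ?P {v\<in>space ?P. \<forall>q\<in>F. ?X 0 q v \<in> A q}"
    proof (rule law_eq_of_tendsto_prob[OF P.prob_space_axioms F(1) _ _ _ _ A])
      show "?X N q \<in> borel_measurable ?P" if "q \<in> F" for N q
        by (rule Xm) (use F that in auto)
      show "?V q \<in> borel_measurable ?P" if "q \<in> F" for q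
        by (rule measurable_compose[OF measurable_fst Vm]) (use F that in auto)
      show "measure ?P {v\<in>space ?P. \<forall>q\<in>F. ?X N q v \<le> c q} = measure ?P {v\<in>space ?P. \<forall>q\<in>F. ?X 0 q v \<le> c q}" for N c
        using fdd[OF F, of "\<lambda>q. {..c q}" N] fdd[OF F, of "\<lambda>q. {..c q}" 0] by (simp add: case_prod_unfold)
      fix q and \<epsilon> :: real assume q: "q \<in> F" and e: "0 < \<epsilon>"
      obtain i k where ik: "q = (i, k)" by (cases q)
      have i: "i \<in> ?R" using q F ik by auto
      show "(\<lambda>N. measure ?P {v\<in>space ?P. \<epsilon> < \<bar>?X N q v - ?V q v\<bar>}) \<longlonglongrightarrow> 0"
      proof (cases i)
        \<comment> \<open>The top weights are common to all \<open>N\<close>, so this component does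
          not move at all.\<close>
        case 0
        then have "?X N q v = ?V q v" for N v unfolding ik by (simp add: X_def V_def coupled_rows_def)
        then show ?thesis using e by simp
      next
        case (Suc j)
        then have "j < length \<rho>" using i by simp
        from LIMSEQ_Suc[OF evolved_tendsto[OF \<rho> this e, of t k]] show ?thesis
          unfolding ik Suc by (simp add: X_def V_def evolved_def)
      qed
    qed
    finally show "measure M {\<omega>\<in>space M. \<forall>(i, k)\<in>F. V \<omega> i k \<in> A (i, k)} = measure ?P {v\<in>space ?P. \<forall>(i, k)\<in>F. X 0 v i k \<in> A (i, k)}"
      by (simp add: case_prod_unfold)
  qed
  then show ?thesis unfolding law[of 0] V_def .
qed

end

theorem theorem3p2:
  fixes M :: "'w measure"
    and Y :: "int \<times> int \<Rightarrow> 'w \<Rightarrow> real"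
    and B :: "real \<Rightarrow> int \<times> int \<Rightarrow> int \<times> int \<Rightarrow> 'w \<Rightarrow> real"
    and \<rho> :: "real list"
    and t :: int
  assumes "prob_space M"
    and "prob_space.indep_vars M (\<lambda>_. borel) Y UNIV"
    and "\<And>x. distributed M lborel (Y x) (exponential_density 1)"
    and "busemann_process M Y B"
    and "\<rho> \<noteq> []"
    and "sorted_wrt (<) (1 # \<rho>)"
  shows "distr M (\<Pi>\<^sub>M i\<in>{..<Suc (length \<rho>)}. sequence_space)
           (\<lambda>\<omega>. \<lambda>i\<in>{..<Suc (length \<rho>)}.
              case i of
                0 \<Rightarrow> (\<lambda>k. Y (k, t) \<omega>)
              | Suc j \<Rightarrow> (\<lambda>k. B (\<rho> ! j) (k - 1, t) (k, t) \<omega>))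
         = multiclass_measure (1 # \<rho>)"
proof -
  interpret exponential_cgm M Y B
    using assms by (intro exponential_cgm.intro exponential_cgm_axioms.intro)
  show ?thesis by (rule busemann_multiclass[OF assms(6)])
qed

end
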